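(* Let $2<p<\infty$, and let $G$ be a closed subgroup of $\mathcal{U}_p(\ell^2)$ with property (FH). Then $G$ is a compact Lie group.
   Context: $\ell^2$ is the separable infinite-dimensional complex Hilbert space. $\mathcal{U}_p(\ell^2)$ is the Schatten $p$-unitary group: the group of all unitaries $u$ on $\ell^2$ such that $u-1$ belongs to the Schatten $p$-class, with the topology of the metric $d(u,v)=\|u-v\|_p$, where $\|x\|_p=\mathrm{Tr}(|x|^p)^{1/p}$. A topological group has property (FH) if every continuous affine isometric action of it on a real Hilbert space has a fixed point. *)

theory Defs
  imports "HOL-Analysis.Analysis" "HOL-Algebra.Module" "HOL-Algebra.Group_Action"
begin

section \<open>The Hilbert space \<open>\<ell>\<^sup>2\<close>\<close>

typedef ell2 = "{x :: nat \<Rightarrow> complex. summable (\<lambda>n. (cmod (x n))\<^sup>2)}"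
  morphisms coord Abs_ell2
  by (rule exI[of _ "\<lambda>_. 0"]) simp

setup_lifting type_definition_ell2

lemma summable_coord: "summable (\<lambda>n. (cmod (coord x n))\<^sup>2)"
  using coord[of x] by simp

lemma summable_norm_coord_mult:
  "summable (\<lambda>n. cmod (coord x n) * cmod (coord y n))"
proof (rule summable_comparison_test')
  show "summable (\<lambda>n. (cmod (coord x n))\<^sup>2 + (cmod (coord y n))\<^sup>2)"
    by (intro summable_add summable_coord)
  fix n :: nat
  have "2 * cmod (coord x n) * cmod (coord y n) \<le> (cmod (coord x n))\<^sup>2 + (cmod (coord y n))\<^sup>2"
    by (rule sum_squares_bound)
  moreover have "0 \<le> cmod (coord x n) * cmod (coord y n)"
    by simp
  ultimately have "cmod (coord x n) * cmod (coord y n)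
      \<le> (cmod (coord x n))\<^sup>2 + (cmod (coord y n))\<^sup>2"
    by linarith
  then show "norm (cmod (coord x n) * cmod (coord y n))
      \<le> (cmod (coord x n))\<^sup>2 + (cmod (coord y n))\<^sup>2"
    by simp
qed

lemma summable_inner_coord: "summable (\<lambda>n. coord x n \<bullet> coord y n)"
  by (rule summable_comparison_test'[OF summable_norm_coord_mult[of x y]])
     (simp add: Cauchy_Schwarz_ineq2)

instantiation ell2 :: real_inner
begin

lift_definition zero_ell2 :: ell2 is "\<lambda>_. 0"
  by simp

lift_definition plus_ell2 :: "ell2 \<Rightarrow> ell2 \<Rightarrow> ell2" is "\<lambda>x y n. x n + y n"
proof -
  fix x y :: "nat \<Rightarrow> complex"
  assume s: "summable (\<lambda>n. (cmod (x n))\<^sup>2)" "summable (\<lambda>n. (cmod (y n))\<^sup>2)"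
  show "summable (\<lambda>n. (cmod (x n + y n))\<^sup>2)"
  proof (rule summable_comparison_test')
    show "summable (\<lambda>n. 2 * (cmod (x n))\<^sup>2 + 2 * (cmod (y n))\<^sup>2)"
      by (intro summable_add summable_mult s)
    fix n :: nat
    have "(cmod (x n + y n))\<^sup>2 \<le> (cmod (x n) + cmod (y n))\<^sup>2"
      by (intro power_mono norm_triangle_ineq) simp
    also have "\<dots> \<le> 2 * (cmod (x n))\<^sup>2 + 2 * (cmod (y n))\<^sup>2"
      using sum_squares_bound[of "cmod (x n)" "cmod (y n)"] by (simp add: power2_sum)
    finally show "norm ((cmod (x n + y n))\<^sup>2) \<le> 2 * (cmod (x n))\<^sup>2 + 2 * (cmod (y n))\<^sup>2"
      by simp
  qed
qed

lift_definition uminus_ell2 :: "ell2 \<Rightarrow> ell2" is "\<lambda>x n. - x n"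
  by simp

definition minus_ell2 :: "ell2 \<Rightarrow> ell2 \<Rightarrow> ell2"
  where "minus_ell2 x y = x + (- y)"

lift_definition scaleR_ell2 :: "real \<Rightarrow> ell2 \<Rightarrow> ell2" is "\<lambda>r x n. r *\<^sub>R x n"
  by (simp add: power_mult_distrib summable_mult)

text \<open>The real inner product, i.e. the real part of the complex one.\<close>

definition inner_ell2 :: "ell2 \<Rightarrow> ell2 \<Rightarrow> real"
  where "inner_ell2 x y = (\<Sum>n. coord x n \<bullet> coord y n)"

definition norm_ell2 :: "ell2 \<Rightarrow> real"
  where "norm_ell2 x = sqrt (x \<bullet> x)"

definition sgn_ell2 :: "ell2 \<Rightarrow> ell2"
  where "sgn_ell2 x = inverse (norm x) *\<^sub>R x"

definition dist_ell2 :: "ell2 \<Rightarrow> ell2 \<Rightarrow> real"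
  where "dist_ell2 x y = norm (x - y)"

definition uniformity_ell2 :: "(ell2 \<times> ell2) filter"
  where "uniformity_ell2 = (INF e\<in>{0<..}. principal {(x, y). dist x y < e})"

definition open_ell2 :: "ell2 set \<Rightarrow> bool"
  where "open_ell2 U \<longleftrightarrow> (\<forall>x\<in>U. eventually (\<lambda>(x', y). x' = x \<longrightarrow> y \<in> U) uniformity)"

instance
proof
  fix x y z :: ell2 and r s :: real
  show "x + y + z = x + (y + z)" "x + y = y + x" "0 + x = x" "- x + x = 0"
    by (transfer; simp add: algebra_simps)+
  show "x - y = x + - y"
    by (rule minus_ell2_def)
  show "r *\<^sub>R (x + y) = r *\<^sub>R x + r *\<^sub>R y" "(r + s) *\<^sub>R x = r *\<^sub>R x + s *\<^sub>R x"
    "r *\<^sub>R s *\<^sub>R x = (r * s) *\<^sub>R x" "1 *\<^sub>R x = x"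
    by (transfer; simp add: algebra_simps)+
  show "x \<bullet> y = y \<bullet> x"
    by (simp add: inner_ell2_def inner_commute)
  show "(x + y) \<bullet> z = x \<bullet> z + y \<bullet> z"
    by (simp add: inner_ell2_def plus_ell2.rep_eq inner_add_left suminf_add summable_inner_coord)
  show "(r *\<^sub>R x) \<bullet> y = r * (x \<bullet> y)"
    by (simp add: inner_ell2_def scaleR_ell2.rep_eq suminf_mult summable_inner_coord)
  show "0 \<le> x \<bullet> x"
    by (simp add: inner_ell2_def suminf_nonneg summable_inner_coord)
  show "x \<bullet> x = 0 \<longleftrightarrow> x = 0"
    by (simp add: inner_ell2_def suminf_eq_zero_iff summable_inner_coord
        coord_inject[symmetric] zero_ell2.rep_eq fun_eq_iff)
qed (simp_all add: norm_ell2_def sgn_ell2_def dist_ell2_def uniformity_ell2_def open_ell2_def)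

end

lemma norm_ell2_square: "(norm x)\<^sup>2 = (\<Sum>n. (cmod (coord x n))\<^sup>2)"
  by (simp only: power2_norm_eq_inner inner_ell2_def)

lemma coord_diff: "coord (x - y) n = coord x n - coord y n"
  unfolding minus_ell2_def plus_ell2.rep_eq uminus_ell2.rep_eq by (rule add_uminus_conv_diff)

lemma sum_coord_le_norm: "(\<Sum>n<N. (cmod (coord x n))\<^sup>2) \<le> (norm x)\<^sup>2"
  unfolding norm_ell2_square by (intro sum_le_suminf summable_coord) auto

instance ell2 :: complete_space
proof
  fix X :: "nat \<Rightarrow> ell2"
  assume X: "Cauchy X"
  have coord_le: "cmod (coord x n) \<le> norm x" for x n
  proof -
    have "(cmod (coord x n))\<^sup>2 \<le> (\<Sum>k<Suc n. (cmod (coord x k))\<^sup>2)"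
      by (simp add: sum_nonneg)
    then have "(cmod (coord x n))\<^sup>2 \<le> (norm x)\<^sup>2"
      using sum_coord_le_norm[of x "Suc n"] by linarith
    then show ?thesis
      by (rule power2_le_imp_le) simp
  qed
  have "Cauchy (\<lambda>k. coord (X k) n)" for n
  proof (rule metric_CauchyI)
    fix e :: real assume "0 < e"
    then obtain M where M: "\<And>k l. k \<ge> M \<Longrightarrow> l \<ge> M \<Longrightarrow> dist (X k) (X l) < e"
      using metric_CauchyD[OF X] by blast
    have "dist (coord (X k) n) (coord (X l) n) < e" if "k \<ge> M" "l \<ge> M" for k l
      using coord_le[of "X k - X l" n] M[OF that] by (simp add: dist_norm coord_diff)
    then show "\<exists>M. \<forall>k\<ge>M. \<forall>l\<ge>M. dist (coord (X k) n) (coord (X l) n) < e"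
      by blast
  qed
  then have "\<exists>a. (\<lambda>k. coord (X k) n) \<longlonglongrightarrow> a" for n
    by (simp add: Cauchy_convergent_iff convergent_def)
  then obtain a where a: "\<And>n. (\<lambda>k. coord (X k) n) \<longlonglongrightarrow> a n"
    by metis
  have bound: "\<exists>M. \<forall>l\<ge>M. \<forall>N. (\<Sum>n<N. (cmod (a n - coord (X l) n))\<^sup>2) \<le> e\<^sup>2" if "0 < e" for e
  proof -
    obtain M where M: "\<And>k l. k \<ge> M \<Longrightarrow> l \<ge> M \<Longrightarrow> dist (X k) (X l) < e"
      using metric_CauchyD[OF X \<open>0 < e\<close>] by blast
    have "(\<Sum>n<N. (cmod (a n - coord (X l) n))\<^sup>2) \<le> e\<^sup>2" if l: "l \<ge> M" for l N
    proof (rule LIMSEQ_le_const2)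
      show "(\<lambda>k. \<Sum>n<N. (cmod (coord (X k) n - coord (X l) n))\<^sup>2)
          \<longlonglongrightarrow> (\<Sum>n<N. (cmod (a n - coord (X l) n))\<^sup>2)"
        by (intro tendsto_intros a)
      have "(\<Sum>n<N. (cmod (coord (X k) n - coord (X l) n))\<^sup>2) \<le> e\<^sup>2" if k: "k \<ge> M" for k
      proof -
        have "(norm (X k - X l))\<^sup>2 \<le> e\<^sup>2"
          using M[OF k l] by (intro power_mono) (simp_all add: dist_norm)
        then show ?thesis
          using sum_coord_le_norm[of "X k - X l" N] by (simp add: coord_diff)
      qed
      then show "\<exists>K. \<forall>k\<ge>K. (\<Sum>n<N. (cmod (coord (X k) n - coord (X l) n))\<^sup>2) \<le> e\<^sup>2"
        by blast
    qed
    then show ?thesis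
      by blast
  qed
  obtain l where "\<And>N. (\<Sum>n<N. (cmod (a n - coord (X l) n))\<^sup>2) \<le> 1\<^sup>2"
    using bound[of 1] by auto
  then have "summable (\<lambda>n. (cmod (a n - coord (X l) n))\<^sup>2)"
    by (intro summableI_nonneg_bounded[where x = "1\<^sup>2"]) auto
  then have d: "coord (Abs_ell2 (\<lambda>n. a n - coord (X l) n)) = (\<lambda>n. a n - coord (X l) n)"
    by (simp add: Abs_ell2_inverse)
  define L where "L = Abs_ell2 (\<lambda>n. a n - coord (X l) n) + X l"
  have L: "coord L n = a n" for n
    by (simp add: L_def plus_ell2.rep_eq d)
  have "X \<longlonglongrightarrow> L"
  proof (rule metric_LIMSEQ_I)
    fix e :: real assume e: "0 < e"
    then obtain M where M: "\<And>l N. l \<ge> M \<Longrightarrow> (\<Sum>n<N. (cmod (a n - coord (X l) n))\<^sup>2) \<le> (e / 2)\<^sup>2"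
      using bound[of "e / 2"] by auto
    have "dist (X l) L < e" if "l \<ge> M" for l
    proof -
      have "(norm (L - X l))\<^sup>2 \<le> (e / 2)\<^sup>2"
        unfolding norm_ell2_square
        by (rule suminf_le_const[OF summable_coord]) (use M[OF that] in \<open>simp add: coord_diff L\<close>)
      then have "norm (L - X l) \<le> e / 2"
        by (rule power2_le_imp_le) (use e in simp)
      then show ?thesis
        using e by (simp add: dist_norm norm_minus_commute)
    qed
    then show "\<exists>M. \<forall>l\<ge>M. dist (X l) L < e"
      by blast
  qed
  then show "convergent X"
    by (auto simp: convergent_def)
qed

lift_definition scaleC :: "complex \<Rightarrow> ell2 \<Rightarrow> ell2" is "\<lambda>c x n. c * x n"
  by (simp add: norm_mult power_mult_distrib summable_mult)

definition cinner :: "ell2 \<Rightarrow> ell2 \<Rightarrow> complex"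
  where "cinner x y = (\<Sum>n. cnj (coord x n) * coord y n)"

lift_definition basis_vec :: "nat \<Rightarrow> ell2" is "\<lambda>n k. if k = n then 1 else 0"
  by (rule summable_finite[of "{n}" for n]) auto

lemma inner_ell2_eq_Re_cinner: "x \<bullet> y = Re (cinner x y)"
proof -
  have "summable (\<lambda>n. cnj (coord x n) * coord y n)"
    by (rule summable_norm_cancel) (simp add: norm_mult summable_norm_coord_mult)
  then show ?thesis
    by (simp add: cinner_def inner_ell2_def Re_suminf inner_complex_def)
qed


section \<open>Operators and Schatten classes\<close>

text \<open>
  Elements of \<^typ>\<open>ell2 \<Rightarrow>\<^sub>L ell2\<close> are only real-linear; the bounded operators on the
  complex Hilbert space are those satisfying \<open>complex_linear\<close>.
\<close>

type_synonym op_ell2 = "ell2 \<Rightarrow>\<^sub>L ell2"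

definition complex_linear :: "op_ell2 \<Rightarrow> bool"
  where "complex_linear A \<longleftrightarrow> (\<forall>c x. blinfun_apply A (scaleC c x) = scaleC c (blinfun_apply A x))"

definition op_adjoint :: "op_ell2 \<Rightarrow> op_ell2"
  where "op_adjoint A =
    (THE B. \<forall>x y. cinner (blinfun_apply A x) y = cinner x (blinfun_apply B y))"

definition unitary :: "op_ell2 \<Rightarrow> bool"
  where "unitary u \<longleftrightarrow> complex_linear u \<and>
    op_adjoint u o\<^sub>L u = id_blinfun \<and> u o\<^sub>L op_adjoint u = id_blinfun"

definition op_poly :: "real poly \<Rightarrow> op_ell2 \<Rightarrow> op_ell2"
  where "op_poly q A = (\<Sum>i\<le>degree q. poly.coeff q i *\<^sub>R ((o\<^sub>L) A ^^ i) id_blinfun)"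

text \<open>
  Continuous functional calculus for a positive operator \<open>A\<close>: the spectrum of \<open>A\<close> is contained
  in \<open>{0..norm A}\<close>, and \<open>f(A)\<close> is the norm limit of \<open>q\<^sub>k(A)\<close> for any real polynomials \<open>q\<^sub>k\<close>
  converging to \<open>f\<close> uniformly on that interval.
\<close>

definition fun_calculus :: "(real \<Rightarrow> real) \<Rightarrow> op_ell2 \<Rightarrow> op_ell2"
  where "fun_calculus f A =
    (THE B. \<forall>q. uniform_limit {0..norm A} (\<lambda>k. poly (q k)) f sequentially
      \<longrightarrow> (\<lambda>k. op_poly (q k) A) \<longlonglongrightarrow> B)"

definition op_powr :: "op_ell2 \<Rightarrow> real \<Rightarrow> op_ell2"
  where "op_powr A r = fun_calculus (\<lambda>t. t powr r) A"

definition op_abs :: "op_ell2 \<Rightarrow> op_ell2"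
  where "op_abs x = op_powr (op_adjoint x o\<^sub>L x) (1 / 2)"

text \<open>For positive \<open>A\<close>, where the sum does not depend on the orthonormal basis.\<close>

definition op_trace :: "op_ell2 \<Rightarrow> ennreal"
  where "op_trace A =
    (\<Sum>n. ennreal (Re (cinner (basis_vec n) (blinfun_apply A (basis_vec n)))))"

definition schatten_class :: "real \<Rightarrow> op_ell2 set"
  where "schatten_class p = {x. complex_linear x \<and> op_trace (op_powr (op_abs x) p) < \<infinity>}"

text \<open>
  The value \<open>0\<close> outside the Schatten class makes \<open>(u, v) \<mapsto> schatten_norm p (u - v)\<close> symmetric
  on the whole type, as \<^locale>\<open>Metric_space\<close> requires.
\<close>

definition schatten_norm :: "real \<Rightarrow> op_ell2 \<Rightarrow> real"
  where "schatten_norm p x =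
    (if x \<in> schatten_class p then enn2real (op_trace (op_powr (op_abs x) p)) powr (1 / p) else 0)"

definition schatten_unitary_group :: "real \<Rightarrow> op_ell2 monoid"
  where "schatten_unitary_group p =
    \<lparr>carrier = {u. unitary u \<and> u - id_blinfun \<in> schatten_class p},
     mult = (o\<^sub>L), one = id_blinfun\<rparr>"

definition schatten_unitary_topology :: "real \<Rightarrow> op_ell2 topology"
  where "schatten_unitary_topology p =
    Metric_space.mtopology (carrier (schatten_unitary_group p)) (\<lambda>u v. schatten_norm p (u - v))"


section \<open>Property (FH)\<close>

text \<open>
  Real Hilbert spaces with an explicit carrier. A real vector space is a module over the field of
  reals; the fields \<^const>\<open>mult\<close> and \<^const>\<open>one\<close>, which module records inherit from ring records,
  are irrelevant.
\<close>

definition real_ring :: "real ring"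
  where "real_ring = \<lparr>carrier = UNIV, mult = (*), one = 1, zero = 0, add = (+)\<rparr>"

record 'h hilbert = "(real, 'h) module" +
  hinner :: "'h \<Rightarrow> 'h \<Rightarrow> real"

definition hdist :: "'h hilbert \<Rightarrow> 'h \<Rightarrow> 'h \<Rightarrow> real"
  where "hdist H x y =
    (if x \<in> carrier H \<and> y \<in> carrier H then sqrt (hinner H (x \<ominus>\<^bsub>H\<^esub> y) (x \<ominus>\<^bsub>H\<^esub> y)) else 0)"

definition htopology :: "'h hilbert \<Rightarrow> 'h topology"
  where "htopology H = Metric_space.mtopology (carrier H) (hdist H)"

locale real_inner_product_space = module real_ring H for H :: "'h hilbert" (structure) +
  assumes hinner_commute:
      "\<lbrakk>x \<in> carrier H; y \<in> carrier H\<rbrakk> \<Longrightarrow> hinner H x y = hinner H y x"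
    and hinner_add_left:
      "\<lbrakk>x \<in> carrier H; y \<in> carrier H; z \<in> carrier H\<rbrakk> \<Longrightarrow>
        hinner H (x \<oplus> y) z = hinner H x z + hinner H y z"
    and hinner_smult_left:
      "\<lbrakk>x \<in> carrier H; y \<in> carrier H\<rbrakk> \<Longrightarrow> hinner H (r \<odot> x) y = r * hinner H x y"
    and hinner_nonneg: "x \<in> carrier H \<Longrightarrow> 0 \<le> hinner H x x"
    and hinner_definite: "\<lbrakk>x \<in> carrier H; hinner H x x = 0\<rbrakk> \<Longrightarrow> x = \<zero>"

locale real_hilbert_space = real_inner_product_space +
  assumes complete: "Metric_space.mcomplete (carrier H) (hdist H)"

definition affine_isometric_action ::
    "('g, 'm) monoid_scheme \<Rightarrow> 'g topology \<Rightarrow> 'h hilbert \<Rightarrow> ('g \<Rightarrow> 'h \<Rightarrow> 'h) \<Rightarrow> bool"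
  where "affine_isometric_action G T H \<alpha> \<longleftrightarrow>
    group_action G (carrier H) \<alpha> \<and>
    continuous_map (prod_topology T (htopology H)) (htopology H) (\<lambda>(g, x). \<alpha> g x) \<and>
    (\<forall>g\<in>carrier G. \<forall>x\<in>carrier H. \<forall>y\<in>carrier H.
      hdist H (\<alpha> g x) (\<alpha> g y) = hdist H x y \<and>
      (\<forall>t. \<alpha> g ((1 - t) \<odot>\<^bsub>H\<^esub> x \<oplus>\<^bsub>H\<^esub> t \<odot>\<^bsub>H\<^esub> y) =
            (1 - t) \<odot>\<^bsub>H\<^esub> \<alpha> g x \<oplus>\<^bsub>H\<^esub> t \<odot>\<^bsub>H\<^esub> \<alpha> g y))"

text \<open>
  A quantifier cannot range over Hilbert spaces of all types, so the carriers are taken inside the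
  type of real functions on \<open>G\<close>. Nothing is lost: \<open>property_FH_fixed_point\<close> below derives
  fixed points on Hilbert spaces over an arbitrary type.
\<close>

definition property_FH :: "('g, 'm) monoid_scheme \<Rightarrow> 'g topology \<Rightarrow> bool"
  where "property_FH G T \<longleftrightarrow>
    (\<forall>(H :: ('g \<Rightarrow> real) hilbert) \<alpha>.
      real_hilbert_space H \<longrightarrow> affine_isometric_action G T H \<alpha> \<longrightarrow>
      (\<exists>x\<in>carrier H. \<forall>g\<in>carrier G. \<alpha> g x = x))"

lemma real_ring_simps [simp]:
  "carrier real_ring = UNIV" "x \<otimes>\<^bsub>real_ring\<^esub> y = x * y" "\<one>\<^bsub>real_ring\<^esub> = 1"
  "\<zero>\<^bsub>real_ring\<^esub> = 0" "x \<oplus>\<^bsub>real_ring\<^esub> y = x + y"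
  by (simp_all add: real_ring_def)

context real_inner_product_space
begin

lemma smult_closed' [simp]: "x \<in> carrier H \<Longrightarrow> r \<odot> x \<in> carrier H"
  using smult_closed by simp

lemma hinner_add_right:
  "\<lbrakk>x \<in> carrier H; y \<in> carrier H; z \<in> carrier H\<rbrakk> \<Longrightarrow>
    hinner H z (x \<oplus> y) = hinner H z x + hinner H z y"
  by (metis hinner_add_left hinner_commute M.a_closed)

lemma hinner_zero_left: "x \<in> carrier H \<Longrightarrow> hinner H \<zero> x = 0"
  using hinner_add_left[of "\<zero>" "\<zero>" x] by simp

lemma hinner_minus_left:
  assumes "x \<in> carrier H" "y \<in> carrier H"
  shows "hinner H (\<ominus> x) y = - hinner H x y"
  using hinner_add_left[of "\<ominus> x" x y] assms by (simp add: M.l_neg hinner_zero_left)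

lemma hinner_diff_left:
  assumes "x \<in> carrier H" "y \<in> carrier H" "z \<in> carrier H"
  shows "hinner H (x \<ominus> y) z = hinner H x z - hinner H y z"
  using assms by (simp add: a_minus_def hinner_add_left hinner_minus_left)

lemma hinner_diff_right:
  assumes "x \<in> carrier H" "y \<in> carrier H" "z \<in> carrier H"
  shows "hinner H z (x \<ominus> y) = hinner H z x - hinner H z y"
  using assms by (metis hinner_diff_left hinner_commute M.minus_closed)

lemma hinner_diff_self:
  assumes "x \<in> carrier H" "y \<in> carrier H"
  shows "hinner H (x \<ominus> y) (x \<ominus> y) = hinner H x x - 2 * hinner H x y + hinner H y y"
  using assms hinner_commute[of y x] by (simp add: hinner_diff_left hinner_diff_right)

lemma hinner_Cauchy_Schwarz:
  assumes x: "x \<in> carrier H" and y: "y \<in> carrier H"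
  shows "(hinner H x y)\<^sup>2 \<le> hinner H x x * hinner H y y"
proof (cases "hinner H y y = 0")
  case True
  then have "y = \<zero>"
    using hinner_definite y by blast
  then show ?thesis
    using hinner_zero_left[OF x] hinner_commute[OF x y] True by simp
next
  case False
  then have pos: "hinner H y y > 0"
    using hinner_nonneg[OF y] by simp
  define t where "t = hinner H x y / hinner H y y"
  have "0 \<le> hinner H (x \<ominus> t \<odot> y) (x \<ominus> t \<odot> y)"
    using x y by (intro hinner_nonneg) simp
  also have "\<dots> = hinner H x x - 2 * (t * hinner H x y) + t * (t * hinner H y y)"
    using x y hinner_smult_left[of y x t] hinner_smult_left[of y "t \<odot> y" t]
      hinner_smult_left[of y y t] hinner_commute[of y "t \<odot> y"]
      hinner_commute[of x "t \<odot> y"] hinner_commute[of x y]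
    by (simp add: hinner_diff_self)
  also have "\<dots> = hinner H x x - (hinner H x y)\<^sup>2 / hinner H y y"
    using pos by (simp add: t_def power2_eq_square)
  finally show ?thesis
    using pos by (simp add: field_simps)
qed

lemma hinner_abs_le:
  assumes "x \<in> carrier H" "y \<in> carrier H"
  shows "\<bar>hinner H x y\<bar> \<le> sqrt (hinner H x x) * sqrt (hinner H y y)"
  using real_sqrt_le_mono[OF hinner_Cauchy_Schwarz[OF assms]] by (simp add: real_sqrt_mult)

lemma hdist_eq:
  "x \<in> carrier H \<Longrightarrow> y \<in> carrier H \<Longrightarrow> hdist H x y = sqrt (hinner H (x \<ominus> y) (x \<ominus> y))"
  by (simp add: hdist_def)

lemma metric_space: "Metric_space (carrier H) (hdist H)"
proof
  fix x y
  show "0 \<le> hdist H x y"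
    by (simp add: hdist_def hinner_nonneg)
  show "hdist H x y = hdist H y x"
    using hinner_commute[of x y] by (simp add: hdist_def hinner_diff_self)
next
  fix x y assume xy: "x \<in> carrier H" "y \<in> carrier H"
  have "x \<ominus> y \<oplus> y = x"
    using xy by (simp add: a_minus_def M.a_assoc M.l_neg)
  then have "x \<ominus> y = \<zero> \<longleftrightarrow> x = y"
    using xy M.l_zero[of y] by (metis M.r_neg a_minus_def)
  moreover have "hinner H (x \<ominus> y) (x \<ominus> y) = 0 \<longleftrightarrow> x \<ominus> y = \<zero>"
    using xy hinner_definite[of "x \<ominus> y"] hinner_zero_left[of "\<zero>"] by auto
  ultimately show "hdist H x y = 0 \<longleftrightarrow> x = y"
    using xy by (simp add: hdist_eq)
next
  fix x y z assume xyz: "x \<in> carrier H" "y \<in> carrier H" "z \<in> carrier H"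
  define u v where "u = x \<ominus> y" and "v = y \<ominus> z"
  have uv: "u \<in> carrier H" "v \<in> carrier H"
    using xyz by (simp_all add: u_def v_def)
  have "x \<ominus> z = u \<oplus> v"
    using xyz unfolding u_def v_def a_minus_def by (simp add: M.a_ac M.r_neg2 M.r_neg1)
  then have "hinner H (x \<ominus> z) (x \<ominus> z) = hinner H u u + 2 * hinner H u v + hinner H v v"
    using uv hinner_commute[of u v] by (simp add: hinner_add_left hinner_add_right)
  also have "\<dots> \<le> (sqrt (hinner H u u) + sqrt (hinner H v v))\<^sup>2"
    using hinner_abs_le[OF uv] hinner_nonneg uv by (simp add: power2_sum)
  finally have "sqrt (hinner H (x \<ominus> z) (x \<ominus> z)) \<le> sqrt (hinner H u u) + sqrt (hinner H v v)"
    using hinner_nonneg uv by (intro real_le_lsqrt) simp_all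
  then show "hdist H x z \<le> hdist H x y + hdist H y z"
    using xyz by (simp add: hdist_eq u_def v_def)
qed

end

text \<open>Transport of a closed linear subspace \<open>V\<close> along an injection \<open>\<Phi>\<close>.\<close>

definition transport :: "'h hilbert \<Rightarrow> 'h set \<Rightarrow> ('h \<Rightarrow> 'k) \<Rightarrow> 'k hilbert"
  where "transport H V \<Phi> =
    \<lparr>carrier = \<Phi> ` V, mult = (\<lambda>a b. a), one = \<Phi> \<zero>\<^bsub>H\<^esub>, zero = \<Phi> \<zero>\<^bsub>H\<^esub>,
     add = (\<lambda>a b. \<Phi> (inv_into V \<Phi> a \<oplus>\<^bsub>H\<^esub> inv_into V \<Phi> b)),
     smult = (\<lambda>r a. \<Phi> (r \<odot>\<^bsub>H\<^esub> inv_into V \<Phi> a)),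
     hinner = (\<lambda>a b. hinner H (inv_into V \<Phi> a) (inv_into V \<Phi> b))\<rparr>"

locale transported_subspace = real_hilbert_space +
  fixes V :: "'a set" and \<Phi> :: "'a \<Rightarrow> 'k"
  assumes sub: "V \<subseteq> carrier H"
    and zero_V: "\<zero> \<in> V"
    and add_V: "\<lbrakk>x \<in> V; y \<in> V\<rbrakk> \<Longrightarrow> x \<oplus> y \<in> V"
    and smult_V: "x \<in> V \<Longrightarrow> r \<odot> x \<in> V"
    and closed_V: "closedin (htopology H) V"
    and inj: "inj_on \<Phi> V"
begin

abbreviation K where "K \<equiv> transport H V \<Phi>"

lemma in_carrier: "x \<in> V \<Longrightarrow> x \<in> carrier H"
  using sub by blast

lemma uminus_V: "x \<in> V \<Longrightarrow> \<ominus> x \<in> V"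
proof -
  assume x: "x \<in> V"
  have "\<ominus>\<^bsub>real_ring\<^esub> 1 = (- 1 :: real)"
    by (rule R.minus_equality) simp_all
  then have "(- 1) \<odot> x = \<ominus> x"
    using smult_l_minus[of 1 x] smult_one[of x] in_carrier[OF x] by simp
  then show ?thesis
    using smult_V[OF x, of "- 1"] by simp
qed

lemma K_simps:
  "carrier K = \<Phi> ` V" "zero K = \<Phi> \<zero>"
  "\<lbrakk>x \<in> V; y \<in> V\<rbrakk> \<Longrightarrow> add K (\<Phi> x) (\<Phi> y) = \<Phi> (x \<oplus> y)"
  "x \<in> V \<Longrightarrow> smult K r (\<Phi> x) = \<Phi> (r \<odot> x)"
  "\<lbrakk>x \<in> V; y \<in> V\<rbrakk> \<Longrightarrow> hinner K (\<Phi> x) (\<Phi> y) = hinner H x y"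
  by (simp_all add: transport_def inv_into_f_f[OF inj])

lemma K_inner: "real_inner_product_space K"
proof -
  have ab: "abelian_group K"
  proof (rule abelian_groupI)
    fix x assume "x \<in> carrier K"
    then obtain v where v: "v \<in> V" "x = \<Phi> v"
      by (auto simp: K_simps)
    show "\<exists>y\<in>carrier K. y \<oplus>\<^bsub>K\<^esub> x = \<zero>\<^bsub>K\<^esub>"
      by (rule bexI[of _ "\<Phi> (\<ominus> v)"])
         (use v uminus_V[of v] in_carrier in \<open>simp_all add: K_simps M.l_neg\<close>)
  qed (auto simp: K_simps add_V zero_V in_carrier M.a_ac)
  interpret KA: abelian_group K
    by (rule ab)
  have "module real_ring K"
    by (rule moduleI[OF R.is_cring ab])
       (auto simp: K_simps smult_V add_V in_carrier
          smult_l_distr[simplified] smult_r_distr[simplified] smult_assoc1[simplified]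
          smult_one[simplified])
  then interpret KM: module real_ring K .
  show ?thesis
  proof
    show "x = \<zero>\<^bsub>K\<^esub>" if "x \<in> carrier K" "hinner K x x = 0" for x
    proof -
      obtain v where "v \<in> V" "x = \<Phi> v"
        using \<open>x \<in> carrier K\<close> by (auto simp: K_simps)
      then show ?thesis
        using that(2) hinner_definite[of v] by (simp add: K_simps in_carrier)
    qed
    show "hinner K x y = hinner K y x" if "x \<in> carrier K" "y \<in> carrier K" for x y
      using that hinner_commute[OF in_carrier in_carrier] by (auto simp: K_simps)
  qed (auto simp: K_simps add_V smult_V in_carrier hinner_add_left hinner_smult_left
        hinner_nonneg)
qed

lemma hdist_K: "\<lbrakk>x \<in> V; y \<in> V\<rbrakk> \<Longrightarrow> hdist K (\<Phi> x) (\<Phi> y) = hdist H x y"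
proof -
  assume xy: "x \<in> V" "y \<in> V"
  interpret K: real_inner_product_space K
    by (rule K_inner)
  have c: "\<Phi> x \<in> carrier K" "\<Phi> y \<in> carrier K"
    using xy by (simp_all add: K_simps)
  show ?thesis
    using xy c by (simp add: K.hdist_eq hdist_eq K.hinner_diff_self hinner_diff_self in_carrier K_simps)
qed

sublocale HM: Metric_space "carrier H" "hdist H"
  by (rule metric_space)

lemma K_hilbert: "real_hilbert_space K"
proof -
  interpret K: real_inner_product_space K
    by (rule K_inner)
  interpret KM: Metric_space "carrier K" "hdist K"
    by (rule K.metric_space)
  show ?thesis
  proof
    show "KM.mcomplete"
      unfolding KM.mcomplete_def
    proof (intro allI impI)
      fix \<sigma> assume \<sigma>: "KM.MCauchy \<sigma>"
      define \<tau> where "\<tau> n = inv_into V \<Phi> (\<sigma> n)" for n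
      have "range \<sigma> \<subseteq> carrier K"
        using \<sigma> by (simp only: KM.MCauchy_def)
      then have r: "\<sigma> n \<in> \<Phi> ` V" for n
        by (auto simp: K_simps)
      have \<tau>: "\<tau> n \<in> V" "\<Phi> (\<tau> n) = \<sigma> n" for n
        using r[of n] by (auto simp: \<tau>_def intro: inv_into_into f_inv_into_f)
      have "hdist H (\<tau> m) (\<tau> n) = hdist K (\<sigma> m) (\<sigma> n)" for m n
        using hdist_K[OF \<tau>(1) \<tau>(1), of m n] by (simp add: \<tau>(2))
      then have "HM.MCauchy \<tau>"
        using \<sigma> \<tau>(1) in_carrier by (auto simp: KM.MCauchy_def HM.MCauchy_def)
      then obtain x where x: "limitin HM.mtopology \<tau> x sequentially"
        using complete HM.mcomplete_def by blast
      have xV: "x \<in> V"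
        using closed_V x \<tau>(1) unfolding htopology_def HM.metric_closedin_iff_sequentially_closed
        by blast
      have "hdist K (\<sigma> n) (\<Phi> x) = hdist H (\<tau> n) x" for n
        using hdist_K[OF \<tau>(1) xV, of n] by (simp add: \<tau>(2))
      then have "limitin KM.mtopology \<sigma> (\<Phi> x) sequentially"
        using x xV r unfolding KM.limit_metric_sequentially HM.limit_metric_sequentially
        by (simp add: K_simps) blast
      then show "\<exists>x. limitin KM.mtopology \<sigma> x sequentially"
        by blast
    qed
  qed
qed

lemma continuous_inv: "continuous_map (htopology K) (htopology H) (inv_into V \<Phi>)"
proof -
  interpret K: real_inner_product_space K
    by (rule K_inner)
  interpret KM: Metric_space "carrier K" "hdist K"
    by (rule K.metric_space)
  have "inv_into V \<Phi> (\<Phi> x) = x" if "x \<in> V" for x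
    using that inj by simp
  then show ?thesis
    unfolding htopology_def KM.metric_continuous_map[OF metric_space]
    by (fastforce simp: K_simps in_carrier hdist_K)
qed

lemma continuous_\<Phi>: "continuous_map (subtopology (htopology H) V) (htopology K) \<Phi>"
proof -
  interpret K: real_inner_product_space K
    by (rule K_inner)
  interpret KM: Metric_space "carrier K" "hdist K"
    by (rule K.metric_space)
  interpret S: Submetric "carrier H" "hdist H" V
    by unfold_locales (rule sub)
  show ?thesis
    unfolding htopology_def S.mtopology_submetric[symmetric]
      S.sub.metric_continuous_map[OF KM.Metric_space_axioms]
    by (fastforce simp: K_simps in_carrier hdist_K)
qed

end

lemma property_FH_fixed_point:
  fixes G (structure) and H :: "'h hilbert"
  assumes FH: "property_FH G T" and top: "topspace T = carrier G"
    and H: "real_hilbert_space H" and \<alpha>: "affine_isometric_action G T H \<alpha>"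
  shows "\<exists>x\<in>carrier H. \<forall>g\<in>carrier G. \<alpha> g x = x"
proof -
  interpret real_hilbert_space H
    by (rule H)
  interpret HM: Metric_space "carrier H" "hdist H"
    by (rule metric_space)
  interpret act: group_action G "carrier H" \<alpha>
    using \<alpha> by (simp add: affine_isometric_action_def)
  interpret G: group G
    using act.group_hom by (simp add: group_hom_def)
  have cont: "continuous_map (prod_topology T (htopology H)) (htopology H) (\<lambda>(g, x). \<alpha> g x)"
    and iso: "\<And>g x y. \<lbrakk>g \<in> carrier G; x \<in> carrier H; y \<in> carrier H\<rbrakk> \<Longrightarrow>
      hdist H (\<alpha> g x) (\<alpha> g y) = hdist H x y"
    and aff: "\<And>g x y t. \<lbrakk>g \<in> carrier G; x \<in> carrier H; y \<in> carrier H\<rbrakk> \<Longrightarrow>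
      \<alpha> g ((1 - t) \<odot>\<^bsub>H\<^esub> x \<oplus>\<^bsub>H\<^esub> t \<odot>\<^bsub>H\<^esub> y) =
        (1 - t) \<odot>\<^bsub>H\<^esub> \<alpha> g x \<oplus>\<^bsub>H\<^esub> t \<odot>\<^bsub>H\<^esub> \<alpha> g y"
    using \<alpha> by (simp_all add: affine_isometric_action_def)
  have \<alpha>_in [simp]: "\<alpha> g x \<in> carrier H" if "g \<in> carrier G" "x \<in> carrier H" for g x
    using that act.element_image by blast
  define b where "b g = \<alpha> g \<zero>\<^bsub>H\<^esub>" for g
  define L where "L g x = \<alpha> g x \<ominus>\<^bsub>H\<^esub> b g" for g x
  have b_in [simp]: "b g \<in> carrier H" if "g \<in> carrier G" for g
    using that by (simp add: b_def)
  have L_in [simp]: "L g x \<in> carrier H" if "g \<in> carrier G" "x \<in> carrier H" for g x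
    using that by (simp add: L_def)
  have sq: "hinner H (x \<ominus>\<^bsub>H\<^esub> y) (x \<ominus>\<^bsub>H\<^esub> y) = (hdist H x y)\<^sup>2"
    if "x \<in> carrier H" "y \<in> carrier H" for x y
    using that by (simp add: hdist_eq hinner_nonneg)
  have L_inner: "hinner H (L g x) (L g y) = hinner H x y"
    if g: "g \<in> carrier G" and x: "x \<in> carrier H" and y: "y \<in> carrier H" for g x y
  proof -
    have *: "hinner H (\<alpha> g u \<ominus>\<^bsub>H\<^esub> \<alpha> g v) (\<alpha> g u \<ominus>\<^bsub>H\<^esub> \<alpha> g v) = hinner H (u \<ominus>\<^bsub>H\<^esub> v) (u \<ominus>\<^bsub>H\<^esub> v)"
      if "u \<in> carrier H" "v \<in> carrier H" for u v
      using that g by (simp add: sq iso)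
    note e = *[OF x y] *[OF x M.zero_closed] *[OF y M.zero_closed]
    have "hinner H \<zero>\<^bsub>H\<^esub> \<zero>\<^bsub>H\<^esub> = 0" "hinner H x \<zero>\<^bsub>H\<^esub> = 0" "hinner H y \<zero>\<^bsub>H\<^esub> = 0"
      using x y hinner_zero_left hinner_commute by (metis M.zero_closed)+
    then show ?thesis
      using e g x y hinner_commute[of "\<alpha> g y" "\<alpha> g \<zero>\<^bsub>H\<^esub>"]
        hinner_commute[of "\<alpha> g x" "\<alpha> g \<zero>\<^bsub>H\<^esub>"] hinner_commute[of "\<alpha> g x" "\<alpha> g y"]
        hinner_commute[of x y] hinner_commute[of x "\<zero>\<^bsub>H\<^esub>"] hinner_commute[of y "\<zero>\<^bsub>H\<^esub>"]
      by (simp add: L_def b_def hinner_diff_self hinner_diff_left hinner_diff_right)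
  qed
  have b_mult: "b (g \<otimes> h) = L g (b h) \<oplus>\<^bsub>H\<^esub> b g" if "g \<in> carrier G" "h \<in> carrier G" for g h
    using that act.composition_rule[of "\<zero>\<^bsub>H\<^esub>" g h]
    by (simp add: L_def b_def a_minus_def M.a_assoc M.l_neg)
  have L_surj: "\<exists>x\<in>carrier H. L g x = y" if gy: "g \<in> carrier G" "y \<in> carrier H" for g y
  proof -
    have "y \<oplus>\<^bsub>H\<^esub> b g \<in> carrier H"
      using gy by simp
    then obtain x where "x \<in> carrier H" "\<alpha> g x = y \<oplus>\<^bsub>H\<^esub> b g"
      using act.surj_prop[OF gy(1)] by (smt (verit) imageE)
    then show ?thesis
      using gy by (intro bexI[of _ x]) (simp_all add: L_def a_minus_def M.a_assoc M.r_neg)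
  qed
  define W where "W = {y \<in> carrier H. \<forall>g\<in>carrier G. hinner H y (b g) = 0}"
  define V where "V = {x \<in> carrier H. \<forall>y\<in>W. hinner H x y = 0}"
  define \<Phi> where "\<Phi> x g = hinner H x (b g)" for x g
  have W_carrier: "y \<in> carrier H" if "y \<in> W" for y
    using that by (simp add: W_def)
  have V_carrier: "x \<in> carrier H" if "x \<in> V" for x
    using that by (simp add: V_def)
  have b_V: "b g \<in> V" if "g \<in> carrier G" for g
    using that hinner_commute by (auto simp: V_def W_def)
  have L_V: "L g x \<in> V" if g: "g \<in> carrier G" and x: "x \<in> V" for g x
  proof -
    have "hinner H (L g x) y = 0" if y: "y \<in> W" for y
    proof -
      obtain y' where y': "y' \<in> carrier H" "L g y' = y"
        using L_surj[OF g W_carrier[OF y]] by blast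
      have "hinner H y' (b h) = 0" if h: "h \<in> carrier G" for h
      proof -
        have "hinner H y' (b h) = hinner H y (L g (b h))"
          using L_inner[OF g y'(1) b_in[OF h]] y'(2) by simp
        moreover have "hinner H y (b (g \<otimes> h)) = 0" "hinner H y (b g) = 0"
          using y g h G.m_closed[OF g h] unfolding W_def by blast+
        ultimately show ?thesis
          using hinner_add_right[of "L g (b h)" "b g" y] b_mult[OF g h] g h W_carrier[OF y] by simp
      qed
      then have "y' \<in> W"
        using y'(1) by (simp add: W_def)
      then show ?thesis
        using L_inner[OF g V_carrier[OF x] y'(1)] x y'(2) by (simp add: V_def)
    qed
    then show ?thesis
      using g V_carrier[OF x] by (simp add: V_def)
  qed
  have add_V: "x \<oplus>\<^bsub>H\<^esub> y \<in> V" if "x \<in> V" "y \<in> V" for x y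
    using that by (auto simp: V_def hinner_add_left W_carrier)
  have \<alpha>_V: "\<alpha> g x \<in> V" if g: "g \<in> carrier G" and x: "x \<in> V" for g x
  proof -
    have "\<alpha> g x = L g x \<oplus>\<^bsub>H\<^esub> b g"
      using g V_carrier[OF x] by (simp add: L_def a_minus_def M.a_assoc M.l_neg)
    then show ?thesis
      using add_V[OF L_V[OF g x] b_V[OF g]] by simp
  qed
  have closed: "closedin (htopology H) V"
    unfolding htopology_def HM.metric_closedin_iff_sequentially_closed
  proof (intro conjI allI impI)
    show "V \<subseteq> carrier H"
      using V_carrier by blast
    fix \<sigma> l assume "range \<sigma> \<subseteq> V \<and> limitin HM.mtopology \<sigma> l sequentially"
    then have \<sigma>: "\<sigma> n \<in> V" and lim: "limitin HM.mtopology \<sigma> l sequentially" for n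
      by auto
    have l: "l \<in> carrier H"
      using lim by (simp add: HM.limit_metric_sequentially)
    have "(\<lambda>n. hdist H (\<sigma> n) l) \<longlonglongrightarrow> 0"
      unfolding LIMSEQ_def dist_real_def
      using lim by (simp add: HM.limit_metric_sequentially) blast
    then have *: "(\<lambda>n. hdist H (\<sigma> n) l * sqrt (hinner H y y)) \<longlonglongrightarrow> 0" for y
      by (rule tendsto_mult_left_zero)
    have "hinner H l y = 0" if y: "y \<in> W" for y
    proof -
      have "\<bar>hinner H l y\<bar> \<le> hdist H (\<sigma> n) l * sqrt (hinner H y y)" for n
      proof -
        have c: "\<sigma> n \<in> carrier H" "y \<in> carrier H"
          using \<sigma> y by (auto intro: V_carrier W_carrier)
        have "hinner H (\<sigma> n \<ominus>\<^bsub>H\<^esub> l) y = - hinner H l y"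
          using \<sigma>[of n] y c l by (simp add: hinner_diff_left V_def)
        then show ?thesis
          using hinner_abs_le[of "\<sigma> n \<ominus>\<^bsub>H\<^esub> l" y] c l by (simp add: hdist_eq)
      qed
      then have "\<bar>hinner H l y\<bar> \<le> 0"
        by (intro LIMSEQ_le_const[OF *]) auto
      then show ?thesis
        by simp
    qed
    then show "l \<in> V"
      using l by (simp add: V_def)
  qed
  have inj: "inj_on \<Phi> V"
  proof (rule inj_onI)
    fix x y assume xy: "x \<in> V" "y \<in> V" and eq: "\<Phi> x = \<Phi> y"
    have c: "x \<in> carrier H" "y \<in> carrier H"
      using xy V_carrier by auto
    have "hinner H (x \<ominus>\<^bsub>H\<^esub> y) (b g) = 0" if "g \<in> carrier G" for g
      using fun_cong[OF eq, of g] c that by (simp add: \<Phi>_def hinner_diff_left)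
    then have W: "x \<ominus>\<^bsub>H\<^esub> y \<in> W"
      using c by (simp add: W_def)
    have "hinner H (x \<ominus>\<^bsub>H\<^esub> y) (x \<ominus>\<^bsub>H\<^esub> y) = 0"
      using xy W c hinner_diff_left[OF c, of "x \<ominus>\<^bsub>H\<^esub> y"] by (simp add: V_def)
    then have "hdist H x y = 0"
      using c by (simp add: hdist_eq)
    then show "x = y"
      using c by simp
  qed
  interpret tr: transported_subspace H V \<Phi>
  proof
    show "V \<subseteq> carrier H"
      using V_carrier by blast
    show "\<zero>\<^bsub>H\<^esub> \<in> V"
      by (simp add: V_def hinner_zero_left W_carrier)
    show "r \<odot>\<^bsub>H\<^esub> x \<in> V" if "x \<in> V" for r x
      using that by (simp add: V_def hinner_smult_left W_carrier)
  qed (fact add_V closed inj)+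
  let ?K = "transport H V \<Phi>"
  define \<beta> where "\<beta> g = (\<lambda>a\<in>\<Phi> ` V. \<Phi> (\<alpha> g (inv_into V \<Phi> a)))" for g
  have \<beta>_\<Phi>: "\<beta> g (\<Phi> x) = \<Phi> (\<alpha> g x)" if "x \<in> V" for g x
    using that inj by (simp add: \<beta>_def)
  have \<alpha>_one: "\<alpha> \<one> x = x" if "x \<in> carrier H" for x
    using that act.id_eq_one by (metis restrict_apply')
  have \<beta>_mult: "\<beta> (g \<otimes> h) a = \<beta> g (\<beta> h a)"
    if "g \<in> carrier G" "h \<in> carrier G" "a \<in> \<Phi> ` V" for g h a
    using that by (auto simp: \<beta>_\<Phi> \<alpha>_V V_carrier act.composition_rule)
  have \<beta>_in: "\<beta> g a \<in> \<Phi> ` V" if "g \<in> carrier G" "a \<in> \<Phi> ` V" for g a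
    using that by (auto simp: \<beta>_\<Phi> \<alpha>_V)
  have \<beta>_one: "\<beta> \<one> a = a" if "a \<in> \<Phi> ` V" for a
    using that by (auto simp: \<beta>_\<Phi> \<alpha>_one V_carrier)
  have \<beta>_Bij: "\<beta> g \<in> Bij (\<Phi> ` V)" if g: "g \<in> carrier G" for g
  proof -
    have "bij_betw (\<beta> g) (\<Phi> ` V) (\<Phi> ` V)"
    proof (rule bij_betw_byWitness[where f' = "\<beta> (inv g)"])
      show "\<forall>a\<in>\<Phi> ` V. \<beta> (inv g) (\<beta> g a) = a"
        using g \<beta>_mult[of "inv g" g] \<beta>_one by simp
      show "\<forall>a\<in>\<Phi> ` V. \<beta> g (\<beta> (inv g) a) = a"
        using g \<beta>_mult[of g "inv g"] \<beta>_one by simp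
      show "\<beta> g ` \<Phi> ` V \<subseteq> \<Phi> ` V" "\<beta> (inv g) ` \<Phi> ` V \<subseteq> \<Phi> ` V"
        using \<beta>_in[OF g] \<beta>_in[OF G.inv_closed[OF g]] by blast+
    qed
    then show ?thesis
      by (simp add: Bij_def \<beta>_def)
  qed
  have "group_action G (carrier ?K) \<beta>"
    unfolding group_action_def tr.K_simps(1)
  proof (rule group_hom.intro[OF G.is_group group_BijGroup], unfold group_hom_axioms_def,
      rule homI)
    fix g h assume gh: "g \<in> carrier G" "h \<in> carrier G"
    show "\<beta> g \<in> carrier (BijGroup (\<Phi> ` V))"
      using gh \<beta>_Bij by (simp add: BijGroup_def)
    have "\<beta> (g \<otimes> h) a = compose (\<Phi> ` V) (\<beta> g) (\<beta> h) a" for a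
      using gh \<beta>_mult[of g h a] by (cases "a \<in> \<Phi> ` V") (simp_all add: compose_def \<beta>_def)
    then show "\<beta> (g \<otimes> h) = \<beta> g \<otimes>\<^bsub>BijGroup (\<Phi> ` V)\<^esub> \<beta> h"
      using gh \<beta>_Bij by (simp add: BijGroup_def fun_eq_iff)
  qed
  moreover have "continuous_map (prod_topology T (htopology ?K)) (htopology ?K) (\<lambda>(g, a). \<beta> g a)"
  proof -
    interpret K: real_inner_product_space ?K
      by (rule tr.K_inner)
    interpret KM: Metric_space "carrier ?K" "hdist ?K"
      by (rule K.metric_space)
    have topK: "topspace (htopology ?K) = \<Phi> ` V"
      unfolding htopology_def KM.topspace_mtopology by (rule tr.K_simps)
    let ?P = "prod_topology T (htopology ?K)"
    have "continuous_map ?P (htopology H) (inv_into V \<Phi> \<circ> snd)"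
      by (rule continuous_map_compose[OF continuous_map_snd tr.continuous_inv])
    then have "continuous_map ?P (prod_topology T (htopology H)) (\<lambda>z. (fst z, (inv_into V \<Phi> \<circ> snd) z))"
      by (intro continuous_map_pairedI continuous_map_fst)
    from continuous_map_compose[OF this cont]
    have "continuous_map ?P (htopology H) (\<lambda>z. \<alpha> (fst z) (inv_into V \<Phi> (snd z)))"
      by (simp add: o_def)
    then have "continuous_map ?P (subtopology (htopology H) V) (\<lambda>z. \<alpha> (fst z) (inv_into V \<Phi> (snd z)))"
    proof (rule continuous_map_into_subtopology, intro funcsetI)
      fix z assume z: "z \<in> topspace ?P"
      then have "fst z \<in> carrier G" "inv_into V \<Phi> (snd z) \<in> V"
        using top topK inj by auto
      then show "\<alpha> (fst z) (inv_into V \<Phi> (snd z)) \<in> V"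
        by (rule \<alpha>_V)
    qed
    from continuous_map_compose[OF this tr.continuous_\<Phi>]
    show ?thesis
      by (rule continuous_map_eq) (auto simp: topK \<beta>_def)
  qed
  moreover have "hdist ?K (\<beta> g a) (\<beta> g c) = hdist ?K a c \<and>
      (\<forall>t. \<beta> g ((1 - t) \<odot>\<^bsub>?K\<^esub> a \<oplus>\<^bsub>?K\<^esub> t \<odot>\<^bsub>?K\<^esub> c) =
        (1 - t) \<odot>\<^bsub>?K\<^esub> \<beta> g a \<oplus>\<^bsub>?K\<^esub> t \<odot>\<^bsub>?K\<^esub> \<beta> g c)"
    if g: "g \<in> carrier G" and a: "a \<in> carrier ?K" and c: "c \<in> carrier ?K" for g a c
  proof -
    obtain x y where "x \<in> V" "a = \<Phi> x" "y \<in> V" "c = \<Phi> y"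
      using a c by (auto simp: tr.K_simps)
    then show ?thesis
      using g by (simp add: tr.K_simps tr.hdist_K \<beta>_\<Phi> \<alpha>_V V_carrier iso aff tr.add_V tr.smult_V)
  qed
  ultimately have "affine_isometric_action G T ?K \<beta>"
    unfolding affine_isometric_action_def by blast
  then obtain a where a: "a \<in> carrier ?K" "\<forall>g\<in>carrier G. \<beta> g a = a"
    using FH tr.K_hilbert unfolding property_FH_def by blast
  then obtain x where x: "x \<in> V" "a = \<Phi> x"
    by (auto simp: tr.K_simps)
  have "\<alpha> g x = x" if g: "g \<in> carrier G" for g
  proof (rule inj_onD[OF inj])
    show "\<Phi> (\<alpha> g x) = \<Phi> x"
      using a(2) x g \<beta>_\<Phi>[of x g] by simp
  qed (use x g \<alpha>_V in auto)
  then show ?thesis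
    using V_carrier[OF x(1)] by blast
qed

section \<open>Lie groups\<close>

text \<open>
  Here \<open>W\<close> is an open subset of \<^term>\<open>Euclidean_space n\<close>, whose points are the
  functions \<^typ>\<open>nat \<Rightarrow> real\<close> vanishing at all indices \<open>i \<ge> n\<close>.
\<close>

definition partial_deriv :: "nat \<Rightarrow> ((nat \<Rightarrow> real) \<Rightarrow> real) \<Rightarrow> (nat \<Rightarrow> real) \<Rightarrow> real"
  where "partial_deriv i f x = deriv (\<lambda>t. f (x(i := t))) (x i)"

primrec Ck_on :: "nat \<Rightarrow> nat \<Rightarrow> (nat \<Rightarrow> real) set \<Rightarrow> ((nat \<Rightarrow> real) \<Rightarrow> real) \<Rightarrow> bool"
  where
    "Ck_on 0 n W f \<longleftrightarrow> continuous_map (subtopology (Euclidean_space n) W) euclideanreal f"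
  | "Ck_on (Suc k) n W f \<longleftrightarrow>
      continuous_map (subtopology (Euclidean_space n) W) euclideanreal f \<and>
      (\<forall>i<n. (\<forall>x\<in>W. (\<lambda>t. f (x(i := t))) differentiable at (x i)) \<and>
        Ck_on k n W (partial_deriv i f))"

definition smooth_on :: "nat \<Rightarrow> nat \<Rightarrow> (nat \<Rightarrow> real) set \<Rightarrow> ((nat \<Rightarrow> real) \<Rightarrow> nat \<Rightarrow> real) \<Rightarrow> bool"
  where "smooth_on n m W F \<longleftrightarrow> (\<forall>j<m. \<forall>k. Ck_on k n W (\<lambda>x. F x j))"

type_synonym 'a chart = "'a set \<times> ('a \<Rightarrow> nat \<Rightarrow> real)"

definition is_chart :: "'a topology \<Rightarrow> nat \<Rightarrow> 'a chart \<Rightarrow> bool"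
  where "is_chart T n = (\<lambda>(U, \<phi>). openin T U \<and>
    (\<exists>V. openin (Euclidean_space n) V \<and>
      homeomorphic_map (subtopology T U) (subtopology (Euclidean_space n) V) \<phi>))"

definition smooth_in_charts :: "nat \<Rightarrow> nat \<Rightarrow> 'a chart \<Rightarrow> 'b chart \<Rightarrow> ('a \<Rightarrow> 'b) \<Rightarrow> bool"
  where "smooth_in_charts n m = (\<lambda>(U, \<phi>) (V, \<psi>) f.
    smooth_on n m (\<phi> ` (U \<inter> f -` V)) (\<psi> \<circ> f \<circ> inv_into U \<phi>))"

definition smooth_atlas :: "'a topology \<Rightarrow> nat \<Rightarrow> 'a chart set \<Rightarrow> bool"
  where "smooth_atlas T n A \<longleftrightarrow>
    (\<forall>c\<in>A. is_chart T n c) \<and> \<Union> (fst ` A) = topspace T \<and>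
    (\<forall>c\<in>A. \<forall>d\<in>A. smooth_in_charts n n c d id)"

definition smooth_manifold :: "'a topology \<Rightarrow> nat \<Rightarrow> 'a chart set \<Rightarrow> bool"
  where "smooth_manifold T n A \<longleftrightarrow>
    Hausdorff_space T \<and> second_countable T \<and> smooth_atlas T n A"

definition smooth_map ::
    "'a topology \<Rightarrow> nat \<Rightarrow> 'a chart set \<Rightarrow> 'b topology \<Rightarrow> nat \<Rightarrow> 'b chart set \<Rightarrow> ('a \<Rightarrow> 'b) \<Rightarrow> bool"
  where "smooth_map T n A S m B f \<longleftrightarrow>
    continuous_map T S f \<and> (\<forall>c\<in>A. \<forall>d\<in>B. smooth_in_charts n m c d f)"

definition prod_atlas :: "nat \<Rightarrow> 'a chart set \<Rightarrow> 'b chart set \<Rightarrow> ('a \<times> 'b) chart set"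
  where "prod_atlas n A B =
    (\<lambda>((U, \<phi>), (V, \<psi>)). (U \<times> V, \<lambda>(x, y) i. if i < n then \<phi> x i else \<psi> y (i - n))) ` (A \<times> B)"

text \<open>A Lie group is finite-dimensional; discrete groups have dimension \<open>n = 0\<close>.\<close>

definition lie_group :: "('a, 'm) monoid_scheme \<Rightarrow> 'a topology \<Rightarrow> bool"
  where "lie_group G T \<longleftrightarrow> group G \<and> topspace T = carrier G \<and>
    (\<exists>n A. smooth_manifold T n A \<and>
      smooth_map (prod_topology T T) (n + n) (prod_atlas n A A) T n A (\<lambda>(x, y). x \<otimes>\<^bsub>G\<^esub> y) \<and>
      smooth_map T n A T n A (\<lambda>x. inv\<^bsub>G\<^esub> x))"

end

theory Submission
  imports Defs
begin

text \<open>Let \<open>E\<close> be the orthogonal complement of the vectors fixed by \<open>G\<close>. If \<open>E\<close> were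
  infinite-dimensional, it would contain an orthonormal sequence \<open>f\<close>. Put \<open>w n = (n + 1) powr (- 1 / 2)\<close>.
  Since \<open>p > 2\<close>, the squares of the weights \<open>w\<close> are \<open>q\<close>-summable for the exponent \<open>q\<close> conjugate to
  \<open>p / 2\<close>, and so \<open>u \<mapsto> (w n (u f\<^sub>n - f\<^sub>n))\<^sub>n\<close> is a continuous cocycle of \<open>G\<close> in the Hilbert sum of
  countably many copies of \<open>\<ell>\<^sup>2\<close>. By property (FH) it is a coboundary, and as the \<open>f\<^sub>n\<close> are orthogonal
  to all fixed vectors, this forces \<open>w\<close> to be square-summable, which it is not. Hence \<open>E\<close> is
  finite-dimensional, and \<open>G\<close> is a closed group of isometries of \<open>E\<close>.

  Such a group is a compact Lie group by the theorem of von Neumann and Cartan, for which neither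
  the exponential map nor the inverse function theorem is needed here. The tangent cone of \<open>G\<close> at
  the identity is a linear subspace. Minimising distances shows that the orthogonal projection \<open>P\<close>
  to it maps \<open>G\<close> near the identity bijectively and bi-Lipschitz onto an open set. The inverse \<open>\<psi>\<close> of
  this chart satisfies \<open>\<partial>\<^sub>i \<psi> = \<psi> Y\<^sub>i\<close>, where the tangent vector \<open>Y\<^sub>i\<close> is determined by
  \<open>P (\<psi> Y\<^sub>i) = v\<^sub>i\<close>; differentiating this equation expresses \<open>\<partial>\<^sub>j Y\<^sub>i\<close> through \<open>\<psi>\<close> and the \<open>Y\<^sub>k\<close>,
  so that \<open>\<psi>\<close> is smooth by bootstrapping.

  That \<open>schatten_norm p\<close> is a norm is seen by compressing to finite-dimensional subspaces, where
  it becomes an \<open>\<ell>\<^sup>p\<close>-norm over an eigenbasis and Minkowski's inequality applies.\<close>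

section \<open>Orthonormal systems\<close>

text \<open>Two estimates tie the Schatten norm to orthonormal systems. For an orthonormal sequence
  f, the p-th powers of the norms of (u - v) f_n have a sum bounded by the p-th power of the
  Schatten norm of u - v; with Hoelder's inequality this makes the cocycle continuous. Conversely,
  an operator that lives on \<open>E\<close> has Schatten norm at most a constant times its operator
  norm. On G both norms therefore define one topology, and the Lie theory can be carried out in the
  operator norm. The coboundary is used as follows: a fixed point x of the affine action makes every
  vector x_n + w_n f_n fixed by G, hence orthogonal to f_n, so the modulus of w_n is at most the
  norm of x_n. Symmetry, positivity and eigenbases refer to the real inner product, because
  truncation to an odd number of real basis vectors is not complex-linear; the price is a factor two
  between real and complex traces.\<close>

definition orthonormal_upto :: "('a \<Rightarrow> 'a \<Rightarrow> real) \<Rightarrow> nat \<Rightarrow> (nat \<Rightarrow> 'a) \<Rightarrow> bool"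
  where "orthonormal_upto ip m f \<longleftrightarrow> (\<forall>i<m. \<forall>j<m. ip (f i) (f j) = of_bool (i = j))"

lemma orthonormal_uptoD:
  "orthonormal_upto ip m f \<Longrightarrow> i < m \<Longrightarrow> j < m \<Longrightarrow> ip (f i) (f j) = of_bool (i = j)"
  by (simp add: orthonormal_upto_def)

text \<open>\<open>S\<close> holds the admissible vectors, \<open>V\<close> the space to be spanned.
  Keeping them apart lets one argument by dependent choice produce both orthonormal bases
  (\<open>S = V\<close>) and eigenbases (\<open>S\<close> the eigenvectors in \<open>V\<close>). The
  form \<open>ip\<close> is a parameter because a trace form on operators is treated in the same
  way.\<close>

lemma orthonormal_extension_dichotomy:
  fixes ip :: "'a::real_vector \<Rightarrow> 'a \<Rightarrow> real"
  assumes sym: "\<And>x y. ip x y = ip y x"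
    and extend: "\<And>f m. \<lbrakk>\<forall>i<m. f i \<in> S; orthonormal_upto ip m f;
        \<exists>x\<in>V. x \<noteq> (\<Sum>i<m. ip (f i) x *\<^sub>R f i)\<rbrakk>
      \<Longrightarrow> \<exists>y\<in>S. ip y y = 1 \<and> (\<forall>i<m. ip (f i) y = 0)"
  shows "(\<exists>f. (\<forall>i. f i \<in> S) \<and> (\<forall>m. orthonormal_upto ip m f)) \<or>
    (\<exists>m f. (\<forall>i<m. f i \<in> S) \<and> orthonormal_upto ip m f \<and>
      (\<forall>x\<in>V. x = (\<Sum>i<m. ip (f i) x *\<^sub>R f i)))"
proof (rule disjCI)
  assume "\<not> (\<exists>m f. (\<forall>i<m. f i \<in> S) \<and> orthonormal_upto ip m f \<and>
      (\<forall>x\<in>V. x = (\<Sum>i<m. ip (f i) x *\<^sub>R f i)))"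
  then have step: "\<exists>y\<in>S. ip y y = 1 \<and> (\<forall>i<m. ip (f i) y = 0)"
    if "\<forall>i<m. f i \<in> S" "orthonormal_upto ip m f" for m f
    using extend[OF that] that by metis
  have "\<exists>F. \<forall>n. ((\<forall>i<n. F n i \<in> S) \<and> orthonormal_upto ip n (F n)) \<and>
      (\<forall>i<n. F (Suc n) i = F n i)"
  proof (rule dependent_nat_choice)
    show "\<exists>f. (\<forall>i<0. f i \<in> S) \<and> orthonormal_upto ip 0 f"
      by (simp add: orthonormal_upto_def)
    fix f n assume f: "(\<forall>i<n. f i \<in> S) \<and> orthonormal_upto ip n f"
    then obtain y where y: "y \<in> S" "ip y y = 1" "\<forall>i<n. ip (f i) y = 0"
      using step by blast
    have y': "ip y (f i) = 0" if "i < n" for i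
      using y(3) that sym[of y "f i"] by simp
    show "\<exists>g. ((\<forall>i<Suc n. g i \<in> S) \<and> orthonormal_upto ip (Suc n) g) \<and> (\<forall>i<n. g i = f i)"
      by (rule exI[of _ "f(n := y)"])
         (use f y y' in \<open>auto simp: orthonormal_upto_def less_Suc_eq\<close>)
  qed
  then obtain F where F: "\<And>n. (\<forall>i<n. F n i \<in> S) \<and> orthonormal_upto ip n (F n)"
    and F': "\<And>n. \<forall>i<n. F (Suc n) i = F n i"
    by blast
  define f where "f i = F (Suc i) i" for i
  have eq: "F n i = f i" if "i < n" for n i
    using that
  proof (induction n)
    case (Suc n)
    then show ?case
      using F'[of n] by (cases "i = n") (simp_all add: f_def)
  qed simp
  have "orthonormal_upto ip m f" for m
    using F[of m] eq[of _ m] by (simp add: orthonormal_upto_def)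
  moreover have "f i \<in> S" for i
    using F[of "Suc i"] by (simp add: f_def)
  ultimately show "\<exists>f. (\<forall>i. f i \<in> S) \<and> (\<forall>m. orthonormal_upto ip m f)"
    by blast
qed

lemma Gram_Schmidt_dichotomy:
  fixes ip :: "'a::real_vector \<Rightarrow> 'a \<Rightarrow> real"
  assumes V: "subspace V"
    and sym: "\<And>x y. ip x y = ip y x"
    and lin: "\<And>x. linear (ip x)"
    and pos: "\<And>x. x \<in> V \<Longrightarrow> x \<noteq> 0 \<Longrightarrow> ip x x > 0"
  shows "(\<exists>f. (\<forall>i. f i \<in> V) \<and> (\<forall>m. orthonormal_upto ip m f)) \<or>
    (\<exists>m f. (\<forall>i<m. f i \<in> V) \<and> orthonormal_upto ip m f \<and>
      (\<forall>x\<in>V. x = (\<Sum>i<m. ip (f i) x *\<^sub>R f i)))"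
proof (rule orthonormal_extension_dichotomy[OF sym])
  fix f m
  assume f: "\<forall>i<m. f i \<in> V" "orthonormal_upto ip m f" 
    and "\<exists>x\<in>V. x \<noteq> (\<Sum>i<m. ip (f i) x *\<^sub>R f i)"
  then obtain x where x: "x \<in> V" "x \<noteq> (\<Sum>i<m. ip (f i) x *\<^sub>R f i)"
    by blast
  define y where "y = x - (\<Sum>i<m. ip (f i) x *\<^sub>R f i)"
  have y: "y \<in> V" "y \<noteq> 0"
    using x f by (auto simp: y_def intro!: subspace_diff V subspace_sum subspace_scale)
  have orth: "ip (f j) y = 0" if "j < m" for j
  proof -
    have "ip (f j) y = ip (f j) x - (\<Sum>i<m. ip (f i) x * ip (f j) (f i))"
      by (simp add: y_def linear_diff[OF lin] linear_sum[OF lin] linear_scale[OF lin])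
    also have "(\<Sum>i<m. ip (f i) x * ip (f j) (f i)) = (\<Sum>i<m. if i = j then ip (f i) x else 0)"
      using that f by (intro sum.cong) (auto simp: orthonormal_upto_def)
    finally show ?thesis using that by simp
  qed
  define c where "c = 1 / sqrt (ip y y)"
  have c: "c * (c * ip y y) = 1"
    using pos[OF y] by (simp add: c_def field_simps)
  have "ip (c *\<^sub>R y) (c *\<^sub>R y) = c * ip (c *\<^sub>R y) y"
    by (simp add: linear_scale[OF lin])
  also have "ip (c *\<^sub>R y) y = c * ip y y"
    by (subst sym) (simp add: linear_scale[OF lin])
  finally have "ip (c *\<^sub>R y) (c *\<^sub>R y) = 1"
    using c by simp
  moreover have "ip (f i) (c *\<^sub>R y) = 0" if "i < m" for i
    using orth[OF that] by (simp add: linear_scale[OF lin])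
  moreover have "c *\<^sub>R y \<in> V"
    using y V by (simp add: subspace_scale)
  ultimately show "\<exists>y\<in>V. ip y y = 1 \<and> (\<forall>i<m. ip (f i) y = 0)"
    by blast
qed

section \<open>Vector-valued functions of several variables\<close>

text \<open>The partial derivatives are existentially quantified and constrained on \<open>W\<close> only, so that a function
  given on \<open>W\<close> by a formula can be differentiated without regard to its values elsewhere.\<close>

primrec CkV :: "nat \<Rightarrow> nat \<Rightarrow> (nat \<Rightarrow> real) set \<Rightarrow> ((nat \<Rightarrow> real) \<Rightarrow> 'b::real_normed_vector) \<Rightarrow> bool"
  where
    "CkV 0 n W F \<longleftrightarrow> continuous_on W F"
  | "CkV (Suc k) n W F \<longleftrightarrow> continuous_on W F \<and>
      (\<exists>F'. \<forall>i<n. (\<forall>x\<in>W. ((\<lambda>t. F (x(i := t))) has_vector_derivative F' i x) (at (x i))) \<and>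
        CkV k n W (F' i))"

lemma CkV_continuous: "CkV k n W F \<Longrightarrow> continuous_on W F"
  by (cases k) auto

lemma CkV_SucI:
  assumes "continuous_on W F"
    and "\<And>i x. i < n \<Longrightarrow> x \<in> W \<Longrightarrow> ((\<lambda>t. F (x(i := t))) has_vector_derivative F' i x) (at (x i))"
    and "\<And>i. i < n \<Longrightarrow> CkV k n W (F' i)"
  shows "CkV (Suc k) n W F"
  using assms by auto

lemma CkV_SucD: "CkV (Suc k) n W F \<Longrightarrow> CkV k n W F"
proof (induction k arbitrary: F)
  case (Suc k)
  obtain F' where F': "\<And>i. i < n \<Longrightarrow> (\<forall>x\<in>W. ((\<lambda>t. F (x(i := t))) has_vector_derivative F' i x) (at (x i))) \<and>
        CkV (Suc k) n W (F' i)"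
    using Suc.prems unfolding CkV.simps(2)[of "Suc k"] by blast
  show ?case
    by (rule CkV_SucI[where F' = F']) (use F' Suc.IH CkV_continuous[OF Suc.prems] in blast)+
qed auto

lemma CkV_const [simp]: "CkV k n W (\<lambda>_. c)"
proof (induction k arbitrary: c)
  case (Suc k)
  show ?case
    by (rule CkV_SucI[where F' = "\<lambda>_ _. 0"]) (use Suc in auto)
qed simp

lemma CkV_bounded_linear:
  assumes f: "bounded_linear f"
  shows "CkV k n W F \<Longrightarrow> CkV k n W (\<lambda>x. f (F x))"
proof (induction k arbitrary: F)
  case 0
  then show ?case by (simp add: bounded_linear.continuous_on[OF f])
next
  case (Suc k)
  then obtain F' where F': "\<And>i. i < n \<Longrightarrow> (\<forall>x\<in>W. ((\<lambda>t. F (x(i := t))) has_vector_derivative F' i x) (at (x i))) \<and>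
        CkV k n W (F' i)"
    by auto
  show ?case
  proof (rule CkV_SucI[where F' = "\<lambda>i x. f (F' i x)"])
    show "continuous_on W (\<lambda>x. f (F x))"
      using CkV_continuous[OF Suc.prems] by (simp add: bounded_linear.continuous_on[OF f])
  qed (use F' Suc.IH bounded_linear.has_vector_derivative[OF f] in blast)+
qed

lemma CkV_add: "CkV k n W F \<Longrightarrow> CkV k n W G \<Longrightarrow> CkV k n W (\<lambda>x. F x + G x)"
proof (induction k arbitrary: F G)
  case (Suc k)
  obtain F' where F': "\<And>i. i < n \<Longrightarrow> (\<forall>x\<in>W. ((\<lambda>t. F (x(i := t))) has_vector_derivative F' i x) (at (x i))) \<and>
        CkV k n W (F' i)"
    using Suc.prems by auto
  obtain G' where G': "\<And>i. i < n \<Longrightarrow> (\<forall>x\<in>W. ((\<lambda>t. G (x(i := t))) has_vector_derivative G' i x) (at (x i))) \<and>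
        CkV k n W (G' i)"
    using Suc.prems by auto
  show ?case
  proof (rule CkV_SucI[where F' = "\<lambda>i x. F' i x + G' i x"])
    show "continuous_on W (\<lambda>x. F x + G x)"
      using Suc.prems by (intro continuous_on_add CkV_continuous)
    fix i assume i: "i < n"
    show "CkV k n W (\<lambda>x. F' i x + G' i x)"
      using F'[OF i] G'[OF i] by (intro Suc.IH) auto
    show "((\<lambda>t. F (x(i := t)) + G (x(i := t))) has_vector_derivative F' i x + G' i x) (at (x i))"
      if "x \<in> W" for x
      using F'[OF i] G'[OF i] that by (intro has_vector_derivative_add) blast+
  qed
qed (simp add: continuous_on_add)

lemma CkV_sum: "(\<And>i. i \<in> I \<Longrightarrow> CkV k n W (F i)) \<Longrightarrow> CkV k n W (\<lambda>x. \<Sum>i\<in>I. F i x)"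
  by (induction I rule: infinite_finite_induct) (auto intro: CkV_add)

lemma CkV_bounded_bilinear:
  assumes f: "bounded_bilinear f"
  shows "CkV k n W F \<Longrightarrow> CkV k n W G \<Longrightarrow> CkV k n W (\<lambda>x. f (F x) (G x))"
proof (induction k arbitrary: F G)
  case 0
  then show ?case by (simp add: bounded_bilinear.continuous_on[OF f])
next
  case (Suc k)
  obtain F' where F': "\<And>i. i < n \<Longrightarrow> (\<forall>x\<in>W. ((\<lambda>t. F (x(i := t))) has_vector_derivative F' i x) (at (x i))) \<and>
        CkV k n W (F' i)"
    using Suc.prems by auto
  obtain G' where G': "\<And>i. i < n \<Longrightarrow> (\<forall>x\<in>W. ((\<lambda>t. G (x(i := t))) has_vector_derivative G' i x) (at (x i))) \<and>
        CkV k n W (G' i)"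
    using Suc.prems by auto
  show ?case
  proof (rule CkV_SucI[where F' = "\<lambda>i x. f (F x) (G' i x) + f (F' i x) (G x)"])
    show "continuous_on W (\<lambda>x. f (F x) (G x))"
      using Suc.prems by (intro bounded_bilinear.continuous_on[OF f] CkV_continuous)
    fix i assume i: "i < n"
    show "CkV k n W (\<lambda>x. f (F x) (G' i x) + f (F' i x) (G x))"
      using F'[OF i] G'[OF i] by (intro CkV_add Suc.IH CkV_SucD[OF Suc.prems(1)] CkV_SucD[OF Suc.prems(2)]) auto
    fix x assume x: "x \<in> W"
    then show "((\<lambda>t. f (F (x(i := t))) (G (x(i := t)))) has_vector_derivative 
        f (F x) (G' i x) + f (F' i x) (G x)) (at (x i))"
      using bounded_bilinear.has_vector_derivative[OF f, of "\<lambda>t. F (x(i := t))" "F' i x" "x i" UNIV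
          "\<lambda>t. G (x(i := t))" "G' i x"] F' G' i by auto
  qed
qed

text \<open>A function of m consecutive coordinates, starting at the offset c, becomes a function of
  all n coordinates; its partial derivatives outside the block vanish. Charts of the product of G
  with itself use the offsets 0 and n.\<close>

lemma CkV_coordinates:
  assumes "c + m \<le> n"
    and W': "\<And>z. z \<in> W' \<Longrightarrow> (\<lambda>i. if i < m then z (i + c) else 0) \<in> W"
  shows "CkV k m W F \<Longrightarrow> CkV k n W' (\<lambda>z. F (\<lambda>i. if i < m then z (i + c) else 0))"
proof (induction k arbitrary: F)
  let ?\<pi> = "\<lambda>z :: nat \<Rightarrow> real. \<lambda>i. if i < m then z (i + c) else 0"
  have cont: "continuous_on W' (\<lambda>z. F (?\<pi> z))" if "continuous_on W F" for F :: "(nat \<Rightarrow> real) \<Rightarrow> 'a"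
  proof (rule continuous_on_compose2[OF that])
    show "continuous_on W' ?\<pi>"
    proof (rule continuous_on_coordinatewise_then_product)
      fix i
      show "continuous_on W' (\<lambda>z. ?\<pi> z i)"
        by (cases "i < m") (auto intro: continuous_on_subset[OF continuous_on_product_coordinates])
    qed
  qed (use W' in auto)
  {
    case 0
    then show ?case using cont by simp
  next
    case (Suc k)
    obtain F' where F': "\<And>i. i < m \<Longrightarrow> (\<forall>x\<in>W. ((\<lambda>t. F (x(i := t))) has_vector_derivative F' i x) (at (x i))) \<and>
        CkV k m W (F' i)"
      using Suc.prems by auto
    show ?case
    proof (rule CkV_SucI[where F' = "\<lambda>j z. if c \<le> j \<and> j < c + m then F' (j - c) (?\<pi> z) else 0"])
      show "continuous_on W' (\<lambda>z. F (?\<pi> z))"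
        using CkV_continuous[OF Suc.prems] cont by blast
      fix j assume j: "j < n"
      show "CkV k n W' (\<lambda>z. if c \<le> j \<and> j < c + m then F' (j - c) (?\<pi> z) else 0)"
        using Suc.IH[of "F' (j - c)"] F'[of "j - c"] by (cases "c \<le> j \<and> j < c + m") auto
      fix z assume z: "z \<in> W'"
      show "((\<lambda>t. F (?\<pi> (z(j := t)))) has_vector_derivative 
          (if c \<le> j \<and> j < c + m then F' (j - c) (?\<pi> z) else 0)) (at (z j))"
      proof (cases "c \<le> j \<and> j < c + m")
        case True
        then have "?\<pi> (z(j := t)) = (?\<pi> z)(j - c := t)" for t
          by (auto simp: fun_eq_iff)
        moreover have "?\<pi> z (j - c) = z j"
          using True by auto
        moreover have "((\<lambda>t. F ((?\<pi> z)(j - c := t))) has_vector_derivative F' (j - c) (?\<pi> z)) (at (?\<pi> z (j - c)))"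
          using F'[of "j - c", THEN conjunct1, THEN bspec, OF _ W'[OF z]] True
          by (simp add: less_diff_conv2)
        ultimately show ?thesis
          using True by (simp only: if_True simp_thms)
      next
        case False
        then have "?\<pi> (z(j := t)) = ?\<pi> z" for t
          by (auto simp: fun_eq_iff)
        then show ?thesis
          using False by auto
      qed
    qed
  }
qed

text \<open>\<open>Ck_on\<close> takes \<open>deriv\<close> of G itself, while \<open>CkV\<close>
  controls F on W. The last hypothesis bridges this: F and G agree along each short coordinate
  segment about a point of W, so they have the same partial derivatives there. The smaller set V
  occurs because a map is read in charts on an intersection with a preimage.\<close>

lemma CkV_imp_Ck_on:
  fixes F G :: "(nat \<Rightarrow> real) \<Rightarrow> real"
  assumes "CkV k n W F" and "\<And>x. x \<in> W \<Longrightarrow> G x = F x" and VW: "V \<subseteq> W"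
    and W: "\<And>x i. x \<in> W \<Longrightarrow> i < n \<Longrightarrow> \<forall>\<^sub>F t in nhds (x i). x(i := t) \<in> W"
  shows "Ck_on k n V G"
  using assms(1,2)
proof (induction k arbitrary: F G)
  have cont: "continuous_map (subtopology (Euclidean_space n) V) euclideanreal G"
    if "continuous_on W F" "\<And>x. x \<in> W \<Longrightarrow> G x = F x" for F G :: "(nat \<Rightarrow> real) \<Rightarrow> real"
  proof -
    have "continuous_on W G"
      using that by (simp cong: continuous_on_cong)
    then have "continuous_on ({x. \<forall>i\<ge>n. x i = 0} \<inter> V) G"
      using VW by (meson continuous_on_subset le_infI2)
    then show ?thesis
      by (simp add: Euclidean_space_def subtopology_subtopology euclidean_product_topology)
  qed
  {
    case 0
    then show ?case using cont[of F G] by simp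
  next
    case (Suc k)
    obtain F' where F': "\<And>i. i < n \<Longrightarrow> (\<forall>x\<in>W. ((\<lambda>t. F (x(i := t))) has_vector_derivative F' i x) (at (x i))) \<and>
        CkV k n W (F' i)"
      using Suc.prems(1) by auto
    have D: "((\<lambda>t. G (x(i := t))) has_field_derivative F' i x) (at (x i))" if "i < n" "x \<in> W" for i x
    proof -
      have "((\<lambda>t. F (x(i := t))) has_field_derivative F' i x) (at (x i))"
        using F' that by (simp add: has_real_derivative_iff_has_vector_derivative)
      moreover have "\<forall>\<^sub>F t in nhds (x i). F (x(i := t)) = G (x(i := t))"
        using W[OF that(2,1)] by eventually_elim (rule Suc.prems(2)[symmetric])
      ultimately show ?thesis
        by (subst (asm) DERIV_cong_ev[OF refl _ refl]) auto
    qed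
    have "(\<lambda>t. G (x(i := t))) differentiable at (x i)" if "i < n" "x \<in> V" for i x
      using D[of i x] that VW real_differentiable_def by blast
    moreover have "Ck_on k n V (partial_deriv i G)" if i: "i < n" for i
      using F'[OF i] i by (intro Suc.IH[of "F' i"]) (auto simp: partial_deriv_def intro!: DERIV_imp_deriv D)
    ultimately show ?case
      using cont[OF CkV_continuous[OF Suc.prems(1)]] Suc.prems(2) by simp
  }
qed

section \<open>Algebra of the composition of bounded operators\<close>

lemmas blinfun_compose_add_left = bounded_bilinear.add_left[OF bounded_bilinear_blinfun_compose]
  and blinfun_compose_add_right = bounded_bilinear.add_right[OF bounded_bilinear_blinfun_compose]
  and blinfun_compose_diff_left = bounded_bilinear.diff_left[OF bounded_bilinear_blinfun_compose]
  and blinfun_compose_diff_right = bounded_bilinear.diff_right[OF bounded_bilinear_blinfun_compose]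
  and blinfun_compose_scaleR_left = bounded_bilinear.scaleR_left[OF bounded_bilinear_blinfun_compose]
  and blinfun_compose_scaleR_right = bounded_bilinear.scaleR_right[OF bounded_bilinear_blinfun_compose]
  and blinfun_compose_sum_right = bounded_bilinear.sum_right[OF bounded_bilinear_blinfun_compose]
  and bounded_linear_blinfun_compose_right = bounded_bilinear.bounded_linear_right[OF bounded_bilinear_blinfun_compose]
  and bounded_linear_blinfun_compose_left = bounded_bilinear.bounded_linear_left[OF bounded_bilinear_blinfun_compose]

lemmas blinfun_compose_distrib = blinfun_compose_add_left blinfun_compose_add_right
  blinfun_compose_diff_left blinfun_compose_diff_right
  blinfun_compose_scaleR_left blinfun_compose_scaleR_right

lemma blinfun_compose_assoc: "(a o\<^sub>L b) o\<^sub>L c = a o\<^sub>L (b o\<^sub>L c)"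
  by (rule blinfun_eqI) simp

lemma blinfun_compose_id [simp]: "a o\<^sub>L id_blinfun = a" "id_blinfun o\<^sub>L a = a"
  by (rule blinfun_eqI; simp)+

section \<open>Closed groups of isometries\<close>

lemma compact_subseq:
  assumes "compact S" "\<And>n. f n \<in> S"
  obtains l r where "l \<in> S" "strict_mono (r :: nat \<Rightarrow> nat)" "(\<lambda>n. f (r n)) \<longlonglongrightarrow> (l :: 'a::metric_space)"
proof -
  obtain l r where "l \<in> S" "strict_mono (r :: nat \<Rightarrow> nat)" "(f \<circ> r) \<longlonglongrightarrow> l"
    using assms unfolding compact_def by blast
  then show ?thesis
    by (intro that[of l r]) (simp_all add: o_def)
qed

text \<open>The ambient space may be infinite-dimensional. What is finite-dimensional is
  \<open>M\<close>, which contains every g - 1; this is expressed by compactness of its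
  intersections with balls. The form \<open>ip\<close> is definite on \<open>M\<close> only, which
  admits a trace form over a finite-dimensional subspace.\<close>

locale closed_isometry_group =
  fixes G M :: "('v::banach \<Rightarrow>\<^sub>L 'v) set" and ip :: "('v \<Rightarrow>\<^sub>L 'v) \<Rightarrow> ('v \<Rightarrow>\<^sub>L 'v) \<Rightarrow> real"
  assumes one: "id_blinfun \<in> G"
    and mult: "\<lbrakk>x \<in> G; y \<in> G\<rbrakk> \<Longrightarrow> x o\<^sub>L y \<in> G"
    and inverse: "x \<in> G \<Longrightarrow> \<exists>y\<in>G. x o\<^sub>L y = id_blinfun \<and> y o\<^sub>L x = id_blinfun"
    and norm_le: "x \<in> G \<Longrightarrow> norm x \<le> 1"
    and closed_G: "closed G"
    and subspace_M: "subspace M"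
    and G_M: "x \<in> G \<Longrightarrow> x - id_blinfun \<in> M"
    and compact_M: "compact (M \<inter> cball 0 R)"
    and ip: "bounded_bilinear ip"
    and ip_sym: "ip X Y = ip Y X"
    and ip_pos: "\<lbrakk>X \<in> M; X \<noteq> 0\<rbrakk> \<Longrightarrow> ip X X > 0"
begin

definition ginv where "ginv x = (SOME y. y \<in> G \<and> x o\<^sub>L y = id_blinfun \<and> y o\<^sub>L x = id_blinfun)"

lemma ginv: 
  assumes "x \<in> G"
  shows "ginv x \<in> G" "x o\<^sub>L ginv x = id_blinfun" "ginv x o\<^sub>L x = id_blinfun"
  using someI_ex[of "\<lambda>y. y \<in> G \<and> x o\<^sub>L y = id_blinfun \<and> y o\<^sub>L x = id_blinfun"] inverse[OF assms]
  unfolding ginv_def by auto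

lemma norm_mult_left:
  assumes "g \<in> G" shows "norm (g o\<^sub>L X) = norm X"
proof (rule antisym)
  have le: "norm (h o\<^sub>L Y) \<le> norm Y" if "h \<in> G" for h Y
    using norm_blinfun_compose[of h Y] norm_le[OF that] mult_right_mono[of "norm h" 1 "norm Y"] by simp
  show "norm (g o\<^sub>L X) \<le> norm X"
    by (rule le[OF assms])
  have "X = ginv g o\<^sub>L (g o\<^sub>L X)"
    using ginv[OF assms] by (simp flip: blinfun_compose_assoc)
  then show "norm X \<le> norm (g o\<^sub>L X)"
    using le[OF ginv(1)[OF assms], of "g o\<^sub>L X"] by simp
qed

lemma norm_mult_right_le:
  assumes "g \<in> G" shows "norm (X o\<^sub>L g) \<le> norm X"
  using norm_blinfun_compose[of X g] norm_le[OF assms] mult_left_mono[of "norm g" 1 "norm X"] by simp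

text \<open>The identity g^-1 - h^-1 = g^-1 (h - g) h^-1 gives this, since multiplication by
  elements of G does not increase norms.\<close>

lemma norm_ginv_diff:
  assumes "g \<in> G" "h \<in> G" shows "norm (ginv g - ginv h) \<le> norm (g - h)"
proof -
  have "ginv g - ginv h = ginv g o\<^sub>L ((h - g) o\<^sub>L ginv h)"
    using ginv[OF assms(1)] ginv[OF assms(2)]
    by (simp add: blinfun_compose_distrib flip: blinfun_compose_assoc)
  then show ?thesis
    using norm_mult_right_le[OF ginv(1)[OF assms(2)], of "h - g"]
    by (simp add: norm_minus_commute norm_mult_left[OF ginv(1)[OF assms(1)]])
qed

lemma closed_M: "closed M"
  unfolding closed_sequential_limits
proof (intro allI impI)
  fix x l assume *: "(\<forall>n. x n \<in> M) \<and> x \<longlonglongrightarrow> l"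
  then have "bounded (range x)"
    using convergent_imp_bounded by blast
  then obtain R where "\<And>n. norm (x n) \<le> R"
    by (auto simp: bounded_iff)
  then have "\<forall>n. x n \<in> M \<inter> cball 0 R"
    using * by auto
  then have "l \<in> M \<inter> cball 0 R"
    using * closed_sequentially[OF compact_imp_closed[OF compact_M]] by blast
  then show "l \<in> M" by simp
qed

lemma compact_G_cball: "compact (G \<inter> cball id_blinfun r)"
proof -
  have "G \<inter> cball id_blinfun r = G \<inter> (\<lambda>X. id_blinfun + X) ` (M \<inter> cball 0 r)"
  proof (intro equalityI subsetI)
    fix g assume "g \<in> G \<inter> cball id_blinfun r"
    then show "g \<in> G \<inter> (\<lambda>X. id_blinfun + X) ` (M \<inter> cball 0 r)"
      using G_M by (auto intro!: image_eqI[of _ _ "g - id_blinfun"] simp: dist_norm norm_minus_commute)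
  qed (auto simp: dist_norm)
  then show ?thesis
    using closed_G by (simp add: closed_Int_compact compact_translation compact_M)
qed

lemma compact_G: "compact G"
proof -
  have "norm (id_blinfun - g) \<le> 2" if "g \<in> G" for g
    using norm_triangle_ineq4[of id_blinfun g] norm_le[OF that] norm_le[OF one] by simp
  then have "G \<inter> cball id_blinfun 2 = G"
    by (auto simp: dist_norm)
  then show ?thesis
    using compact_G_cball[of 2] by simp
qed

text \<open>The tangent space at the identity, described without one-parameter subgroups.\<close>

definition tangent :: "('v \<Rightarrow>\<^sub>L 'v) set"
  where "tangent = {X. \<exists>\<gamma>. (\<forall>s. \<gamma> s \<in> G) \<and>
    ((\<lambda>s. (\<gamma> s - id_blinfun) /\<^sub>R s) \<longlongrightarrow> X) (at_right (0::real))}"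

lemma tangentI:
  "\<lbrakk>\<And>s. \<gamma> s \<in> G; ((\<lambda>s. (\<gamma> s - id_blinfun) /\<^sub>R s) \<longlongrightarrow> X) (at_right 0)\<rbrakk> \<Longrightarrow> X \<in> tangent"
  unfolding tangent_def by blast

lemma tangentE:
  assumes "X \<in> tangent"
  obtains \<gamma> where "\<And>s. \<gamma> s \<in> G" "((\<lambda>s. (\<gamma> s - id_blinfun) /\<^sub>R s) \<longlongrightarrow> X) (at_right 0)"
    "(\<gamma> \<longlongrightarrow> id_blinfun) (at_right 0)"
proof -
  obtain \<gamma> where \<gamma>: "\<And>s. \<gamma> s \<in> G" and lim: "((\<lambda>s. (\<gamma> s - id_blinfun) /\<^sub>R s) \<longlongrightarrow> X) (at_right 0)"
    using assms unfolding tangent_def by blast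
  have "((\<lambda>s. s *\<^sub>R ((\<gamma> s - id_blinfun) /\<^sub>R s)) \<longlongrightarrow> 0 *\<^sub>R X) (at_right 0)"
    by (intro tendsto_scaleR tendsto_ident_at lim)
  moreover have "\<forall>\<^sub>F s in at_right 0. s *\<^sub>R ((\<gamma> s - id_blinfun) /\<^sub>R s) = \<gamma> s - id_blinfun"
    using eventually_at_right_less[of 0] by eventually_elim simp
  ultimately have "((\<lambda>s. \<gamma> s - id_blinfun) \<longlongrightarrow> 0) (at_right 0)"
    using Lim_transform_eventually by fastforce
  then show ?thesis
    using \<gamma> lim that LIM_zero_cancel by blast
qed

text \<open>To first order, products of curves add their directions, inverses negate them, and a
  change of speed scales them. Since s tends to 0 from the right only, negative factors are reached
  through inverses.\<close>

lemma subspace_tangent: "subspace tangent"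
proof (rule subspaceI)
  show zero: "0 \<in> tangent"
    by (rule tangentI[of "\<lambda>_. id_blinfun"]) (simp_all add: one)
  have minus: "- X \<in> tangent" if X: "X \<in> tangent" for X
  proof -
    obtain \<gamma> where \<gamma>: "\<And>s. \<gamma> s \<in> G" "((\<lambda>s. (\<gamma> s - id_blinfun) /\<^sub>R s) \<longlongrightarrow> X) (at_right 0)"
      "(\<gamma> \<longlongrightarrow> id_blinfun) (at_right 0)"
      by (rule tangentE[OF X]) blast
    have "((\<lambda>s. ginv (\<gamma> s) - id_blinfun) \<longlongrightarrow> 0) (at_right 0)"
    proof (rule Lim_null_comparison)
      show "((\<lambda>s. norm (\<gamma> s - id_blinfun)) \<longlongrightarrow> 0) (at_right 0)"
        using \<gamma>(3) by (simp add: LIM_zero tendsto_norm_zero)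
      have "ginv id_blinfun = id_blinfun" using ginv(2)[OF one] by simp
      then show "\<forall>\<^sub>F s in at_right 0. norm (ginv (\<gamma> s) - id_blinfun) \<le> norm (\<gamma> s - id_blinfun)"
        using norm_ginv_diff[OF \<gamma>(1) one] by (intro always_eventually) simp
    qed
    then have "((\<lambda>s. - (ginv (\<gamma> s) o\<^sub>L ((\<gamma> s - id_blinfun) /\<^sub>R s))) \<longlongrightarrow> - (id_blinfun o\<^sub>L X)) (at_right 0)"
      by (intro tendsto_minus bounded_bilinear.tendsto[OF bounded_bilinear_blinfun_compose] \<gamma>(2)) (rule LIM_zero_cancel)
    moreover have "- (ginv (\<gamma> s) o\<^sub>L ((\<gamma> s - id_blinfun) /\<^sub>R s)) = (ginv (\<gamma> s) - id_blinfun) /\<^sub>R s" for s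
      using ginv(3)[OF \<gamma>(1)[of s]] by (simp add: blinfun_compose_distrib algebra_simps)
    ultimately show ?thesis
      by (intro tangentI[of "\<lambda>s. ginv (\<gamma> s)"] ginv(1)[OF \<gamma>(1)]) simp
  qed
  have scale: "c *\<^sub>R X \<in> tangent" if X: "X \<in> tangent" and c: "c > 0" for c X
  proof -
    obtain \<gamma> where \<gamma>: "\<And>s. \<gamma> s \<in> G" "((\<lambda>s. (\<gamma> s - id_blinfun) /\<^sub>R s) \<longlongrightarrow> X) (at_right 0)"
      by (rule tangentE[OF X]) blast
    have "filterlim (\<lambda>s. c * s) (at_right 0) (at_right 0)"
      by (rule filterlim_times_pos[OF filterlim_ident c]) simp
    from tendsto_scaleR[OF tendsto_const filterlim_compose[OF \<gamma>(2) this], of c]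
    have "((\<lambda>s. (\<gamma> (c * s) - id_blinfun) /\<^sub>R s) \<longlongrightarrow> c *\<^sub>R X) (at_right 0)"
      using c by (simp add: mult.assoc[symmetric])
    then show ?thesis by (intro tangentI[of "\<lambda>s. \<gamma> (c * s)"] \<gamma>(1))
  qed
  show "c *\<^sub>R X \<in> tangent" if "X \<in> tangent" for c X
    using scale[OF that, of c] scale[OF minus[OF that], of "- c"] zero
    by (cases c "0::real" rule: linorder_cases) auto
  show "X + Y \<in> tangent" if X: "X \<in> tangent" and Y: "Y \<in> tangent" for X Y
  proof -
    obtain \<gamma> where \<gamma>: "\<And>s. \<gamma> s \<in> G" "((\<lambda>s. (\<gamma> s - id_blinfun) /\<^sub>R s) \<longlongrightarrow> X) (at_right 0)"
      "(\<gamma> \<longlongrightarrow> id_blinfun) (at_right 0)"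
      by (rule tangentE[OF X]) blast
    obtain \<delta> where \<delta>: "\<And>s. \<delta> s \<in> G" "((\<lambda>s. (\<delta> s - id_blinfun) /\<^sub>R s) \<longlongrightarrow> Y) (at_right 0)"
      by (rule tangentE[OF Y]) blast
    have "((\<lambda>s. (\<gamma> s - id_blinfun) /\<^sub>R s + (\<gamma> s o\<^sub>L ((\<delta> s - id_blinfun) /\<^sub>R s))) \<longlongrightarrow> X + (id_blinfun o\<^sub>L Y)) (at_right 0)"
      by (intro tendsto_add bounded_bilinear.tendsto[OF bounded_bilinear_blinfun_compose] \<gamma> \<delta>)
    moreover have "(\<gamma> s - id_blinfun) /\<^sub>R s + (\<gamma> s o\<^sub>L ((\<delta> s - id_blinfun) /\<^sub>R s)) = ((\<gamma> s o\<^sub>L \<delta> s) - id_blinfun) /\<^sub>R s" for s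
      by (simp add: blinfun_compose_distrib algebra_simps)
    ultimately show ?thesis
      by (intro tangentI[of "\<lambda>s. \<gamma> s o\<^sub>L \<delta> s"] mult \<gamma>(1) \<delta>(1)) simp
  qed
qed

lemmas tangent_minus = subspace_neg[OF subspace_tangent]

lemma tangent_subset: "tangent \<subseteq> M"
proof
  fix X assume "X \<in> tangent"
  then obtain \<gamma> where \<gamma>: "\<And>s. \<gamma> s \<in> G" "((\<lambda>s. (\<gamma> s - id_blinfun) /\<^sub>R s) \<longlongrightarrow> X) (at_right 0)"
    by (rule tangentE) blast
  show "X \<in> M"
    by (rule Lim_in_closed_set[OF closed_M _ _ \<gamma>(2)]) (simp_all add: G_M \<gamma>(1) subspace_scale[OF subspace_M])
qed

lemma tangent_approxE:
  assumes "X \<in> tangent" "\<eta> > 0"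
  obtains \<epsilon> where "\<epsilon> > 0"
    "\<And>s. 0 < s \<Longrightarrow> s < \<epsilon> \<Longrightarrow> \<exists>\<gamma>\<in>G. norm (\<gamma> - id_blinfun - s *\<^sub>R X) \<le> \<eta> * s"
proof -
  obtain \<gamma> where \<gamma>: "\<And>s. \<gamma> s \<in> G" "((\<lambda>s. (\<gamma> s - id_blinfun) /\<^sub>R s) \<longlongrightarrow> X) (at_right 0)"
    by (rule tangentE[OF assms(1)]) blast
  obtain \<epsilon> where \<epsilon>: "\<epsilon> > 0" "\<And>s. 0 < s \<Longrightarrow> s < \<epsilon> \<Longrightarrow> norm ((\<gamma> s - id_blinfun) /\<^sub>R s - X) < \<eta>"
    using tendstoD[OF \<gamma>(2) assms(2)] unfolding eventually_at_right_field dist_norm by blast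
  have "norm (\<gamma> s - id_blinfun - s *\<^sub>R X) \<le> \<eta> * s" if s: "0 < s" "s < \<epsilon>" for s
  proof -
    have "\<gamma> s - id_blinfun - s *\<^sub>R X = s *\<^sub>R ((\<gamma> s - id_blinfun) /\<^sub>R s - X)"
      using s by (simp add: scaleR_diff_right)
    then show ?thesis
      using \<epsilon>(2)[OF s] s by (simp only: norm_scaleR) (simp add: mult.commute less_imp_le)
  qed
  then show ?thesis using that \<epsilon>(1) \<gamma>(1) by blast
qed

text \<open>The hypothesis offers different group elements for different precisions. A point of the
  compact set G nearest to 1 + s X serves all precisions at once and so defines a single
  curve.\<close>

lemma tangent_approxI:
  assumes "\<And>\<eta>. \<eta> > 0 \<Longrightarrow> \<exists>\<epsilon>>0. \<forall>s. 0 < s \<and> s < \<epsilon> \<longrightarrow>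
    (\<exists>\<gamma>\<in>G. norm (\<gamma> - id_blinfun - s *\<^sub>R X) \<le> \<eta> * s)"
  shows "X \<in> tangent"
proof -
  have "\<exists>g\<in>G. \<forall>h\<in>G. norm (g - id_blinfun - s *\<^sub>R X) \<le> norm (h - id_blinfun - s *\<^sub>R X)" for s
    using one by (intro continuous_attains_inf compact_G continuous_intros) auto
  then obtain \<gamma> where \<gamma>: "\<And>s. \<gamma> s \<in> G"
    and min: "\<And>s h. h \<in> G \<Longrightarrow> norm (\<gamma> s - id_blinfun - s *\<^sub>R X) \<le> norm (h - id_blinfun - s *\<^sub>R X)"
    by metis
  show ?thesis
  proof (rule tangentI[OF \<gamma> tendstoI])
    fix e :: real assume e: "e > 0"
    then obtain \<epsilon> where \<epsilon>: "\<epsilon> > 0" "\<And>s. 0 < s \<Longrightarrow> s < \<epsilon> \<Longrightarrow> \<exists>\<gamma>\<in>G. norm (\<gamma> - id_blinfun - s *\<^sub>R X) \<le> e / 2 * s"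
      using assms[of "e / 2"] half_gt_zero[OF e] by blast
    have "dist ((\<gamma> s - id_blinfun) /\<^sub>R s) X < e" if s: "0 < s" "s < \<epsilon>" for s
    proof -
      have "(\<gamma> s - id_blinfun) /\<^sub>R s - X = (1 / s) *\<^sub>R (\<gamma> s - id_blinfun - s *\<^sub>R X)"
        using s by (simp add: scaleR_diff_right inverse_eq_divide)
      then have "norm ((\<gamma> s - id_blinfun) /\<^sub>R s - X) = norm (\<gamma> s - id_blinfun - s *\<^sub>R X) / s"
        using s by (simp only: norm_scaleR) simp
      also have "\<dots> \<le> e / 2"
        using min \<epsilon>(2)[OF s] s order_trans by (simp only: divide_le_eq if_True) blast
      finally show ?thesis using e by (simp add: dist_norm)
    qed
    then show "\<forall>\<^sub>F s in at_right 0. dist ((\<gamma> s - id_blinfun) /\<^sub>R s) X < e"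
      unfolding eventually_at_right_field using \<epsilon>(1) by blast
  qed
qed

section \<open>Powers of elements near the identity\<close>

primrec gpow :: "('v \<Rightarrow>\<^sub>L 'v) \<Rightarrow> nat \<Rightarrow> ('v \<Rightarrow>\<^sub>L 'v)"
  where "gpow x 0 = id_blinfun" | "gpow x (Suc m) = x o\<^sub>L gpow x m"

lemma gpow_in: "x \<in> G \<Longrightarrow> gpow x m \<in> G"
  by (induction m) (auto simp: one mult)

lemma norm_gpow_minus_id:
  assumes "x \<in> G" shows "norm (gpow x m - id_blinfun) \<le> m * norm (x - id_blinfun)"
proof (induction m)
  case (Suc m)
  have "gpow x (Suc m) - id_blinfun = (x o\<^sub>L (gpow x m - id_blinfun)) + (x - id_blinfun)"
    by (simp add: blinfun_compose_diff_right)
  also have "norm \<dots> \<le> m * norm (x - id_blinfun) + norm (x - id_blinfun)"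
    using Suc by (intro norm_triangle_le add_mono) (auto simp: norm_mult_left[OF assms])
  finally show ?case by (simp add: algebra_simps)
qed simp

text \<open>While m times the norm of x - 1 is small, the m-th power of x moves almost straight in
  the direction x - 1. This does the work that one-parameter subgroups would do.\<close>

lemma norm_gpow_linear:
  assumes "x \<in> G"
  shows "norm (gpow x m - id_blinfun - m *\<^sub>R (x - id_blinfun)) \<le> (m * norm (x - id_blinfun))\<^sup>2"
proof (induction m)
  case (Suc m)
  let ?u = "x - id_blinfun"
  have "gpow x (Suc m) - id_blinfun - (Suc m) *\<^sub>R ?u = 
      (gpow x m - id_blinfun - m *\<^sub>R ?u) + (?u o\<^sub>L (gpow x m - id_blinfun))"
    by (simp add: blinfun_compose_distrib algebra_simps)
  also have "norm \<dots> \<le> (m * norm ?u)\<^sup>2 + norm ?u * (m * norm ?u)"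
    using Suc norm_gpow_minus_id[OF assms, of m]
    by (intro norm_triangle_le add_mono order_trans[OF norm_blinfun_compose] mult_left_mono) auto
  also have "\<dots> \<le> (Suc m * norm ?u)\<^sup>2"
    by (simp add: power2_eq_square algebra_simps)
  finally show ?case .
qed simp

text \<open>Von Neumann's argument: a short step h_k whose direction is close to Z is iterated until
  it has travelled about the distance s. The power stays in G and lies near 1 + s Z.\<close>

lemma tangent_limit:
  assumes h: "\<And>k. h k \<in> G" and ne: "\<And>k. h k \<noteq> id_blinfun" and lim: "h \<longlonglongrightarrow> id_blinfun"
    and Z: "(\<lambda>k. (h k - id_blinfun) /\<^sub>R norm (h k - id_blinfun)) \<longlonglongrightarrow> Z"
  shows "Z \<in> tangent"
proof (rule tangent_approxI)
  fix \<eta> :: real assume \<eta>: "\<eta> > 0"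
  define \<tau> where "\<tau> k = norm (h k - id_blinfun)" for k
  have \<tau>: "\<tau> k > 0" for k
    using ne by (simp add: \<tau>_def)
  have \<tau>0: "\<tau> \<longlonglongrightarrow> 0"
    unfolding \<tau>_def using lim LIM_zero tendsto_norm_zero by blast
  have nZ: "norm Z \<le> 1"
    by (rule Lim_bounded[OF tendsto_norm[OF Z], of 0]) (auto simp: ne)
  \<comment> \<open>The bound on s makes the quadratic error of the power at most
    \<open>\<eta> / 2 * s\<close>. The other half of the allowance is shared equally by the
    deviation of the direction from Z and by rounding \<open>s / \<tau> k\<close> down to an
    integer.\<close>
  have "\<exists>\<gamma>\<in>G. norm (\<gamma> - id_blinfun - s *\<^sub>R Z) \<le> \<eta> * s" if s: "0 < s" "s < \<eta> / 2" for s
  proof -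
    have "\<forall>\<^sub>F k in sequentially. \<tau> k < \<eta> / 4 * s"
      using s \<eta> by (intro order_tendstoD(2)[OF \<tau>0]) simp
    moreover have "\<forall>\<^sub>F k in sequentially. dist ((h k - id_blinfun) /\<^sub>R norm (h k - id_blinfun)) Z < \<eta> / 4"
      using \<eta> by (intro tendstoD[OF Z]) simp
    ultimately obtain k where k: "\<tau> k < \<eta> / 4 * s"
        "dist ((h k - id_blinfun) /\<^sub>R norm (h k - id_blinfun)) Z < \<eta> / 4"
      using eventually_happens'[OF sequentially_bot eventually_conj] by blast
    define m where "m = nat \<lfloor>s / \<tau> k\<rfloor>"
    have "real m \<le> s / \<tau> k" "s / \<tau> k < real m + 1"
      using s \<tau>[of k] by (auto simp: m_def)
    then have m: "real m * \<tau> k \<le> s" "s < real m * \<tau> k + \<tau> k"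
      using \<tau>[of k] by (auto simp: field_simps)
    let ?u = "h k - id_blinfun"
    have u: "?u = \<tau> k *\<^sub>R (?u /\<^sub>R norm ?u)"
      using \<tau>[of k] by (simp add: \<tau>_def)
    have 1: "norm (gpow (h k) m - id_blinfun - m *\<^sub>R ?u) \<le> s * s"
    proof -
      have "(m * norm ?u)\<^sup>2 \<le> s\<^sup>2"
        using m(1) by (intro power_mono) (auto simp: \<tau>_def)
      then show ?thesis
        using norm_gpow_linear[OF h, of k m] by (simp add: power2_eq_square)
    qed
    have "m *\<^sub>R ?u - s *\<^sub>R Z = (m * \<tau> k) *\<^sub>R (?u /\<^sub>R norm ?u - Z) + (m * \<tau> k - s) *\<^sub>R Z"
      by (subst u) (simp add: algebra_simps)
    also have "norm \<dots> \<le> s * (\<eta> / 4) + \<tau> k * 1"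
    proof (intro norm_triangle_le add_mono)
      show "norm ((m * \<tau> k) *\<^sub>R (?u /\<^sub>R norm ?u - Z)) \<le> s * (\<eta> / 4)"
        unfolding norm_scaleR using k(2) m(1) \<tau>[of k] s by (intro mult_mono) (auto simp: dist_norm)
      show "norm ((m * \<tau> k - s) *\<^sub>R Z) \<le> \<tau> k * 1"
        unfolding norm_scaleR using m nZ \<tau>[of k] by (intro mult_mono) auto
    qed
    finally have 2: "norm (m *\<^sub>R ?u - s *\<^sub>R Z) \<le> \<eta> / 2 * s"
      using k(1) by (simp add: mult.commute[of s])
    have "gpow (h k) m - id_blinfun - s *\<^sub>R Z = (gpow (h k) m - id_blinfun - m *\<^sub>R ?u) + (m *\<^sub>R ?u - s *\<^sub>R Z)"
      by simp
    also have "norm \<dots> \<le> s * s + \<eta> / 2 * s"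
      using 1 2 by (intro norm_triangle_le add_mono)
    also have "\<dots> \<le> \<eta> / 2 * s + \<eta> / 2 * s"
      using s by (intro add_mono mult_right_mono) auto
    finally show ?thesis
      using gpow_in[OF h, of k m] by (intro bexI[of _ "gpow (h k) m"]) auto
  qed
  then show "\<exists>\<epsilon>>0. \<forall>s. 0 < s \<and> s < \<epsilon> \<longrightarrow> (\<exists>\<gamma>\<in>G. norm (\<gamma> - id_blinfun - s *\<^sub>R Z) \<le> \<eta> * s)"
    using \<eta> by (intro exI[of _ "\<eta> / 2"]) auto
qed

text \<open>An infinite sequence f would be normalised for \<open>ip\<close>, whereas compactness
  refers to the operator norm, hence the rescaled \<open>?g\<close>. A limit l of a subsequence has
  norm 1, so \<open>ip l l > 0\<close>; but consecutive members are orthogonal, so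
  \<open>ip l l\<close> is also a limit of zeros.\<close>

lemma tangent_basis_exists:
  "\<exists>n v. (\<forall>i<n. v i \<in> tangent) \<and> orthonormal_upto ip n v \<and>
      (\<forall>X\<in>tangent. X = (\<Sum>i<n. ip (v i) X *\<^sub>R v i))"
proof -
  interpret ip: bounded_bilinear ip by (rule ip)
  have "\<not> (\<exists>f. (\<forall>i. f i \<in> tangent) \<and> (\<forall>m. orthonormal_upto ip m f))"
  proof
    assume "\<exists>f. (\<forall>i. f i \<in> tangent) \<and> (\<forall>m. orthonormal_upto ip m f)"
    then obtain f where f: "\<And>i. f i \<in> tangent" "\<And>m. orthonormal_upto ip m f"
      by blast
    have ipf: "ip (f i) (f j) = of_bool (i = j)" for i j
      using orthonormal_uptoD[OF f(2)[of "Suc (max i j)"], of i j] by auto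
    have fM: "f i \<in> M" for i
      using f(1) tangent_subset by blast
    have f0: "f i \<noteq> 0" for i
      using ipf[of i i] ip.zero_left by auto
    have cont: "continuous_on A (\<lambda>X. ip X X)" for A
      by (intro ip.continuous_on continuous_intros)
    let ?g = "\<lambda>i. f i /\<^sub>R norm (f i)"
    have "?g i \<in> M \<inter> sphere 0 1" for i
      using fM subspace_M f0 by (auto simp: subspace_scale)
    then have g: "?g i \<in> M \<inter> cball 0 1" for i
      by fastforce
    obtain l r where r: "l \<in> M \<inter> cball 0 1" "strict_mono r" "(\<lambda>k. ?g (r k)) \<longlonglongrightarrow> l"
      by (rule compact_subseq[where f = ?g, OF compact_M g]) blast
    have "(\<lambda>k. norm (?g (r k))) \<longlonglongrightarrow> 1"
      using f0 by simp
    then have "norm l = 1"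
      using LIMSEQ_unique[OF tendsto_norm[OF r(3)]] by blast
    then have "ip l l > 0"
      using r(1) by (intro ip_pos) auto
    moreover have "(\<lambda>k. ip (?g (r k)) (?g (r (Suc k)))) \<longlonglongrightarrow> ip l l"
      using LIMSEQ_Suc[OF r(3)] by (intro ip.tendsto r(3))
    moreover have "ip (?g (r k)) (?g (r (Suc k))) = 0" for k
      using ipf[of "r k" "r (Suc k)"] r(2) strict_mono_Suc_iff[of r]
      by (simp add: ip.scaleR_left ip.scaleR_right less_imp_neq)
    ultimately show False
      by (simp add: LIMSEQ_const_iff)
  qed
  moreover have "0 < ip X X" if "X \<in> tangent" "X \<noteq> 0" for X
    using ip_pos[of X] that tangent_subset by blast
  ultimately show ?thesis
    using Gram_Schmidt_dichotomy[OF subspace_tangent ip_sym, OF bounded_linear.linear[OF ip.bounded_linear_right]]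
    by blast
qed

end

section \<open>Orthogonal projection to the tangent space\<close>

locale tangent_basis = closed_isometry_group G M ip
  for G M :: "('v::banach \<Rightarrow>\<^sub>L 'v) set" and ip +
  fixes n :: nat and v :: "nat \<Rightarrow> 'v \<Rightarrow>\<^sub>L 'v"
  assumes v_tangent: "i < n \<Longrightarrow> v i \<in> tangent"
    and v_orthonormal: "orthonormal_upto ip n v"
    and v_expand: "X \<in> tangent \<Longrightarrow> X = (\<Sum>i<n. ip (v i) X *\<^sub>R v i)"
begin

definition P :: "('v \<Rightarrow>\<^sub>L 'v) \<Rightarrow> ('v \<Rightarrow>\<^sub>L 'v)" where "P X = (\<Sum>i<n. ip (v i) X *\<^sub>R v i)"

definition emb :: "(nat \<Rightarrow> real) \<Rightarrow> ('v \<Rightarrow>\<^sub>L 'v)" where "emb x = (\<Sum>i<n. x i *\<^sub>R v i)"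

text \<open>The summand 1 keeps the constant positive when the tangent space is zero, so that 1 / (2
  K) can serve as a radius.\<close>

definition K :: real where "K = onorm P + 1"

lemma bounded_linear_ip: "bounded_linear (ip X)"
  by (rule bounded_bilinear.bounded_linear_right[OF ip])

lemma bounded_linear_P: "bounded_linear P"
  unfolding P_def by (intro bounded_linear_sum bounded_linear_scaleR_left[THEN bounded_linear_compose] bounded_linear_ip)

lemmas P_simps = linear_simps[OF bounded_linear_P]
lemmas ip_simps = linear_simps[OF bounded_linear_ip]

lemma K_pos: "K > 0"
  unfolding K_def using onorm_pos_le[OF bounded_linear_P] by simp

lemma norm_P: "norm (P X) \<le> K * norm X"
proof -
  have "norm (P X) \<le> onorm P * norm X"
    by (rule onorm[OF bounded_linear_P])
  also have "\<dots> \<le> K * norm X"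
    by (intro mult_right_mono) (auto simp: K_def)
  finally show ?thesis .
qed

lemma emb_tangent: "emb x \<in> tangent"
  unfolding emb_def by (intro subspace_sum[OF subspace_tangent] subspace_scale[OF subspace_tangent] v_tangent) auto

lemma P_tangent: "P X \<in> tangent"
  unfolding P_def by (intro subspace_sum[OF subspace_tangent] subspace_scale[OF subspace_tangent] v_tangent) auto

lemma P_id: "X \<in> tangent \<Longrightarrow> P X = X"
  using v_expand by (simp add: P_def)

lemma ip_emb: "i < n \<Longrightarrow> ip (v i) (emb x) = x i"
proof -
  assume i: "i < n"
  have "ip (v i) (emb x) = (\<Sum>j<n. x j * ip (v i) (v j))"
    by (simp add: emb_def bounded_linear.linear[OF bounded_linear_ip, THEN linear_sum] ip_simps)
  also have "\<dots> = (\<Sum>j<n. if j = i then x j else 0)"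
    using i v_orthonormal by (intro sum.cong) (auto simp: orthonormal_upto_def)
  finally show ?thesis using i by simp
qed

lemma emb_inject: "emb x = emb y \<Longrightarrow> i < n \<Longrightarrow> x i = y i"
  using ip_emb by metis

lemma emb_upd: "i < n \<Longrightarrow> emb (x(i := t)) = emb x + (t - x i) *\<^sub>R v i"
proof -
  assume i: "i < n"
  have "emb (x(i := t)) = (\<Sum>j<n. x j *\<^sub>R v j + (if j = i then (t - x i) *\<^sub>R v i else 0))"
    unfolding emb_def by (intro sum.cong) (auto simp: algebra_simps)
  then show ?thesis using i by (simp add: sum.distrib emb_def)
qed

lemma continuous_emb: "continuous_on A emb"
  unfolding emb_def
  by (intro continuous_intros continuous_on_subset[OF continuous_on_product_coordinates]) auto

text \<open>Otherwise the normalised differences of some g_k and h_k tending to 1 would have a limit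
  Z of norm 1 with P Z = 0. Multiplied by the inverse of h_k they become the directions of the group
  elements h_k^-1 g_k, so Z is tangent by \<open>tangent_limit\<close>, and then P Z = Z.\<close>

lemma P_bounded_below:
  "\<exists>c>0. \<exists>r>0. \<forall>g\<in>G. \<forall>h\<in>G. norm (g - id_blinfun) < r \<longrightarrow> norm (h - id_blinfun) < r \<longrightarrow>
    c * norm (g - h) \<le> norm (P (g - h))"
proof (rule ccontr)
  assume neg: "\<not> ?thesis"
  have "\<exists>g h. g \<in> G \<and> h \<in> G \<and> norm (g - id_blinfun) < 1 / Suc k \<and> norm (h - id_blinfun) < 1 / Suc k \<and>
    norm (P (g - h)) < 1 / Suc k * norm (g - h)" for k
  proof -
    have "1 / real (Suc k) > 0" by simp
    then show ?thesis using neg by (metis not_le)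
  qed
  then obtain g h where gh: "\<And>k. g k \<in> G" "\<And>k. h k \<in> G" "\<And>k. norm (g k - id_blinfun) < 1 / Suc k"
    "\<And>k. norm (h k - id_blinfun) < 1 / Suc k"
    "\<And>k. norm (P (g k - h k)) < 1 / Suc k * norm (g k - h k)"
    by metis
  have ne: "g k \<noteq> h k" for k
    using gh(5)[of k] by (auto simp: P_simps)
  have lim: "f \<longlonglongrightarrow> id_blinfun" if "\<And>k. norm (f k - id_blinfun) < 1 / Suc k" for f :: "nat \<Rightarrow> 'v \<Rightarrow>\<^sub>L 'v"
  proof -
    have "(\<lambda>k. f k - id_blinfun) \<longlonglongrightarrow> 0"
    proof (rule Lim_null_comparison)
      show "\<forall>\<^sub>F k in sequentially. norm (f k - id_blinfun) \<le> 1 / Suc k"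
        using that by (intro always_eventually allI less_imp_le)
      show "(\<lambda>k. 1 / real (Suc k)) \<longlonglongrightarrow> 0"
        using LIMSEQ_inverse_real_of_nat by (simp add: inverse_eq_divide)
    qed
    then show ?thesis by (simp add: LIM_zero_iff)
  qed
  define z where "z k = (g k - h k) /\<^sub>R norm (g k - h k)" for k
  have zM: "z k \<in> M \<inter> cball 0 1" for k
  proof -
    have "g k - h k = (g k - id_blinfun) - (h k - id_blinfun)" by simp
    then have "g k - h k \<in> M"
      using G_M gh(1,2) subspace_M by (metis subspace_diff)
    then show ?thesis using subspace_M ne[of k] by (simp add: z_def subspace_scale)
  qed
  obtain Z s where s: "strict_mono s" and Z: "(\<lambda>k. z (s k)) \<longlonglongrightarrow> Z"
    by (rule compact_subseq[where f = z, OF compact_M zM]) blast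
  let ?w = "\<lambda>k. ginv (h (s k)) o\<^sub>L g (s k)"
  have w: "?w k - id_blinfun = ginv (h (s k)) o\<^sub>L (g (s k) - h (s k))" for k
    using ginv[OF gh(2)] by (simp add: blinfun_compose_distrib)
  have nw: "norm (?w k - id_blinfun) = norm (g (s k) - h (s k))" for k
    unfolding w by (rule norm_mult_left[OF ginv(1)[OF gh(2)]])
  have hs: "(\<lambda>k. h (s k)) \<longlonglongrightarrow> id_blinfun" "(\<lambda>k. g (s k)) \<longlonglongrightarrow> id_blinfun"
    using LIMSEQ_subseq_LIMSEQ[OF lim[OF gh(4)] s] LIMSEQ_subseq_LIMSEQ[OF lim[OF gh(3)] s] by (simp_all add: o_def)
  have ginv1: "ginv id_blinfun = id_blinfun"
    using ginv(2)[OF one] by simp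
  have "(\<lambda>k. ginv (h (s k)) - id_blinfun) \<longlonglongrightarrow> 0"
  proof (rule Lim_null_comparison)
    show "\<forall>\<^sub>F k in sequentially. norm (ginv (h (s k)) - id_blinfun) \<le> norm (h (s k) - id_blinfun)"
      using norm_ginv_diff[OF gh(2) one] ginv1 by (intro always_eventually) simp
    show "(\<lambda>k. norm (h (s k) - id_blinfun)) \<longlonglongrightarrow> 0"
      using hs(1) by (simp add: LIM_zero tendsto_norm_zero)
  qed
  then have hinv: "(\<lambda>k. ginv (h (s k))) \<longlonglongrightarrow> id_blinfun"
    by (simp add: LIM_zero_iff)
  have "(\<lambda>k. ginv (h (s k)) o\<^sub>L z (s k)) \<longlonglongrightarrow> (id_blinfun o\<^sub>L Z)"
    by (rule bounded_bilinear.tendsto[OF bounded_bilinear_blinfun_compose hinv Z])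
  then have lim_w: "(\<lambda>k. (?w k - id_blinfun) /\<^sub>R norm (?w k - id_blinfun)) \<longlonglongrightarrow> Z"
    by (simp add: nw) (simp add: w z_def blinfun_compose_scaleR_right)
  have "Z \<in> tangent"
  proof (rule tangent_limit[OF _ _ _ lim_w])
    show "?w k \<in> G" for k
      using mult ginv(1) gh(1,2) by blast
    show "?w k \<noteq> id_blinfun" for k
      using nw[of k] ne[of "s k"] by auto
    show "?w \<longlonglongrightarrow> id_blinfun"
      using bounded_bilinear.tendsto[OF bounded_bilinear_blinfun_compose hinv hs(2)] by simp
  qed
  moreover have "P Z = 0"
  proof (rule LIMSEQ_unique)
    show "(\<lambda>k. P (z (s k))) \<longlonglongrightarrow> P Z"
      by (rule bounded_linear.tendsto[OF bounded_linear_P Z])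
    have "(\<lambda>k. P (z k)) \<longlonglongrightarrow> 0"
    proof (rule Lim_null_comparison)
      show "(\<lambda>k. 1 / real (Suc k)) \<longlonglongrightarrow> 0"
        using LIMSEQ_inverse_real_of_nat by (simp add: inverse_eq_divide)
      have "norm (P (z k)) \<le> 1 / Suc k" for k
      proof -
        have "P (z k) = inverse (norm (g k - h k)) *\<^sub>R P (g k - h k)"
          unfolding z_def by (rule linear_scale[OF bounded_linear.linear[OF bounded_linear_P]])
        then have "norm (P (z k)) = norm (P (g k - h k)) / norm (g k - h k)"
          by (simp add: divide_inverse mult.commute)
        also have "\<dots> \<le> 1 / Suc k"
          using gh(5)[of k] ne[of k] by (simp add: divide_le_eq del: of_nat_Suc)
        finally show ?thesis .
      qed
      then show "\<forall>\<^sub>F k in sequentially. norm (P (z k)) \<le> 1 / Suc k"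
        by (intro always_eventually allI)
    qed
    then show "(\<lambda>k. P (z (s k))) \<longlonglongrightarrow> 0"
      using LIMSEQ_subseq_LIMSEQ[OF _ s] by (force simp: o_def)
  qed
  ultimately have "Z = 0" using P_id by simp
  moreover have "(\<lambda>k. norm (z (s k))) \<longlonglongrightarrow> 1"
    using ne by (simp add: z_def)
  ultimately show False
    using LIMSEQ_unique[OF tendsto_norm[OF Z]] by force
qed

text \<open>For g within 1 / (2 K) of 1, the map sending Y to P (g Y) differs from the identity of
  the tangent space by at most 1/2. The equation is the fixed-point equation Y = V - P ((g - 1) Y)
  of a contraction.\<close>

lemma solve_tangent:
  assumes g: "norm (g - id_blinfun) \<le> 1 / (2 * K)" and V: "V \<in> tangent"
  shows "\<exists>Y\<in>tangent. P (g o\<^sub>L Y) = V"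
proof -
  let ?f = "\<lambda>Y. V - P ((g - id_blinfun) o\<^sub>L Y)"
  have "\<exists>!Y. Y \<in> tangent \<and> ?f Y = Y"
  proof (rule Banach_fix)
    have "closed {X. P X = X}"
      by (intro closed_Collect_eq linear_continuous_on[OF bounded_linear_P] continuous_on_id)
    moreover have "{X. P X = X} = tangent"
      using P_id P_tangent by (metis (mono_tags, lifting) mem_Collect_eq subsetI subset_antisym)
    ultimately show "complete tangent"
      by (simp add: complete_eq_closed)
    show "tangent \<noteq> {}" using V by blast
    show "?f ` tangent \<subseteq> tangent"
      using V P_tangent subspace_diff[OF subspace_tangent] by blast
    show "(1/2::real) < 1" "0 \<le> (1/2::real)" by auto
    fix X Y assume "X \<in> tangent" "Y \<in> tangent"
    have "?f X - ?f Y = P ((g - id_blinfun) o\<^sub>L (Y - X))"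
      by (simp add: blinfun_compose_distrib P_simps)
    also have "norm \<dots> \<le> K * (norm (g - id_blinfun) * norm (Y - X))"
      by (intro order_trans[OF norm_P] mult_left_mono norm_blinfun_compose) (use K_pos in auto)
    also have "\<dots> \<le> K * (1 / (2 * K) * norm (Y - X))"
      using g K_pos by (intro mult_left_mono mult_right_mono) auto
    also have "\<dots> = 1/2 * norm (Y - X)"
      using K_pos by simp
    finally show "dist (?f X) (?f Y) \<le> 1/2 * dist X Y"
      by (simp add: dist_norm norm_minus_commute)
  qed
  then obtain Y where Y: "Y \<in> tangent" "?f Y = Y" by blast
  have "P (g o\<^sub>L Y) = P Y + P ((g - id_blinfun) o\<^sub>L Y)"
    by (simp add: blinfun_compose_distrib P_simps)
  then show ?thesis
    using Y P_id[OF Y(1)] by (intro bexI[of _ Y]) (auto simp: algebra_simps)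
qed

text \<open>The same perturbation estimate, read as injectivity with a bound for the
  inverse.\<close>

lemma norm_tangent_le:
  assumes g: "norm (g - id_blinfun) \<le> 1 / (2 * K)" and Y: "Y \<in> tangent"
  shows "norm Y \<le> 2 * norm (P (g o\<^sub>L Y))"
proof -
  have "Y = P (g o\<^sub>L Y) - P ((g - id_blinfun) o\<^sub>L Y)"
    using P_id[OF Y] by (simp add: blinfun_compose_distrib P_simps)
  then have "norm Y \<le> norm (P (g o\<^sub>L Y)) + norm (P ((g - id_blinfun) o\<^sub>L Y))"
    using norm_triangle_ineq4[of "P (g o\<^sub>L Y)" "P ((g - id_blinfun) o\<^sub>L Y)"] by simp
  also have "norm (P ((g - id_blinfun) o\<^sub>L Y)) \<le> K * (norm (g - id_blinfun) * norm Y)"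
    by (intro order_trans[OF norm_P] mult_left_mono norm_blinfun_compose) (use K_pos in auto)
  also have "\<dots> \<le> K * (1 / (2 * K) * norm Y)"
    using g K_pos by (intro mult_left_mono mult_right_mono) auto
  also have "\<dots> = 1/2 * norm Y"
    using K_pos by simp
  finally show ?thesis by simp
qed

text \<open>Left translation by g is isometric, so the approximation available at the identity
  carries over to g without loss. The second bound keeps h inside a prescribed ball.\<close>

lemma tangent_move:
  assumes g: "g \<in> G" and Y: "Y \<in> tangent" and e: "\<eta> > 0" "\<delta> > 0"
  shows "\<exists>d>0. \<forall>s. 0 < s \<and> s < d \<longrightarrow> (\<exists>h\<in>G. norm (h - g - s *\<^sub>R (g o\<^sub>L Y)) \<le> \<eta> * s \<and> norm (h - g) < \<delta>)"
proof -
  obtain \<epsilon> where "\<epsilon> > 0" and \<epsilon>: "\<And>s. 0 < s \<Longrightarrow> s < \<epsilon> \<Longrightarrow> \<exists>\<gamma>\<in>G. norm (\<gamma> - id_blinfun - s *\<^sub>R Y) \<le> \<eta> * s"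
    by (rule tangent_approxE[OF Y e(1)]) blast
  define L where "L = \<eta> + norm (g o\<^sub>L Y)"
  have L: "L > 0" using e by (simp add: L_def add_pos_nonneg)
  have "\<exists>h\<in>G. norm (h - g - s *\<^sub>R (g o\<^sub>L Y)) \<le> \<eta> * s \<and> norm (h - g) < \<delta>"
    if s: "0 < s" "s < min \<epsilon> (\<delta> / L)" for s
  proof -
    obtain \<gamma> where \<gamma>: "\<gamma> \<in> G" "norm (\<gamma> - id_blinfun - s *\<^sub>R Y) \<le> \<eta> * s"
      using \<epsilon>[of s] s by auto
    have "(g o\<^sub>L \<gamma>) - g - s *\<^sub>R (g o\<^sub>L Y) = g o\<^sub>L (\<gamma> - id_blinfun - s *\<^sub>R Y)"
      by (simp add: blinfun_compose_distrib)
    then have 1: "norm ((g o\<^sub>L \<gamma>) - g - s *\<^sub>R (g o\<^sub>L Y)) \<le> \<eta> * s"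
      using \<gamma>(2) by (simp only: norm_mult_left[OF g])
    have "norm ((g o\<^sub>L \<gamma>) - g) \<le> norm ((g o\<^sub>L \<gamma>) - g - s *\<^sub>R (g o\<^sub>L Y)) + norm (s *\<^sub>R (g o\<^sub>L Y))"
      using norm_triangle_ineq[of "(g o\<^sub>L \<gamma>) - g - s *\<^sub>R (g o\<^sub>L Y)" "s *\<^sub>R (g o\<^sub>L Y)"] by simp
    also have "\<dots> \<le> s * L"
      using 1 s by (simp add: L_def algebra_simps)
    also have "\<dots> < \<delta>"
      using s L by (simp add: pos_less_divide_eq)
    finally show ?thesis
      using 1 mult[OF g \<gamma>(1)] by blast
  qed
  moreover have "min \<epsilon> (\<delta> / L) > 0"
    using \<open>\<epsilon> > 0\<close> L e by simp
  ultimately show ?thesis by blast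
qed

text \<open>The candidate g minimises the distance of P (g - 1) to w. If a residual y remained,
  moving g in a direction with P (g Y) = y would shorten it. The radius \<open>c * r / 4\<close>
  leaves room for that: c times the norm of g - 1 is at most twice the norm of w, so g is off the
  boundary of the ball of radius r / 2.\<close>

lemma P_locally_onto:
  assumes c: "c > 0" and r: "r > 0" "r \<le> 1 / (2 * K)"
    and below: "\<And>g h. \<lbrakk>g \<in> G; h \<in> G; norm (g - id_blinfun) < r; norm (h - id_blinfun) < r\<rbrakk> \<Longrightarrow>
      c * norm (g - h) \<le> norm (P (g - h))"
    and w: "w \<in> tangent" "norm w < c * r / 4"
  shows "\<exists>g\<in>G. norm (g - id_blinfun) < r \<and> P (g - id_blinfun) = w"
proof -
  let ?f = "\<lambda>g. norm (P (g - id_blinfun) - w)"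
  let ?C = "G \<inter> cball id_blinfun (r / 2)"
  have C: "g \<in> ?C \<longleftrightarrow> g \<in> G \<and> norm (g - id_blinfun) \<le> r / 2" for g
    by (auto simp: dist_norm norm_minus_commute)
  have "\<exists>g\<in>?C. \<forall>h\<in>?C. ?f g \<le> ?f h"
  proof (rule continuous_attains_inf[OF compact_G_cball])
    show "?C \<noteq> {}" using one r by (auto intro!: exI[of _ id_blinfun])
    show "continuous_on ?C ?f"
      by (intro continuous_intros bounded_linear.continuous_on[OF bounded_linear_P])
  qed
  then obtain g where g: "g \<in> G" "norm (g - id_blinfun) \<le> r / 2" and min: "\<And>h. h \<in> G \<Longrightarrow> norm (h - id_blinfun) \<le> r / 2 \<Longrightarrow> ?f g \<le> ?f h"
    using C by blast
  have fg: "?f g \<le> norm w"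
    using min[OF one] r by (simp add: P_simps)
  have "c * norm (g - id_blinfun) \<le> norm (P (g - id_blinfun))"
    using below[OF g(1) one] g(2) r by simp
  also have "\<dots> \<le> ?f g + norm w"
    using norm_triangle_ineq[of "P (g - id_blinfun) - w" w] by simp
  also have "\<dots> < c * (r / 2)"
    using fg w(2) by simp
  finally have g': "norm (g - id_blinfun) < r / 2"
    using c by simp
  define y where "y = w - P (g - id_blinfun)"
  have "y = 0"
  proof (rule ccontr)
    assume "y \<noteq> 0"
    have "y \<in> tangent"
      using w P_tangent by (simp add: y_def subspace_diff[OF subspace_tangent])
    then obtain Y where Y: "Y \<in> tangent" "P (g o\<^sub>L Y) = y"
      using solve_tangent[of g y] g(2) r by fastforce
    \<comment> \<open>A move of length s shortens the residual by s times its norm; with this error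
      rate the deviation of h from the straight move gives back at most half of that.\<close>
    define \<eta> where "\<eta> = norm y / (2 * K)"
    have \<eta>: "\<eta> > 0" "K * \<eta> < norm y"
      using \<open>y \<noteq> 0\<close> K_pos by (simp_all add: \<eta>_def)
    obtain d where d: "d > 0" and dd: "\<And>s. 0 < s \<Longrightarrow> s < d \<Longrightarrow> 
        \<exists>h\<in>G. norm (h - g - s *\<^sub>R (g o\<^sub>L Y)) \<le> \<eta> * s \<and> norm (h - g) < r / 2 - norm (g - id_blinfun)"
      using tangent_move[OF g(1) Y(1) \<eta>(1), of "r / 2 - norm (g - id_blinfun)"] g' by auto
    define s where "s = min (d / 2) (1 / 2)"
    have s: "0 < s" "s < d" "s < 1" using d by (auto simp: s_def)
    obtain h where h: "h \<in> G" "norm (h - g - s *\<^sub>R (g o\<^sub>L Y)) \<le> \<eta> * s" "norm (h - g) < r / 2 - norm (g - id_blinfun)"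
      using dd[OF s(1,2)] by blast
    have "norm (h - id_blinfun) \<le> r / 2"
      using h(3) norm_triangle_ineq[of "h - g" "g - id_blinfun"] by simp
    from min[OF h(1) this] have "norm y \<le> ?f h"
      by (simp add: y_def norm_minus_commute)
    also have "P (h - id_blinfun) - w = P (h - g - s *\<^sub>R (g o\<^sub>L Y)) - (1 - s) *\<^sub>R y"
      by (simp add: P_simps Y y_def algebra_simps)
    also have "norm \<dots> \<le> K * (\<eta> * s) + (1 - s) * norm y"
    proof (rule order_trans[OF norm_triangle_ineq4], rule add_mono)
      show "norm (P (h - g - s *\<^sub>R (g o\<^sub>L Y))) \<le> K * (\<eta> * s)"
        using h(2) K_pos by (intro order_trans[OF norm_P] mult_left_mono) auto
    qed (use s in simp)
    finally have "norm y * s \<le> K * \<eta> * s"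
      by (simp add: algebra_simps)
    then show False
      using \<eta>(2) s by simp
  qed
  then show ?thesis
    using g g' r by (intro bexI[of _ g]) (auto simp: y_def)
qed

end


section \<open>The chart at the identity\<close>

locale tangent_chart = tangent_basis G M ip n v
  for G M :: "('v::banach \<Rightarrow>\<^sub>L 'v) set" and ip n v +
  fixes c r \<rho> :: real
  assumes c: "c > 0" and r: "r > 0" "r \<le> 1 / (2 * K)" and \<rho>: "\<rho> > 0"
    and below: "\<lbrakk>g \<in> G; h \<in> G; norm (g - id_blinfun) < r; norm (h - id_blinfun) < r\<rbrakk> \<Longrightarrow>
      c * norm (g - h) \<le> norm (P (g - h))"
    and onto: "\<lbrakk>w \<in> tangent; norm w < \<rho>\<rbrakk> \<Longrightarrow> \<exists>g\<in>G. norm (g - id_blinfun) < r \<and> P (g - id_blinfun) = w"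
begin

definition D :: "(nat \<Rightarrow> real) set" where "D = {x. (\<forall>i\<ge>n. x i = 0) \<and> norm (emb x) < \<rho>}"

definition \<psi> :: "(nat \<Rightarrow> real) \<Rightarrow> ('v \<Rightarrow>\<^sub>L 'v)"
  where "\<psi> x = (SOME g. g \<in> G \<and> norm (g - id_blinfun) < r \<and> P (g - id_blinfun) = emb x)"

text \<open>The left logarithmic derivative of \<open>\<psi>\<close> in direction i, defined by an
  equation because differentiability is not yet known.\<close>

definition Y :: "nat \<Rightarrow> (nat \<Rightarrow> real) \<Rightarrow> ('v \<Rightarrow>\<^sub>L 'v)"
  where "Y i x = (SOME y. y \<in> tangent \<and> P (\<psi> x o\<^sub>L y) = v i)"

lemma \<psi>:
  assumes "x \<in> D"
  shows "\<psi> x \<in> G" "norm (\<psi> x - id_blinfun) < r" "P (\<psi> x - id_blinfun) = emb x"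
  using someI_ex[of "\<lambda>g. g \<in> G \<and> norm (g - id_blinfun) < r \<and> P (g - id_blinfun) = emb x"]
    onto[OF emb_tangent, of x] assms unfolding \<psi>_def D_def by auto

lemma \<psi>_small: "x \<in> D \<Longrightarrow> norm (\<psi> x - id_blinfun) \<le> 1 / (2 * K)"
  using \<psi>(2)[of x] r by simp

lemma Y:
  assumes "x \<in> D" "i < n"
  shows "Y i x \<in> tangent" "P (\<psi> x o\<^sub>L Y i x) = v i"
  using someI_ex[of "\<lambda>y. y \<in> tangent \<and> P (\<psi> x o\<^sub>L y) = v i"]
    solve_tangent[OF \<psi>_small[OF assms(1)] v_tangent[OF assms(2)]] unfolding Y_def by auto

lemma \<psi>_unique:
  assumes "x \<in> D" "g \<in> G" "norm (g - id_blinfun) < r" "P (g - id_blinfun) = emb x"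
  shows "\<psi> x = g"
proof -
  have "P (\<psi> x - g) = P (\<psi> x - id_blinfun) - P (g - id_blinfun)"
    by (simp add: P_simps)
  then have "c * norm (\<psi> x - g) \<le> 0"
    using below[OF \<psi>(1)[OF assms(1)] assms(2) \<psi>(2)[OF assms(1)] assms(3)] \<psi>(3)[OF assms(1)] assms(4) by simp
  then show ?thesis using c by (simp add: mult_le_0_iff)
qed

lemma \<psi>_lipschitz:
  assumes "x \<in> D" "y \<in> D"
  shows "c * norm (\<psi> x - \<psi> y) \<le> norm (emb x - emb y)"
proof -
  have "P (\<psi> x - \<psi> y) = P (\<psi> x - id_blinfun) - P (\<psi> y - id_blinfun)"
    by (simp add: P_simps)
  then show ?thesis
    using below[OF \<psi>(1)[OF assms(1)] \<psi>(1)[OF assms(2)] \<psi>(2)[OF assms(1)] \<psi>(2)[OF assms(2)]]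
      \<psi>(3)[OF assms(1)] \<psi>(3)[OF assms(2)] by simp
qed

lemma continuous_\<psi>: "continuous_on D \<psi>"
  unfolding continuous_on_def
proof
  fix x assume x: "x \<in> D"
  have "((\<lambda>y. emb y - emb x) \<longlongrightarrow> 0) (at x within D)"
    using continuous_emb[of D] x by (simp add: continuous_on_def LIM_zero)
  then have "((\<lambda>y. norm (emb y - emb x) / c) \<longlongrightarrow> 0) (at x within D)"
    by (intro tendsto_divide_zero tendsto_norm_zero)
  then have "((\<lambda>y. \<psi> y - \<psi> x) \<longlongrightarrow> 0) (at x within D)"
  proof (rule Lim_null_comparison[rotated])
    show "\<forall>\<^sub>F y in at x within D. norm (\<psi> y - \<psi> x) \<le> norm (emb y - emb x) / c"
      unfolding eventually_at_filter using \<psi>_lipschitz[OF _ x] c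
      by (intro always_eventually) (auto simp: field_simps)
  qed
  then show "(\<psi> \<longlongrightarrow> \<psi> x) (at x within D)"
    by (simp add: LIM_zero_iff)
qed

text \<open>The difference of the two vectors is tangent, and subtracting their defining equations
  leaves only the change of \<open>\<psi>\<close> acting on \<open>Y i x\<close>.\<close>

lemma Y_lipschitz:
  assumes "x \<in> D" "y \<in> D" "i < n"
  shows "norm (Y i y - Y i x) \<le> 2 * (K * (norm (\<psi> y - \<psi> x) * norm (Y i x)))"
proof -
  have "Y i y - Y i x \<in> tangent"
    using Y(1) assms by (intro subspace_diff[OF subspace_tangent]) auto
  then have "norm (Y i y - Y i x) \<le> 2 * norm (P (\<psi> y o\<^sub>L (Y i y - Y i x)))"
    by (rule norm_tangent_le[OF \<psi>_small[OF assms(2)]])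
  also have "P (\<psi> y o\<^sub>L (Y i y - Y i x)) = - P ((\<psi> y - \<psi> x) o\<^sub>L Y i x)"
    using Y(2)[OF assms(1,3)] Y(2)[OF assms(2,3)]
    by (simp add: blinfun_compose_distrib P_simps)
  also have "norm (- P ((\<psi> y - \<psi> x) o\<^sub>L Y i x)) \<le> K * (norm (\<psi> y - \<psi> x) * norm (Y i x))"
    unfolding norm_minus_cancel
    by (intro order_trans[OF norm_P] mult_left_mono norm_blinfun_compose) (use K_pos in auto)
  finally show ?thesis by simp
qed

lemma continuous_Y:
  assumes i: "i < n"
  shows "continuous_on D (Y i)"
  unfolding continuous_on_def
proof
  fix x assume x: "x \<in> D"
  have "((\<lambda>y. \<psi> y - \<psi> x) \<longlongrightarrow> 0) (at x within D)"
    using continuous_\<psi> x by (simp add: continuous_on_def LIM_zero)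
  then have "((\<lambda>y. 2 * (K * (norm (\<psi> y - \<psi> x) * norm (Y i x)))) \<longlongrightarrow> 0) (at x within D)"
    by (intro tendsto_mult_right_zero tendsto_mult_left_zero tendsto_norm_zero)
  then have "((\<lambda>y. Y i y - Y i x) \<longlongrightarrow> 0) (at x within D)"
  proof (rule Lim_null_comparison[rotated])
    show "\<forall>\<^sub>F y in at x within D. norm (Y i y - Y i x) \<le> 2 * (K * (norm (\<psi> y - \<psi> x) * norm (Y i x)))"
      unfolding eventually_at_filter using Y_lipschitz[OF x _ i]
      by (intro always_eventually) auto
  qed
  then show "(Y i \<longlongrightarrow> Y i x) (at x within D)"
    by (simp add: LIM_zero_iff)
qed

section \<open>Derivatives of the parametrisation\<close>

text \<open>G contains a point h within \<open>\<eta> * s\<close> of the straight displacement. The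
  images of h and \<open>\<psi> y\<close> under P differ by at most \<open>K * \<eta> * s\<close>,
  and as P is bounded below near 1, h and \<open>\<psi> y\<close> are themselves close.\<close>

lemma \<psi>_step:
  assumes x: "x \<in> D" and Z: "Z \<in> tangent" and e: "e > 0"
  shows "\<exists>d>0. \<forall>s y. 0 < s \<and> s < d \<and> y \<in> D \<and> emb y = emb x + s *\<^sub>R P (\<psi> x o\<^sub>L Z) \<longrightarrow>
    norm (\<psi> y - \<psi> x - s *\<^sub>R (\<psi> x o\<^sub>L Z)) \<le> e * s"
proof -
  \<comment> \<open>The errors are \<open>\<eta> * s\<close> for the displacement and
    \<open>K * \<eta> / c * s\<close> for inverting P; this choice makes their sum
    \<open>e * s\<close>.\<close>
  define \<eta> where "\<eta> = e / (1 + K / c)"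
  have Kc: "1 + K / c > 0" using K_pos c by (simp add: add_pos_pos)
  have "\<eta> + K * \<eta> / c = \<eta> * (1 + K / c)"
    by (simp add: algebra_simps)
  then have \<eta>: "\<eta> > 0" "\<eta> + K * \<eta> / c = e"
    using e Kc by (simp_all add: \<eta>_def)
  have pos: "0 < r - norm (\<psi> x - id_blinfun)" using \<psi>(2)[OF x] by simp
  obtain d where d: "d > 0" and dd: "\<And>s. 0 < s \<Longrightarrow> s < d \<Longrightarrow> 
      \<exists>h\<in>G. norm (h - \<psi> x - s *\<^sub>R (\<psi> x o\<^sub>L Z)) \<le> \<eta> * s \<and> norm (h - \<psi> x) < r - norm (\<psi> x - id_blinfun)"
    using tangent_move[OF \<psi>(1)[OF x] Z \<eta>(1) pos] by blast
  have "norm (\<psi> y - \<psi> x - s *\<^sub>R (\<psi> x o\<^sub>L Z)) \<le> e * s"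
    if s: "0 < s" "s < d" and y: "y \<in> D" "emb y = emb x + s *\<^sub>R P (\<psi> x o\<^sub>L Z)" for s y
  proof -
    obtain h where h: "h \<in> G" "norm (h - \<psi> x - s *\<^sub>R (\<psi> x o\<^sub>L Z)) \<le> \<eta> * s" "norm (h - \<psi> x) < r - norm (\<psi> x - id_blinfun)"
      using dd[OF s] by blast
    have hr: "norm (h - id_blinfun) < r"
      using h(3) norm_triangle_ineq[of "h - \<psi> x" "\<psi> x - id_blinfun"] by simp
    have "P (\<psi> y - h) = P (\<psi> y - id_blinfun) - P (\<psi> x - id_blinfun) - s *\<^sub>R P (\<psi> x o\<^sub>L Z) - P (h - \<psi> x - s *\<^sub>R (\<psi> x o\<^sub>L Z))"
      by (simp add: P_simps)
    also have "\<dots> = - P (h - \<psi> x - s *\<^sub>R (\<psi> x o\<^sub>L Z))"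
      using \<psi>(3)[OF x] \<psi>(3)[OF y(1)] y(2) by simp
    finally have "c * norm (\<psi> y - h) \<le> norm (P (h - \<psi> x - s *\<^sub>R (\<psi> x o\<^sub>L Z)))"
      using below[OF \<psi>(1)[OF y(1)] h(1) \<psi>(2)[OF y(1)] hr] by simp
    also have "\<dots> \<le> K * (\<eta> * s)"
      using h(2) K_pos by (intro order_trans[OF norm_P] mult_left_mono) auto
    finally have *: "norm (\<psi> y - h) \<le> K * \<eta> / c * s"
      using c by (simp add: field_simps)
    have "\<psi> y - \<psi> x - s *\<^sub>R (\<psi> x o\<^sub>L Z) = (h - \<psi> x - s *\<^sub>R (\<psi> x o\<^sub>L Z)) + (\<psi> y - h)"
      by simp
    also have "norm \<dots> \<le> \<eta> * s + K * \<eta> / c * s"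
      using h(2) * by (intro norm_triangle_le add_mono)
    also have "\<dots> = e * s"
      by (simp flip: \<eta>(2) add: algebra_simps)
    finally show ?thesis .
  qed
  then show ?thesis using d by blast
qed

lemma D_upd:
  assumes "x \<in> D" "i < n"
  shows "\<forall>\<^sub>F t in nhds (x i). x(i := t) \<in> D"
proof -
  have "((\<lambda>t. norm (emb (x(i := t)))) \<longlongrightarrow> norm (emb x + (x i - x i) *\<^sub>R v i)) (nhds (x i))"
    unfolding emb_upd[OF assms(2)] by (intro tendsto_intros filterlim_ident)
  then have "\<forall>\<^sub>F t in nhds (x i). norm (emb (x(i := t))) < \<rho>"
    using assms(1) by (intro order_tendstoD(2)) (auto simp: D_def)
  then show ?thesis
    by eventually_elim (use assms in \<open>auto simp: D_def\<close>)
qed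

lemma D_upd_dist:
  assumes "x \<in> D" "i < n"
  obtains d where "d > 0" "\<And>t. \<bar>t - x i\<bar> < d \<Longrightarrow> x(i := t) \<in> D"
  using D_upd[OF assms] unfolding eventually_nhds_metric dist_real_def by blast

lemma has_vector_derivative_at_alt:
  "(f has_vector_derivative f') (at (a::real)) \<longleftrightarrow>
    (\<forall>e>0. \<exists>d>0. \<forall>t. \<bar>t - a\<bar> < d \<longrightarrow> norm (f t - f a - (t - a) *\<^sub>R f') \<le> e * \<bar>t - a\<bar>)"
  unfolding has_vector_derivative_def has_derivative_at_alt
  by (simp add: bounded_linear_scaleR_left)

lemma \<psi>_derivative:
  assumes x: "x \<in> D" and i: "i < n"
  shows "((\<lambda>t. \<psi> (x(i := t))) has_vector_derivative (\<psi> x o\<^sub>L Y i x)) (at (x i))"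
  unfolding has_vector_derivative_at_alt
proof (intro allI impI)
  fix e :: real assume e: "e > 0"
  obtain d0 where d0: "d0 > 0" "\<And>t. \<bar>t - x i\<bar> < d0 \<Longrightarrow> x(i := t) \<in> D"
    by (rule D_upd_dist[OF x i]) blast
  \<comment> \<open>Tangent vectors give one-sided information: t to the right of \<open>x i\<close>
    uses Y, t to the left uses its negative.\<close>
  have Yt: "Y i x \<in> tangent" "- Y i x \<in> tangent"
    using Y[OF x i] tangent_minus by auto
  obtain d1 where d1: "d1 > 0" "\<And>s y. 0 < s \<Longrightarrow> s < d1 \<Longrightarrow> y \<in> D \<Longrightarrow> emb y = emb x + s *\<^sub>R P (\<psi> x o\<^sub>L Y i x) \<Longrightarrow>
    norm (\<psi> y - \<psi> x - s *\<^sub>R (\<psi> x o\<^sub>L Y i x)) \<le> e * s"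
    using \<psi>_step[OF x Yt(1) e] by blast
  obtain d2 where d2: "d2 > 0" "\<And>s y. 0 < s \<Longrightarrow> s < d2 \<Longrightarrow> y \<in> D \<Longrightarrow> emb y = emb x + s *\<^sub>R P (\<psi> x o\<^sub>L (- Y i x)) \<Longrightarrow>
    norm (\<psi> y - \<psi> x - s *\<^sub>R (\<psi> x o\<^sub>L (- Y i x))) \<le> e * s"
    using \<psi>_step[OF x Yt(2) e] by blast
  have minus: "\<psi> x o\<^sub>L (- Y i x) = - (\<psi> x o\<^sub>L Y i x)"
    by (rule bounded_bilinear.minus_right[OF bounded_bilinear_blinfun_compose])
  have "norm (\<psi> (x(i := t)) - \<psi> (x(i := x i)) - (t - x i) *\<^sub>R (\<psi> x o\<^sub>L Y i x)) \<le> e * \<bar>t - x i\<bar>"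
    if t: "\<bar>t - x i\<bar> < min d0 (min d1 d2)" for t
  proof -
    consider "t = x i" | "t > x i" | "t < x i" by linarith
    then show ?thesis
    proof cases
      case 2
      then show ?thesis
        using d1(2)[of "t - x i" "x(i := t)"] d0(2)[of t] t emb_upd[OF i, of x t] Y(2)[OF x i] by simp
    next
      case 3
      then show ?thesis
        using d2(2)[of "x i - t" "x(i := t)"] d0(2)[of t] t emb_upd[OF i, of x t] Y(2)[OF x i] 
        by (simp add: minus P_simps algebra_simps)
    qed simp
  qed
  then show "\<exists>d>0. \<forall>t. \<bar>t - x i\<bar> < d \<longrightarrow> norm (\<psi> (x(i := t)) - \<psi> (x(i := x i)) - (t - x i) *\<^sub>R (\<psi> x o\<^sub>L Y i x)) \<le> e * \<bar>t - x i\<bar>"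
    using d0(1) d1(1) d2(1) by (intro exI[of _ "min d0 (min d1 d2)"]) auto
qed


lemma has_vector_derivative_quotient:
  "(f has_vector_derivative f') (at (a::real)) \<longleftrightarrow> ((\<lambda>t. (f t - f a) /\<^sub>R (t - a)) \<longlongrightarrow> f') (at a)"
proof -
  have "norm ((f t - f a) - (t - a) *\<^sub>R f') / norm (t - a) = norm ((f t - f a) /\<^sub>R (t - a) - f')" if "t \<noteq> a" for t
  proof -
    have "(f t - f a) /\<^sub>R (t - a) - f' = inverse (t - a) *\<^sub>R ((f t - f a) - (t - a) *\<^sub>R f')"
      using that by (simp add: scaleR_diff_right)
    then show ?thesis
      by (simp only: norm_scaleR) (simp add: divide_inverse abs_inverse)
  qed
  then have "((\<lambda>t. norm ((f t - f a) - (t - a) *\<^sub>R f') / norm (t - a)) \<longlongrightarrow> 0) (at a) \<longleftrightarrow>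
      ((\<lambda>t. norm ((f t - f a) /\<^sub>R (t - a) - f')) \<longlongrightarrow> 0) (at a)"
    by (intro tendsto_cong) (auto simp: eventually_at_filter)
  then show ?thesis
    unfolding has_vector_derivative_def has_derivative_iff_norm
    by (simp add: bounded_linear_scaleR_left tendsto_norm_zero_iff LIM_zero_iff)
qed

lemma \<psi>_limits:
  assumes x: "x \<in> D" and j: "j < n"
  shows "((\<lambda>t. (\<psi> (x(j := t)) - \<psi> x) /\<^sub>R (t - x j)) \<longlongrightarrow> (\<psi> x o\<^sub>L Y j x)) (at (x j))"
    and "((\<lambda>t. \<psi> (x(j := t))) \<longlongrightarrow> \<psi> x) (at (x j))"
    and "\<forall>\<^sub>F t in at (x j). x(j := t) \<in> D \<and> t \<noteq> x j"
proof -
  show "((\<lambda>t. (\<psi> (x(j := t)) - \<psi> x) /\<^sub>R (t - x j)) \<longlongrightarrow> (\<psi> x o\<^sub>L Y j x)) (at (x j))"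
    using \<psi>_derivative[OF x j] by (simp add: has_vector_derivative_quotient)
  show "((\<lambda>t. \<psi> (x(j := t))) \<longlongrightarrow> \<psi> x) (at (x j))"
    using has_vector_derivative_continuous[OF \<psi>_derivative[OF x j]] by (simp add: continuous_at)
  show "\<forall>\<^sub>F t in at (x j). x(j := t) \<in> D \<and> t \<noteq> x j"
    using D_upd[OF x j] unfolding eventually_at_filter by eventually_elim simp
qed

text \<open>Formally, the negative W of the derivative must satisfy P (\<open>\<psi>\<close> W) = P
  (\<open>\<psi>\<close> Y_j Y_i), and as the Y_k are preimages of the basis vectors v_k, this gives
  W explicitly. The difference quotient plus W is tangent, so \<open>norm_tangent_le\<close> reduces
  its convergence to that of an expression in which only \<open>\<psi>\<close> is
  differentiated.\<close>

lemma Y_derivative: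
  assumes x: "x \<in> D" and i: "i < n" and j: "j < n"
  shows "((\<lambda>t. Y i (x(j := t))) has_vector_derivative
    (- (\<Sum>k<n. ip (v k) (\<psi> x o\<^sub>L (Y j x o\<^sub>L Y i x)) *\<^sub>R Y k x))) (at (x j))"
proof -
  define W where "W = (\<Sum>k<n. ip (v k) (\<psi> x o\<^sub>L (Y j x o\<^sub>L Y i x)) *\<^sub>R Y k x)"
  have Wt: "W \<in> tangent"
    unfolding W_def by (intro subspace_sum[OF subspace_tangent] subspace_scale[OF subspace_tangent] Y(1) x) auto
  have PW: "P (\<psi> x o\<^sub>L W) = P (\<psi> x o\<^sub>L (Y j x o\<^sub>L Y i x))"
  proof -
    have "P (\<psi> x o\<^sub>L W) = (\<Sum>k<n. ip (v k) (\<psi> x o\<^sub>L (Y j x o\<^sub>L Y i x)) *\<^sub>R P (\<psi> x o\<^sub>L Y k x))"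
      by (simp add: W_def blinfun_compose_sum_right blinfun_compose_scaleR_right 
          linear_sum[OF bounded_linear.linear[OF bounded_linear_P]] P_simps)
    also have "\<dots> = P (\<psi> x o\<^sub>L (Y j x o\<^sub>L Y i x))"
      using Y(2)[OF x] by (simp add: P_def)
    finally show ?thesis .
  qed
  let ?q = "\<lambda>F t. (F (x(j := t)) - F x) /\<^sub>R (t - x j)"
  have "((\<lambda>t. ?q (Y i) t + W) \<longlongrightarrow> 0) (at (x j))"
  proof (rule Lim_null_comparison)
    have "((\<lambda>t. P (\<psi> (x(j := t)) o\<^sub>L W) - P (?q \<psi> t o\<^sub>L Y i x)) \<longlongrightarrow> P (\<psi> x o\<^sub>L W) - P ((\<psi> x o\<^sub>L Y j x) o\<^sub>L Y i x)) (at (x j))"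
      by (intro tendsto_diff bounded_linear.tendsto[OF bounded_linear_P]
          bounded_bilinear.tendsto[OF bounded_bilinear_blinfun_compose] \<psi>_limits[OF x j] tendsto_const)
    then show "((\<lambda>t. 2 * norm (P (\<psi> (x(j := t)) o\<^sub>L W) - P (?q \<psi> t o\<^sub>L Y i x))) \<longlongrightarrow> 0) (at (x j))"
      by (intro tendsto_mult_right_zero tendsto_norm_zero) (simp add: PW blinfun_compose_assoc)
    show "\<forall>\<^sub>F t in at (x j). norm (?q (Y i) t + W) \<le> 2 * norm (P (\<psi> (x(j := t)) o\<^sub>L W) - P (?q \<psi> t o\<^sub>L Y i x))"
      using \<psi>_limits(3)[OF x j]
    proof eventually_elim
      case (elim t)
      let ?y = "x(j := t)"
      have y: "?y \<in> D" using elim by simp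
      have "?q (Y i) t + W \<in> tangent"
        using Wt Y(1)[OF x i] Y(1)[OF y i]
        by (intro subspace_add[OF subspace_tangent] subspace_diff[OF subspace_tangent] subspace_scale[OF subspace_tangent])
      then have "norm (?q (Y i) t + W) \<le> 2 * norm (P (\<psi> ?y o\<^sub>L (?q (Y i) t + W)))"
        by (rule norm_tangent_le[OF \<psi>_small[OF y]])
      also have "P (\<psi> ?y o\<^sub>L (?q (Y i) t + W)) = P (\<psi> ?y o\<^sub>L W) - P (?q \<psi> t o\<^sub>L Y i x)"
        using Y(2)[OF x i] Y(2)[OF y i]
        by (simp add: blinfun_compose_distrib P_simps algebra_simps)
      finally show ?case .
    qed
  qed
  then have "((\<lambda>t. ?q (Y i) t - - W) \<longlongrightarrow> 0) (at (x j))"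
    by simp
  then show ?thesis
    unfolding has_vector_derivative_quotient W_def[symmetric] by (simp only: LIM_zero_iff fun_upd_triv)
qed

lemma ginv_\<psi>_derivative:
  assumes x: "x \<in> D" and i: "i < n"
  shows "((\<lambda>t. ginv (\<psi> (x(i := t)))) has_vector_derivative (- (Y i x o\<^sub>L ginv (\<psi> x)))) (at (x i))"
proof -
  let ?\<chi> = "\<lambda>t. ginv (\<psi> (x(i := t)))" and ?q = "\<lambda>t. (\<psi> (x(i := t)) - \<psi> x) /\<^sub>R (t - x i)"
  have "((\<lambda>t. ?\<chi> t - ginv (\<psi> x)) \<longlongrightarrow> 0) (at (x i))"
  proof (rule Lim_null_comparison)
    show "((\<lambda>t. norm (\<psi> (x(i := t)) - \<psi> x)) \<longlongrightarrow> 0) (at (x i))"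
      using \<psi>_limits(2)[OF x i] by (simp add: LIM_zero tendsto_norm_zero)
    show "\<forall>\<^sub>F t in at (x i). norm (?\<chi> t - ginv (\<psi> x)) \<le> norm (\<psi> (x(i := t)) - \<psi> x)"
      using \<psi>_limits(3)[OF x i] by eventually_elim (intro norm_ginv_diff \<psi>(1) x, simp)
  qed
  then have "((\<lambda>t. - (?\<chi> t o\<^sub>L (?q t o\<^sub>L ginv (\<psi> x)))) \<longlongrightarrow>
      - (ginv (\<psi> x) o\<^sub>L ((\<psi> x o\<^sub>L Y i x) o\<^sub>L ginv (\<psi> x)))) (at (x i))"
    by (intro tendsto_minus bounded_bilinear.tendsto[OF bounded_bilinear_blinfun_compose] \<psi>_limits[OF x i] tendsto_const)
      (rule LIM_zero_cancel)
  moreover have "ginv (\<psi> x) o\<^sub>L ((\<psi> x o\<^sub>L Y i x) o\<^sub>L ginv (\<psi> x)) = Y i x o\<^sub>L ginv (\<psi> x)"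
    using ginv(3)[OF \<psi>(1)[OF x]] by (simp flip: blinfun_compose_assoc)
  moreover have "\<forall>\<^sub>F t in at (x i). - (?\<chi> t o\<^sub>L (?q t o\<^sub>L ginv (\<psi> x))) = (?\<chi> t - ginv (\<psi> x)) /\<^sub>R (t - x i)"
    using \<psi>_limits(3)[OF x i]
  proof eventually_elim
    case (elim t)
    then have inv: "?\<chi> t o\<^sub>L (\<psi> (x(i := t)) o\<^sub>L X) = X" for X
      using ginv(3)[OF \<psi>(1)] by (simp flip: blinfun_compose_assoc)
    show ?case
      using ginv(2)[OF \<psi>(1)[OF x]]
      by (simp add: inv blinfun_compose_distrib blinfun_compose_assoc scaleR_diff_right)
  qed
  ultimately show ?thesis
    unfolding has_vector_derivative_quotient
    by (simp add: tendsto_cong)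
qed

lemma continuous_ginv: "continuous_on G ginv"
  unfolding continuous_on_iff dist_norm using norm_ginv_diff by (meson le_less_trans)

text \<open>The derivatives of \<open>\<psi>\<close> and of the Y_i are polynomial in these maps, so
  each gains an order once both have the previous one; hence the joint induction.\<close>

lemma CkV_\<psi>_Y: "CkV k n D \<psi> \<and> (\<forall>i<n. CkV k n D (Y i))"
proof (induction k)
  case 0
  then show ?case by (simp add: continuous_\<psi> continuous_Y)
next
  case (Suc k)
  note comp = CkV_bounded_bilinear[OF bounded_bilinear_blinfun_compose]
  have "CkV (Suc k) n D \<psi>"
    by (rule CkV_SucI[where F' = "\<lambda>i x. \<psi> x o\<^sub>L Y i x"])
      (use Suc in \<open>auto intro: continuous_\<psi> \<psi>_derivative comp\<close>)
  moreover have "CkV (Suc k) n D (Y i)" if i: "i < n" for i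
  proof (rule CkV_SucI[where F' = "\<lambda>j x. - (\<Sum>k<n. ip (v k) (\<psi> x o\<^sub>L (Y j x o\<^sub>L Y i x)) *\<^sub>R Y k x)"])
    fix j assume j: "j < n"
    have "CkV k n D (\<lambda>x. (\<Sum>k<n. ip (v k) (\<psi> x o\<^sub>L (Y j x o\<^sub>L Y i x)) *\<^sub>R Y k x))"
      using Suc i j
      by (intro CkV_sum CkV_bounded_bilinear[OF bounded_bilinear_scaleR] CkV_bounded_linear[OF bounded_linear_ip] comp) auto
    then show "CkV k n D (\<lambda>x. - (\<Sum>k<n. ip (v k) (\<psi> x o\<^sub>L (Y j x o\<^sub>L Y i x)) *\<^sub>R Y k x))"
      by (rule CkV_bounded_linear[OF bounded_linear_minus[OF bounded_linear_ident]])
  qed (use i continuous_Y Y_derivative in auto)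
  ultimately show ?case by blast
qed

lemma CkV_ginv_\<psi>: "CkV k n D (\<lambda>x. ginv (\<psi> x))"
proof (induction k)
  case 0
  show ?case
    using continuous_on_compose2[OF continuous_ginv continuous_\<psi>] \<psi>(1) by (auto simp: image_subset_iff)
next
  case (Suc k)
  show ?case
  proof (rule CkV_SucI[where F' = "\<lambda>i x. - (Y i x o\<^sub>L ginv (\<psi> x))"])
    show "continuous_on D (\<lambda>x. ginv (\<psi> x))"
      by (rule CkV_continuous[OF Suc])
    fix i assume i: "i < n"
    have "CkV k n D (\<lambda>x. Y i x o\<^sub>L ginv (\<psi> x))"
      using CkV_\<psi>_Y i by (intro CkV_bounded_bilinear[OF bounded_bilinear_blinfun_compose] Suc) auto
    then show "CkV k n D (\<lambda>x. - (Y i x o\<^sub>L ginv (\<psi> x)))"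
      by (rule CkV_bounded_linear[OF bounded_linear_minus[OF bounded_linear_ident]])
  qed (rule ginv_\<psi>_derivative)
qed

end

section \<open>Compact Lie groups\<close>

lemma second_countable_compact_metric:
  fixes S :: "'a::metric_space set"
  assumes "compact S"
  shows "second_countable (top_of_set S)"
proof -
  have "\<exists>C. finite C \<and> S \<subseteq> (\<Union>x\<in>C. ball x (1 / Suc m))" for m :: nat
    using assms unfolding compact_eq_totally_bounded by simp
  then obtain C where C: "\<And>m :: nat. finite (C m)" "\<And>m. S \<subseteq> (\<Union>x\<in>C m. ball x (1 / Suc m))"
    by metis
  define B where "B = (\<Union>m. (\<lambda>x. S \<inter> ball x (1 / Suc m)) ` C m)"
  have "countable B"
    unfolding B_def using C(1) by (auto intro: countable_finite)
  moreover have "\<forall>V\<in>B. openin (top_of_set S) V"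
    by (auto simp: B_def)
  moreover have "\<exists>V\<in>B. x \<in> V \<and> V \<subseteq> U" if U: "openin (top_of_set S) U" "x \<in> U" for U x
  proof -
    obtain e where e: "e > 0" "ball x e \<inter> S \<subseteq> U" and x: "x \<in> S"
      using U by (meson openin_contains_ball openin_imp_subset subsetD)
    obtain m where m: "1 / Suc m < e / 2"
      using e(1) by (metis half_gt_zero nat_approx_posE)
    obtain y where y: "y \<in> C m" "dist y x < 1 / Suc m"
      using C(2)[of m] x by auto
    have "S \<inter> ball y (1 / Suc m) \<subseteq> U"
    proof
      fix z assume z: "z \<in> S \<inter> ball y (1 / Suc m)"
      then have "dist x z < e"
        using y m dist_triangle[of x z y] by (auto simp: dist_commute)
      then show "z \<in> U" using e z by auto
    qed
    then show ?thesis
      using y x by (intro bexI[of _ "S \<inter> ball y (1 / Suc m)"]) (auto simp: B_def)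
  qed
  ultimately show ?thesis
    unfolding second_countable_def by blast
qed

lemma Euclidean_space_eq: "Euclidean_space n = top_of_set {x. \<forall>i\<ge>n. x i = 0}"
  by (simp add: Euclidean_space_def euclidean_product_topology)

section \<open>Translated charts and smoothness of the group operations\<close>

context tangent_chart
begin

text \<open>Left translates of the chart at the identity. Within \<open>r\<close> of the identity
  \<open>\<psi>\<close> is unique, and the bound \<open>\<rho>\<close> places the coordinates in
  \<open>D\<close>.\<close>

definition dom where "dom g = {u \<in> G. norm ((ginv g o\<^sub>L u) - id_blinfun) < r \<and> norm (P ((ginv g o\<^sub>L u) - id_blinfun)) < \<rho>}"

definition coords where "coords g u = (\<lambda>i. if i < n then ip (v i) ((ginv g o\<^sub>L u) - id_blinfun) else 0)"

definition atlas where "atlas = (\<lambda>g. (dom g, coords g)) ` G"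

lemma emb_coords: "emb (coords g u) = P ((ginv g o\<^sub>L u) - id_blinfun)"
  by (simp add: emb_def coords_def P_def)

lemma coords_in_D: "u \<in> dom g \<Longrightarrow> coords g u \<in> D"
  by (simp add: D_def emb_coords dom_def) (simp add: coords_def)

lemma mult_ginv: "g \<in> G \<Longrightarrow> g o\<^sub>L (ginv g o\<^sub>L X) = X" "g \<in> G \<Longrightarrow> ginv g o\<^sub>L (g o\<^sub>L X) = X"
  using ginv[of g] by (simp_all flip: blinfun_compose_assoc)

lemma \<psi>_coords:
  assumes "g \<in> G" "u \<in> dom g" shows "g o\<^sub>L \<psi> (coords g u) = u"
proof -
  have "\<psi> (coords g u) = ginv g o\<^sub>L u"
    using assms by (intro \<psi>_unique coords_in_D mult ginv) (auto simp: dom_def emb_coords)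
  then show ?thesis using mult_ginv assms by simp
qed

lemma \<psi>_in_dom:
  assumes "g \<in> G" "x \<in> D" shows "g o\<^sub>L \<psi> x \<in> dom g"
  using assms \<psi>[OF assms(2)] by (simp add: dom_def mult mult_ginv D_def)

lemma coords_\<psi>:
  assumes "g \<in> G" "x \<in> D" shows "coords g (g o\<^sub>L \<psi> x) = x"
proof
  fix i
  have "emb (coords g (g o\<^sub>L \<psi> x)) = emb x"
    using \<psi>(3)[OF assms(2)] assms by (simp add: emb_coords mult_ginv)
  from emb_inject[OF this, of i] show "coords g (g o\<^sub>L \<psi> x) i = x i"
    using assms(2) by (cases "i < n") (auto simp: coords_def D_def)
qed

lemma inj_on_coords: "g \<in> G \<Longrightarrow> inj_on (coords g) (dom g)"
  by (metis inj_onI \<psi>_coords)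

lemma inv_into_coords: "g \<in> G \<Longrightarrow> x \<in> D \<Longrightarrow> inv_into (dom g) (coords g) x = g o\<^sub>L \<psi> x"
  by (intro inv_into_f_eq inj_on_coords \<psi>_in_dom coords_\<psi>)

lemma coords_image: "g \<in> G \<Longrightarrow> coords g ` dom g \<subseteq> D"
  using coords_in_D by auto

lemma openin_dom: "openin (top_of_set G) (dom g)"
proof -
  have "open {u. norm ((ginv g o\<^sub>L u) - id_blinfun) < r \<and> norm (P ((ginv g o\<^sub>L u) - id_blinfun)) < \<rho>}"
    by (intro open_Collect_conj open_Collect_less continuous_intros
        bounded_linear.continuous_on[OF bounded_linear_P]
        bounded_linear.continuous_on[OF bounded_linear_blinfun_compose_right])
  then show ?thesis
    by (auto simp: dom_def openin_open)
qed

lemma openin_D: "openin (Euclidean_space n) D"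
proof -
  have "open {x. norm (emb x) < \<rho>}"
    by (intro open_Collect_less continuous_intros continuous_emb)
  then show ?thesis
    by (auto simp: Euclidean_space_eq D_def openin_open)
qed

lemma is_chart_coords: 
  assumes g: "g \<in> G" shows "is_chart (top_of_set G) n (dom g, coords g)"
proof -
  have 1: "subtopology (top_of_set G) (dom g) = top_of_set (dom g)"
    by (simp add: subtopology_subtopology dom_def Int_absorb1 Collect_conj_eq Int_assoc[symmetric]) 
  have 2: "subtopology (Euclidean_space n) D = top_of_set D"
  proof -
    have "{x. \<forall>i\<ge>n. x i = 0} \<inter> D = D" by (auto simp: D_def)
    then show ?thesis by (simp add: Euclidean_space_eq subtopology_subtopology)
  qed
  have "homeomorphic_maps (top_of_set (dom g)) (top_of_set D) (coords g) (\<lambda>x. g o\<^sub>L \<psi> x)"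
    unfolding homeomorphic_maps_def
  proof (intro conjI)
    have "continuous_on (dom g) (coords g)"
    proof (rule continuous_on_coordinatewise_then_product)
      fix i
      show "continuous_on (dom g) (\<lambda>u. coords g u i)"
        unfolding coords_def
        by (cases "i < n") (auto intro!: continuous_intros bounded_linear.continuous_on[OF bounded_linear_ip]
          bounded_linear.continuous_on[OF bounded_linear_blinfun_compose_right])
    qed
    then show "continuous_map (top_of_set (dom g)) (top_of_set D) (coords g)"
      using coords_in_D by (auto simp: continuous_map_subtopology_eu)
    have "continuous_on D (\<lambda>x. g o\<^sub>L \<psi> x)"
      by (intro bounded_linear.continuous_on[OF bounded_linear_blinfun_compose_right] continuous_\<psi>)
    then show "continuous_map (top_of_set D) (top_of_set (dom g)) (\<lambda>x. g o\<^sub>L \<psi> x)"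
      using \<psi>_in_dom[OF g] by (auto simp: continuous_map_subtopology_eu)
  qed (use \<psi>_coords coords_\<psi> g in auto)
  then have "homeomorphic_map (top_of_set (dom g)) (top_of_set D) (coords g)"
    by (rule homeomorphic_maps_imp_map)
  then show ?thesis
    unfolding is_chart_def using openin_dom openin_D 1 2 by auto
qed

lemma smooth_onI:
  assumes "\<And>j k. j < m \<Longrightarrow> CkV k N W (F j)"
    and "\<And>j x. j < m \<Longrightarrow> x \<in> W \<Longrightarrow> H x j = F j x" and "V \<subseteq> W"
    and "\<And>x i. x \<in> W \<Longrightarrow> i < N \<Longrightarrow> \<forall>\<^sub>F t in nhds (x i). x(i := t) \<in> W"
  shows "smooth_on N m V H"
  unfolding smooth_on_def
proof (intro allI impI)
  fix j k assume j: "j < m"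
  show "Ck_on k N V (\<lambda>x. H x j)"
    by (rule CkV_imp_Ck_on[OF assms(1)[OF j] _ assms(3,4)]) (use assms(2)[OF j] in auto)
qed

lemmas CkV_comp = CkV_bounded_bilinear[OF bounded_bilinear_blinfun_compose]

lemma CkV_coord:
  assumes "CkV k N W F"
  shows "CkV k N W (\<lambda>x. ip X ((a o\<^sub>L F x) - id_blinfun))"
proof -
  have "CkV k N W (\<lambda>x. (a o\<^sub>L F x) + - id_blinfun)"
    by (intro CkV_add CkV_const CkV_comp assms)
  then show ?thesis
    using CkV_bounded_linear[OF bounded_linear_ip, of k N W "\<lambda>x. (a o\<^sub>L F x) + - id_blinfun" X] by simp
qed

text \<open>Coordinates are the restriction of an affine function of the operator, and the inverse
  chart is a translate of \<open>\<psi>\<close>. So a transition map is an affine function of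
  \<open>\<psi>\<close>, smooth on all of \<open>D\<close> and in particular on the overlap.\<close>

lemma smooth_transition:
  assumes g: "g \<in> G" and h: "h \<in> G"
  shows "smooth_in_charts n n (dom g, coords g) (dom h, coords h) id"
  unfolding smooth_in_charts_def prod.case
proof (rule smooth_onI[where W = D and F = "\<lambda>j x. ip (v j) ((ginv h o\<^sub>L (g o\<^sub>L \<psi> x)) - id_blinfun)"])
  fix j k
  show "CkV k n D (\<lambda>x. ip (v j) ((ginv h o\<^sub>L (g o\<^sub>L \<psi> x)) - id_blinfun))"
    using CkV_\<psi>_Y by (intro CkV_coord CkV_comp CkV_const) auto
next
  show "(coords h \<circ> id \<circ> inv_into (dom g) (coords g)) x j = ip (v j) ((ginv h o\<^sub>L (g o\<^sub>L \<psi> x)) - id_blinfun)"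
    if "j < n" "x \<in> D" for j x
    using that g by (simp add: inv_into_coords) (simp add: coords_def)
qed (use coords_image[OF g] D_upd in blast)+

text \<open>The map f need agree with \<open>ginv\<close> on G only, because the inverse
  \<open>m_inv R\<close> of the group record may differ from it elsewhere.\<close>

lemma smooth_inverse:
  assumes g: "g \<in> G" and h: "h \<in> G" and f: "\<And>u. u \<in> G \<Longrightarrow> f u = ginv u"
  shows "smooth_in_charts n n (dom g, coords g) (dom h, coords h) f"
  unfolding smooth_in_charts_def prod.case
proof (rule smooth_onI[where W = D and F = "\<lambda>j x. ip (v j) ((ginv h o\<^sub>L (ginv (\<psi> x) o\<^sub>L ginv g)) - id_blinfun)"])
  fix j k
  show "CkV k n D (\<lambda>x. ip (v j) ((ginv h o\<^sub>L (ginv (\<psi> x) o\<^sub>L ginv g)) - id_blinfun))"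
    using CkV_ginv_\<psi> by (intro CkV_coord CkV_comp CkV_const) auto
next
  fix j x assume *: "j < n" "x \<in> D"
  have "ginv (g o\<^sub>L \<psi> x) = ginv (\<psi> x) o\<^sub>L ginv g"
  proof -
    have "ginv (g o\<^sub>L \<psi> x) = ginv (g o\<^sub>L \<psi> x) o\<^sub>L ((g o\<^sub>L \<psi> x) o\<^sub>L (ginv (\<psi> x) o\<^sub>L ginv g))"
      by (simp add: blinfun_compose_assoc mult_ginv(1)[OF \<psi>(1)[OF *(2)]] ginv(2)[OF g])
    also have "\<dots> = ginv (\<psi> x) o\<^sub>L ginv g"
      by (rule mult_ginv(2)[OF mult[OF g \<psi>(1)[OF *(2)]]])
    finally show ?thesis .
  qed
  then show "(coords h \<circ> f \<circ> inv_into (dom g) (coords g)) x j = ip (v j) ((ginv h o\<^sub>L (ginv (\<psi> x) o\<^sub>L ginv g)) - id_blinfun)"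
    using * g by (simp add: inv_into_coords f mult \<psi>(1)) (simp add: coords_def)
qed (use coords_image[OF g] D_upd in blast)+

text \<open>The summand 0 gives \<open>lower\<close> and \<open>upper\<close> the common shape to
  which \<open>CkV_coordinates\<close> applies.\<close>

definition lower where "lower z = (\<lambda>i. if i < n then z (i + 0) else (0::real))" for z :: "nat \<Rightarrow> real"
definition upper where "upper z = (\<lambda>i. if i < n then z (i + n) else (0::real))" for z :: "nat \<Rightarrow> real"
definition D2 where "D2 = {z. (\<forall>i\<ge>n+n. z i = 0) \<and> lower z \<in> D \<and> upper z \<in> D}"

lemma D2_upd:
  assumes "z \<in> D2" "i < n + n"
  shows "\<forall>\<^sub>F t in nhds (z i). z(i := t) \<in> D2"
proof (cases "i < n")
  case True
  have "lower (z(i := t)) = (lower z)(i := t)" "upper (z(i := t)) = upper z" for t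
    using True by (auto simp: lower_def upper_def fun_eq_iff)
  moreover have "\<forall>\<^sub>F t in nhds (lower z i). (lower z)(i := t) \<in> D"
    using assms True by (intro D_upd) (auto simp: D2_def)
  moreover have "lower z i = z i" using True by (simp add: lower_def)
  ultimately show ?thesis
    using assms by (auto simp: D2_def elim: eventually_mono)
next
  case False
  then have i: "i - n < n" "i - n + n = i" using assms by auto
  have "upper (z(i := t)) = (upper z)(i - n := t)" "lower (z(i := t)) = lower z" for t
    using False i by (auto simp: lower_def upper_def fun_eq_iff)
  moreover have "\<forall>\<^sub>F t in nhds (upper z (i - n)). (upper z)(i - n := t) \<in> D"
    using assms i by (intro D_upd) (auto simp: D2_def)
  moreover have "upper z (i - n) = z i" using i by (simp add: upper_def)
  ultimately show ?thesis
    using assms by (auto simp: D2_def elim: eventually_mono)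
qed

text \<open>Composition of operators is bilinear, so the product in charts is an affine function of
  a composite of two copies of \<open>\<psi>\<close>, one on each half of the coordinates.
  \<open>lower\<close> and \<open>upper\<close> undo the concatenation, which makes the product
  chart injective.\<close>

lemma smooth_mult:
  assumes g: "g \<in> G" "g' \<in> G" and h: "h \<in> G"
  shows "smooth_in_charts (n + n) n
    (dom g \<times> dom g', \<lambda>(x, y) i. if i < n then coords g x i else coords g' y (i - n)) (dom h, coords h) (\<lambda>(x, y). x o\<^sub>L y)"
  unfolding smooth_in_charts_def prod.case
proof (rule smooth_onI[where W = D2 and 
      F = "\<lambda>j z. ip (v j) ((ginv h o\<^sub>L ((g o\<^sub>L \<psi> (lower z)) o\<^sub>L (g' o\<^sub>L \<psi> (upper z)))) - id_blinfun)"])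
  let ?\<Phi> = "\<lambda>(x, y) i. if i < n then coords g x i else coords g' y (i - n)"
  have lu: "lower (?\<Phi> (x, y)) = coords g x" "upper (?\<Phi> (x, y)) = coords g' y" for x y
    by (auto simp: lower_def upper_def coords_def fun_eq_iff)
  have inj: "inj_on ?\<Phi> (dom g \<times> dom g')"
  proof (rule inj_onI)
    fix a b assume ab: "a \<in> dom g \<times> dom g'" "b \<in> dom g \<times> dom g'" and eq: "?\<Phi> a = ?\<Phi> b"
    obtain x y x' y' where xy: "a = (x, y)" "b = (x', y')"
      by (cases a, cases b)
    note eq = eq[unfolded xy]
    have "coords g x = coords g x'" "coords g' y = coords g' y'"
      using arg_cong[OF eq, of lower] arg_cong[OF eq, of upper] unfolding lu by this+
    then show "a = b"
      using ab inj_onD[OF inj_on_coords[OF g(1)], of x x'] inj_onD[OF inj_on_coords[OF g(2)], of y y']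
      by (auto simp: xy)
  qed
  fix j k
  have "CkV k (n+n) D2 (\<lambda>z. \<psi> (lower z))"
    unfolding lower_def
    by (rule CkV_coordinates[where W = D]) (use CkV_\<psi>_Y in \<open>auto simp: D2_def lower_def\<close>)
  moreover have "CkV k (n+n) D2 (\<lambda>z. \<psi> (upper z))"
    unfolding upper_def
    by (rule CkV_coordinates[where W = D]) (use CkV_\<psi>_Y in \<open>auto simp: D2_def upper_def\<close>)
  ultimately show "CkV k (n+n) D2 (\<lambda>z. ip (v j) ((ginv h o\<^sub>L ((g o\<^sub>L \<psi> (lower z)) o\<^sub>L (g' o\<^sub>L \<psi> (upper z)))) - id_blinfun))"
    by (intro CkV_coord CkV_comp CkV_const)
  show "(coords h \<circ> (\<lambda>(x, y). x o\<^sub>L y) \<circ> inv_into (dom g \<times> dom g') ?\<Phi>) z j =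
      ip (v j) ((ginv h o\<^sub>L ((g o\<^sub>L \<psi> (lower z)) o\<^sub>L (g' o\<^sub>L \<psi> (upper z)))) - id_blinfun)"
    if "j < n" "z \<in> D2" for j z
  proof -
    have z: "lower z \<in> D" "upper z \<in> D" "\<forall>i\<ge>n+n. z i = 0" using that by (auto simp: D2_def)
    have "inv_into (dom g \<times> dom g') ?\<Phi> z = (g o\<^sub>L \<psi> (lower z), g' o\<^sub>L \<psi> (upper z))"
    proof (rule inv_into_f_eq[OF inj])
      show "?\<Phi> (g o\<^sub>L \<psi> (lower z), g' o\<^sub>L \<psi> (upper z)) = z"
        using coords_\<psi>[OF g(1) z(1)] coords_\<psi>[OF g(2) z(2)] z(3)
        by (simp add: fun_eq_iff) (auto simp: lower_def upper_def)
    qed (use \<psi>_in_dom g z in auto)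
    then show ?thesis using that by (simp add: coords_def)
  qed
  have "?\<Phi> (x, y) \<in> D2" if "x \<in> dom g" "y \<in> dom g'" for x y
    using that coords_in_D lu[of x y] by (simp add: D2_def) (auto simp: coords_def)
  then show "?\<Phi> ` (dom g \<times> dom g' \<inter> (\<lambda>(x, y). x o\<^sub>L y) -` dom h) \<subseteq> D2"
    by auto
qed (rule D2_upd)

lemma id_in_dom: "g \<in> G \<Longrightarrow> g \<in> dom g"
  using r \<rho> ginv by (simp add: dom_def P_simps)

lemma lie_group_chart:
  fixes R :: "('v \<Rightarrow>\<^sub>L 'v, 'm) monoid_scheme"
  assumes R: "carrier R = G" "mult R = (o\<^sub>L)" "monoid.one R = id_blinfun"
  shows "lie_group R (top_of_set G)"
proof -
  have group: "group R"
  proof (rule groupI)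
    show "\<exists>y\<in>carrier R. y \<otimes>\<^bsub>R\<^esub> x = \<one>\<^bsub>R\<^esub>" if "x \<in> carrier R" for x
      using ginv[of x] that R by auto
  qed (use R mult one blinfun_compose_assoc in auto)
  have inv: "m_inv R x = ginv x" if "x \<in> G" for x
    using group.inv_equality[OF group, of "ginv x" x] ginv[OF that] that R by simp
  have "smooth_manifold (top_of_set G) n atlas"
    unfolding smooth_manifold_def smooth_atlas_def
  proof (intro conjI ballI)
    show "Hausdorff_space (top_of_set G)"
      by (simp add: Hausdorff_space_subtopology)
    show "second_countable (top_of_set G)"
      by (rule second_countable_compact_metric[OF compact_G])
    show "\<Union> (fst ` atlas) = topspace (top_of_set G)"
      using id_in_dom by (auto simp: atlas_def dom_def)
  qed (auto simp: atlas_def is_chart_coords smooth_transition)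
  moreover have "smooth_map (prod_topology (top_of_set G) (top_of_set G)) (n + n) (prod_atlas n atlas atlas)
      (top_of_set G) n atlas (\<lambda>(x, y). x \<otimes>\<^bsub>R\<^esub> y)"
    unfolding smooth_map_def
  proof (intro conjI ballI)
    have "continuous_on (G \<times> G) (\<lambda>(x, y). x o\<^sub>L y)"
      unfolding case_prod_unfold
      by (intro bounded_bilinear.continuous_on[OF bounded_bilinear_blinfun_compose] continuous_intros)
    then show "continuous_map (prod_topology (top_of_set G) (top_of_set G)) (top_of_set G) (\<lambda>(x, y). x \<otimes>\<^bsub>R\<^esub> y)"
      using mult R by (auto simp: continuous_map_subtopology_eu simp flip: subtopology_Times)
    fix a b assume "a \<in> prod_atlas n atlas atlas" "b \<in> atlas"
    then show "smooth_in_charts (n + n) n a b (\<lambda>(x, y). x \<otimes>\<^bsub>R\<^esub> y)"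
      using smooth_mult R(2) by (auto simp: prod_atlas_def atlas_def)
  qed
  moreover have "smooth_map (top_of_set G) n atlas (top_of_set G) n atlas (\<lambda>x. m_inv R x)"
    unfolding smooth_map_def
  proof (intro conjI ballI)
    have "continuous_on G (\<lambda>x. m_inv R x)"
      using continuous_ginv inv by (simp cong: continuous_on_cong)
    then show "continuous_map (top_of_set G) (top_of_set G) (\<lambda>x. m_inv R x)"
      using inv ginv(1) by (auto simp: continuous_map_subtopology_eu)
    fix a b assume "a \<in> atlas" "b \<in> atlas"
    then show "smooth_in_charts n n a b (\<lambda>x. m_inv R x)"
      using smooth_inverse[of _ _ "m_inv R"] inv by (auto simp: atlas_def)
  qed
  ultimately show ?thesis
    unfolding lie_group_def using group R by auto
qed

end

theorem (in closed_isometry_group) lie_group: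
  fixes R :: "('v \<Rightarrow>\<^sub>L 'v, 'm) monoid_scheme"
  assumes R: "carrier R = G" "mult R = (o\<^sub>L)" "monoid.one R = id_blinfun"
  shows "lie_group R (top_of_set G)"
proof -
  obtain n v where v: "\<forall>i<n. v i \<in> tangent" "orthonormal_upto ip n v"
      "\<forall>X\<in>tangent. X = (\<Sum>i<n. ip (v i) X *\<^sub>R v i)"
    using tangent_basis_exists by blast
  interpret tangent_basis G M ip n v
    by unfold_locales (use v in blast)+
  obtain c r where cr: "c > 0" "r > 0" and below: "\<And>g h. g \<in> G \<Longrightarrow> h \<in> G \<Longrightarrow> norm (g - id_blinfun) < r \<Longrightarrow>
      norm (h - id_blinfun) < r \<Longrightarrow> c * norm (g - h) \<le> norm (P (g - h))"
    using P_bounded_below by blast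
  \<comment> \<open>The radius has to suit both the lower bound for P and the contraction in
    \<open>solve_tangent\<close>; \<open>P_locally_onto\<close> then supplies
    \<open>c * s / 4\<close> for the coordinates.\<close>
  define s where "s = min r (1 / (2 * K))"
  have s: "s > 0" "s \<le> 1 / (2 * K)" "s \<le> r"
    using cr K_pos by (auto simp: s_def)
  interpret tangent_chart G M ip n v c s "c * s / 4"
  proof
    show below': "c * norm (g - h) \<le> norm (P (g - h))"
      if "g \<in> G" "h \<in> G" "norm (g - id_blinfun) < s" "norm (h - id_blinfun) < s" for g h
      using below[of g h] that s by simp
    show "\<exists>g\<in>G. norm (g - id_blinfun) < s \<and> P (g - id_blinfun) = w" 
      if "w \<in> tangent" "norm w < c * s / 4" for w
      by (rule P_locally_onto[OF cr(1) s(1,2) below' that])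
  qed (use cr s in auto)
  show ?thesis
    by (rule lie_group_chart[OF R])
qed

section \<open>The real structure of \<open>\<ell>\<^sup>2\<close>\<close>

instance ell2 :: banach ..

lemma coord_add: "coord (x + y) n = coord x n + coord y n"
  by (simp add: plus_ell2.rep_eq)

lemma coord_scaleR: "coord (r *\<^sub>R x) n = r *\<^sub>R coord x n"
  by (simp add: scaleR_ell2.rep_eq)

lemma coord_scaleC: "coord (scaleC c x) n = c * coord x n"
  by (simp add: scaleC.rep_eq)

lemma ell2_eqI: "(\<And>n. coord x n = coord y n) \<Longrightarrow> x = y"
  by (simp add: coord_inject[symmetric] fun_eq_iff)

lemma scaleC_simps:
  "scaleC c (x + y) = scaleC c x + scaleC c y" "scaleC c (x - y) = scaleC c x - scaleC c y"
  "scaleC c (r *\<^sub>R x) = r *\<^sub>R scaleC c x" "scaleC c (scaleC d x) = scaleC (c * d) x"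
  by (rule ell2_eqI; simp add: coord_add coord_diff coord_scaleC coord_scaleR algebra_simps)+

lemma norm_scaleC: "norm (scaleC c x) = cmod c * norm x"
proof -
  have "(norm (scaleC c x))\<^sup>2 = (cmod c * norm x)\<^sup>2"
    unfolding norm_ell2_square power_mult_distrib
    by (simp add: coord_scaleC norm_mult power_mult_distrib suminf_mult summable_coord)
  then show ?thesis by (simp add: power2_eq_iff_nonneg)
qed

lemma bounded_linear_scaleC: "bounded_linear (scaleC c)"
  by (rule bounded_linear_intro[of _ "cmod c"]) (auto simp: scaleC_simps norm_scaleC)

lemma inner_scaleC: "scaleC c x \<bullet> y = x \<bullet> scaleC (cnj c) y"
  unfolding inner_ell2_def by (simp add: coord_scaleC inner_complex_def algebra_simps)

text \<open>Recovers the complex inner product from the real one, so that adjoints can be found over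
  the reals.\<close>

lemma cinner_eq: "cinner x y = Complex (x \<bullet> y) (scaleC \<i> x \<bullet> y)"
proof -
  have "summable (\<lambda>n. cnj (coord x n) * coord y n)"
    by (rule summable_norm_cancel) (simp add: norm_mult summable_norm_coord_mult)
  then have "cinner (scaleC \<i> x) y = - \<i> * cinner x y"
    unfolding cinner_def using suminf_mult[of "\<lambda>n. cnj (coord x n) * coord y n" "- \<i>"]
    by (simp add: coord_scaleC mult.assoc)
  then show ?thesis
    by (simp add: inner_ell2_eq_Re_cinner complex_eq_iff)
qed

text \<open>Placing each basis vector next to its multiple by i makes the first 2 N members span the
  complex span of the first N vectors \<open>basis_vec\<close>.\<close>

definition real_basis :: "nat \<Rightarrow> ell2"
  where "real_basis m = (if even m then basis_vec (m div 2) else scaleC \<i> (basis_vec (m div 2)))"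

lemma coord_basis_vec: "coord (basis_vec k) n = (if n = k then 1 else 0)"
  by (simp add: basis_vec.rep_eq)

lemma inner_basis_vec: "basis_vec k \<bullet> x = Re (coord x k)"
proof -
  have "(\<lambda>n. coord (basis_vec k) n \<bullet> coord x n) = (\<lambda>n. if n = k then Re (coord x k) else 0)"
    by (auto simp: coord_basis_vec inner_complex_def)
  then show ?thesis unfolding inner_ell2_def using sums_unique[OF sums_single[of k "\<lambda>_. Re (coord x k)"]] by simp
qed

lemma inner_real_basis:
  "real_basis (2 * k) \<bullet> x = Re (coord x k)" "real_basis (Suc (2 * k)) \<bullet> x = Im (coord x k)"
  by (simp_all add: real_basis_def inner_basis_vec inner_scaleC coord_scaleC)

lemma orthonormal_real_basis: "real_basis i \<bullet> real_basis j = of_bool (i = j)"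
proof -
  have "(i div 2 = j div 2 \<and> (even i \<longleftrightarrow> even j)) \<longleftrightarrow> i = j" by (auto dest: even_two_times_div_two) presburger+
  then show ?thesis
    by (auto simp: real_basis_def inner_basis_vec inner_scaleC coord_scaleC coord_basis_vec)
qed

lemma Parseval_sums: "(\<lambda>m. (real_basis m \<bullet> x)\<^sup>2) sums (norm x)\<^sup>2"
proof -
  let ?S = "\<lambda>N. \<Sum>m<N. (real_basis m \<bullet> x)\<^sup>2"
  have even: "?S (2 * K) = (\<Sum>k<K. (cmod (coord x k))\<^sup>2)" for K
    by (induction K) (simp_all add: inner_real_basis cmod_power2)
  have bnd: "?S N \<le> (norm x)\<^sup>2" for N
  proof -
    have "?S N \<le> ?S (2 * N)" by (intro sum_mono2) auto
    also have "\<dots> \<le> (norm x)\<^sup>2" unfolding even by (rule sum_coord_le_norm)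
    finally show ?thesis .
  qed
  have "summable (\<lambda>m. (real_basis m \<bullet> x)\<^sup>2)"
    by (rule summableI_nonneg_bounded[OF _ bnd]) simp
  then have lim: "?S \<longlonglongrightarrow> (\<Sum>m. (real_basis m \<bullet> x)\<^sup>2)"
    by (rule summable_LIMSEQ)
  have "(\<lambda>K. ?S (2 * K)) \<longlonglongrightarrow> (\<Sum>m. (real_basis m \<bullet> x)\<^sup>2)"
    using LIMSEQ_subseq_LIMSEQ[OF lim, of "\<lambda>K. 2 * K"] by (simp add: o_def strict_mono_def)
  moreover have "(\<lambda>K. ?S (2 * K)) \<longlonglongrightarrow> (norm x)\<^sup>2"
    unfolding even norm_ell2_square by (rule summable_LIMSEQ[OF summable_coord])
  ultimately have "(\<Sum>m. (real_basis m \<bullet> x)\<^sup>2) = (norm x)\<^sup>2"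
    by (rule LIMSEQ_unique)
  then show ?thesis using lim unfolding sums_def by simp
qed

lemma inner_orthonormal_sum:
  fixes f :: "nat \<Rightarrow> 'a::real_inner"
  assumes "orthonormal_upto (\<bullet>) N f" "m < N"
  shows "f m \<bullet> (\<Sum>k<N. c k *\<^sub>R f k) = c m"
proof -
  have "f m \<bullet> (\<Sum>k<N. c k *\<^sub>R f k) = (\<Sum>k<N. if k = m then c k else 0)"
    unfolding inner_sum_right using orthonormal_uptoD[OF assms] by (intro sum.cong) auto
  then show ?thesis using assms(2) by simp
qed

lemma norm_orthonormal_sum:
  fixes f :: "nat \<Rightarrow> 'a::real_inner"
  assumes "orthonormal_upto (\<bullet>) N f"
  shows "(norm (\<Sum>k<N. c k *\<^sub>R f k))\<^sup>2 = (\<Sum>k<N. (c k)\<^sup>2)"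
  unfolding power2_norm_eq_inner inner_sum_left[of _ _ "\<Sum>k<N. c k *\<^sub>R f k"]
  by (intro sum.cong) (simp_all add: inner_orthonormal_sum[OF assms] power2_eq_square)

lemma norm_diff_orthonormal:
  fixes x :: "'a::real_inner"
  assumes "orthonormal_upto (\<bullet>) N f"
  shows "(norm (x - (\<Sum>m<N. (f m \<bullet> x) *\<^sub>R f m)))\<^sup>2 = (norm x)\<^sup>2 - (\<Sum>m<N. (f m \<bullet> x)\<^sup>2)"
proof -
  let ?y = "\<Sum>m<N. (f m \<bullet> x) *\<^sub>R f m"
  have a: "x \<bullet> ?y = (\<Sum>m<N. (f m \<bullet> x)\<^sup>2)"
    by (simp add: inner_sum_right power2_eq_square inner_commute)
  have b: "?y \<bullet> ?y = (\<Sum>m<N. (f m \<bullet> x)\<^sup>2)"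
    using norm_orthonormal_sum[OF assms] by (simp add: power2_norm_eq_inner)
  show ?thesis
    unfolding power2_norm_eq_inner using a b inner_commute[of x ?y]
    by (simp add: inner_diff_left inner_diff_right)
qed

lemma Bessel:
  fixes x :: "'a::real_inner"
  assumes "orthonormal_upto (\<bullet>) N f"
  shows "(\<Sum>m<N. (f m \<bullet> x)\<^sup>2) \<le> (norm x)\<^sup>2"
  using norm_diff_orthonormal[OF assms, of x] zero_le_power2[of "norm (x - (\<Sum>m<N. (f m \<bullet> x) *\<^sub>R f m))"]
  by linarith

lemma orthonormal_upto_real_basis: "orthonormal_upto (\<bullet>) N real_basis"
  by (simp add: orthonormal_upto_def orthonormal_real_basis)

definition trunc :: "nat \<Rightarrow> ell2 \<Rightarrow> ell2"
  where "trunc N x = (\<Sum>m<N. (real_basis m \<bullet> x) *\<^sub>R real_basis m)"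

lemma trunc_tendsto: "(\<lambda>N. trunc N x) \<longlonglongrightarrow> x"
proof -
  have "(\<lambda>N. (norm x)\<^sup>2 - (\<Sum>m<N. (real_basis m \<bullet> x)\<^sup>2)) \<longlonglongrightarrow> (norm x)\<^sup>2 - (norm x)\<^sup>2"
    using Parseval_sums[of x] unfolding sums_def by (intro tendsto_intros)
  then have "(\<lambda>N. (norm (x - trunc N x))\<^sup>2) \<longlonglongrightarrow> 0"
    unfolding trunc_def norm_diff_orthonormal[OF orthonormal_upto_real_basis] by simp
  then have "(\<lambda>N. sqrt ((norm (x - trunc N x))\<^sup>2)) \<longlonglongrightarrow> sqrt 0"
    by (rule tendsto_real_sqrt)
  then have "(\<lambda>N. norm (trunc N x - x)) \<longlonglongrightarrow> 0"
    by (simp add: norm_minus_commute)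
  then show ?thesis
    by (simp add: LIM_zero_cancel tendsto_norm_zero_iff)
qed

section \<open>Riesz representation and adjoints\<close>

text \<open>On a finite combination of basis vectors with the functional's own values as
  coefficients, the functional equals the squared norm. Boundedness by B thus bounds the sum of
  squares of these coefficients by B^2, and the vector they define represents the functional on
  truncations, hence in the limit.\<close>

lemma Riesz:
  assumes "bounded_linear (\<phi> :: ell2 \<Rightarrow> real)"
  shows "\<exists>y. \<forall>x. \<phi> x = x \<bullet> y"
proof -
  interpret \<phi>: bounded_linear \<phi> by (rule assms)
  let ?c = "\<lambda>k. Complex (\<phi> (real_basis (2 * k))) (\<phi> (real_basis (Suc (2 * k))))"
  obtain B where B: "B \<ge> 0" "\<And>x. norm (\<phi> x) \<le> norm x * B"
    using \<phi>.nonneg_bounded by blast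
  have bnd: "(\<Sum>m<N. (\<phi> (real_basis m))\<^sup>2) \<le> B\<^sup>2" for N
  proof -
    define s where "s = (\<Sum>m<N. (\<phi> (real_basis m))\<^sup>2)"
    define y where "y = (\<Sum>m<N. \<phi> (real_basis m) *\<^sub>R real_basis m)"
    have "\<phi> y = s"
      by (simp add: y_def s_def \<phi>.sum \<phi>.scaleR power2_eq_square)
    moreover have "y \<bullet> y = s"
      using norm_orthonormal_sum[OF orthonormal_upto_real_basis] by (simp add: y_def s_def power2_norm_eq_inner)
    moreover have "s \<ge> 0" by (simp add: s_def sum_nonneg)
    ultimately have "s \<le> sqrt s * B"
      using B(2)[of y] by (simp add: norm_eq_sqrt_inner)
    then have "sqrt s * sqrt s \<le> sqrt s * B" using \<open>s \<ge> 0\<close> by simp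
    then have "sqrt s \<le> B"
      using B(1) \<open>s \<ge> 0\<close> mult_left_le_imp_le[of "sqrt s" "sqrt s" B] by (cases "s = 0") auto
    then show ?thesis
      using \<open>s \<ge> 0\<close> power_mono[of "sqrt s" B 2] by (simp flip: s_def)
  qed
  have "summable (\<lambda>k. (cmod (?c k))\<^sup>2)"
  proof (rule summableI_nonneg_bounded)
    fix K
    have "(\<Sum>k<K. (cmod (?c k))\<^sup>2) = (\<Sum>m<2*K. (\<phi> (real_basis m))\<^sup>2)"
      by (induction K) (simp_all add: cmod_power2)
    then show "(\<Sum>k<K. (cmod (?c k))\<^sup>2) \<le> B\<^sup>2" using bnd by simp
  qed simp
  then have c: "coord (Abs_ell2 ?c) = ?c"
    by (simp add: Abs_ell2_inverse)
  define y where "y = Abs_ell2 ?c"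
  have rb: "real_basis m \<bullet> y = \<phi> (real_basis m)" for m
  proof (cases "even m")
    case True
    then obtain k where "m = 2 * k" by (elim evenE)
    then show ?thesis by (simp add: inner_real_basis y_def c)
  next
    case False
    then obtain k where "m = Suc (2 * k)" by (elim oddE) simp
    then show ?thesis by (simp add: inner_real_basis y_def c)
  qed
  have "\<phi> x = x \<bullet> y" for x
  proof (rule LIMSEQ_unique)
    show "(\<lambda>N. \<phi> (trunc N x)) \<longlonglongrightarrow> \<phi> x"
      by (rule \<phi>.tendsto[OF trunc_tendsto])
    have "\<phi> (trunc N x) = trunc N x \<bullet> y" for N
      by (simp add: trunc_def \<phi>.sum \<phi>.scaleR inner_sum_left rb)
    then show "(\<lambda>N. \<phi> (trunc N x)) \<longlonglongrightarrow> x \<bullet> y"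
      using tendsto_inner[OF trunc_tendsto tendsto_const] by simp
  qed
  then show ?thesis by blast
qed

lemma real_adjoint_exists: "\<exists>B :: op_ell2. \<forall>x y. A x \<bullet> y = x \<bullet> B y" for A :: op_ell2
proof -
  have "\<exists>z. \<forall>x. A x \<bullet> y = x \<bullet> z" for y
    by (intro Riesz bounded_linear_intros blinfun.bounded_linear_right bounded_linear_compose[OF bounded_linear_inner_left])
  then obtain f where f: "\<And>x y. A x \<bullet> y = x \<bullet> f y" by metis
  have "bounded_linear f"
  proof (rule bounded_linear_intro[of _ "norm A"])
    show "f (x + y) = f x + f y" for x y
      by (rule vector_eq_ldot[THEN iffD1]) (simp add: inner_add_right flip: f)
    show "f (r *\<^sub>R x) = r *\<^sub>R f x" for r x
      by (rule vector_eq_ldot[THEN iffD1]) (simp flip: f)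
    fix y
    have "norm (f y) * norm (f y) = A (f y) \<bullet> y"
      by (simp add: f flip: power2_norm_eq_inner power2_eq_square)
    also have "\<dots> \<le> norm (A (f y)) * norm y" by (rule norm_cauchy_schwarz)
    also have "\<dots> \<le> norm A * norm (f y) * norm y"
      by (intro mult_right_mono norm_blinfun) auto
    finally show "norm (f y) \<le> norm y * norm A"
      by (cases "norm (f y) = 0") (auto simp: mult.assoc mult.left_commute mult.commute)
  qed
  then show ?thesis
    using f by (intro exI[of _ "Blinfun f"]) (simp add: bounded_linear_Blinfun_apply)
qed

text \<open>By \<open>cinner_eq\<close> the imaginary part of the complex inner product is a real
  inner product with i x, so the real adjoint of an operator that commutes with i satisfies the
  complex adjoint equation.\<close>

lemma op_adjoint:
  assumes "complex_linear A"
  shows "A x \<bullet> y = x \<bullet> op_adjoint A y" "complex_linear (op_adjoint A)"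
proof -
  obtain B :: op_ell2 where B: "\<And>x y. A x \<bullet> y = x \<bullet> B y"
    using real_adjoint_exists[of A] by blast
  have "op_adjoint A = B"
    unfolding op_adjoint_def
  proof (rule the_equality)
    have "scaleC \<i> (A x) = A (scaleC \<i> x)" for x
      using assms by (simp add: complex_linear_def)
    then show "\<forall>x y. cinner (A x) y = cinner x (B y)"
      by (simp add: cinner_eq B)
    fix C assume "\<forall>x y. cinner (A x) y = cinner x (blinfun_apply C y)"
    then have "x \<bullet> C y = x \<bullet> B y" for x y
      by (simp add: B[symmetric] cinner_eq)
    then show "C = B"
      by (intro blinfun_eqI) (metis vector_eq_ldot)
  qed
  then show "A x \<bullet> y = x \<bullet> op_adjoint A y" using B by simp
  have "B (scaleC c y) = scaleC c (B y)" for c y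
  proof (rule vector_eq_ldot[THEN iffD1], intro allI)
    fix x
    have "x \<bullet> B (scaleC c y) = scaleC (cnj c) (A x) \<bullet> y"
      by (simp add: inner_scaleC flip: B)
    also have "\<dots> = A (scaleC (cnj c) x) \<bullet> y"
      using assms by (simp add: complex_linear_def)
    also have "\<dots> = x \<bullet> scaleC c (B y)"
      by (simp add: B inner_scaleC)
    finally show "x \<bullet> B (scaleC c y) = x \<bullet> scaleC c (B y)" .
  qed
  then show "complex_linear (op_adjoint A)"
    using \<open>op_adjoint A = B\<close> by (simp add: complex_linear_def)
qed

lemma inner_blinfun_le: "\<bar>v \<bullet> blinfun_apply A v\<bar> \<le> norm A * (norm v)\<^sup>2" for A :: "'a::real_inner \<Rightarrow>\<^sub>L 'a"
proof -
  have "\<bar>v \<bullet> A v\<bar> \<le> norm v * norm (A v)" by (rule Cauchy_Schwarz_ineq2)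
  also have "\<dots> \<le> norm v * (norm A * norm v)" by (intro mult_left_mono norm_blinfun) auto
  finally show ?thesis by (simp add: power2_eq_square mult_ac)
qed

definition selfadj :: "op_ell2 \<Rightarrow> bool" where "selfadj A \<longleftrightarrow> (\<forall>x y. A x \<bullet> y = x \<bullet> A y)"

definition psd :: "op_ell2 \<Rightarrow> bool" where "psd A \<longleftrightarrow> selfadj A \<and> (\<forall>x. 0 \<le> x \<bullet> A x)"

lemma selfadjD: "selfadj A \<Longrightarrow> A x \<bullet> y = x \<bullet> A y"
  by (simp add: selfadj_def)

section \<open>Functional calculus\<close>

lemma op_poly_0 [simp]: "op_poly 0 A = 0"
  by (simp add: op_poly_def)

lemma op_poly_upto: "degree q \<le> n \<Longrightarrow> op_poly q A = (\<Sum>i\<le>n. poly.coeff q i *\<^sub>R ((o\<^sub>L) A ^^ i) id_blinfun)"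
  unfolding op_poly_def by (rule sum.mono_neutral_left) (auto simp: coeff_eq_0)

lemma op_poly_pCons: "op_poly (pCons a q) A = a *\<^sub>R id_blinfun + (A o\<^sub>L op_poly q A)"
proof -
  have "op_poly (pCons a q) A = (\<Sum>i\<le>Suc (degree q). poly.coeff (pCons a q) i *\<^sub>R ((o\<^sub>L) A ^^ i) id_blinfun)"
    by (rule op_poly_upto) (rule degree_pCons_le)
  also have "\<dots> = a *\<^sub>R id_blinfun + (A o\<^sub>L op_poly q A)"
    unfolding sum.atMost_Suc_shift op_poly_def
    by (simp add: blinfun_compose_sum_right blinfun_compose_scaleR_right)
  finally show ?thesis .
qed

lemma op_poly_add: "op_poly (p + q) A = op_poly p A + op_poly q A"
  by (induction p q rule: poly_induct2) (simp_all add: op_poly_pCons blinfun_compose_distrib algebra_simps)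

lemma op_poly_smult: "op_poly (Polynomial.smult c q) A = c *\<^sub>R op_poly q A"
  by (induction q) (simp_all add: op_poly_pCons blinfun_compose_distrib algebra_simps)

lemma op_poly_mult: "op_poly (p * q) A = op_poly p A o\<^sub>L op_poly q A"
  by (induction p) (simp_all add: op_poly_pCons op_poly_add op_poly_smult blinfun_compose_distrib blinfun_compose_assoc)

lemma op_poly_diff: "op_poly (p - q) A = op_poly p A - op_poly q A"
  using op_poly_add[of p "- q" A] op_poly_smult[of "- 1" q A] by simp

lemma op_poly_const [simp]: "op_poly [:c:] A = c *\<^sub>R id_blinfun"
  by (simp add: op_poly_pCons)

lemma op_poly_linear: "op_poly [:c, d:] A = c *\<^sub>R id_blinfun + d *\<^sub>R A"
  by (simp add: op_poly_pCons blinfun_compose_distrib)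

lemma op_poly_commute: "A o\<^sub>L op_poly q A = op_poly q A o\<^sub>L A"
  using op_poly_mult[of "[:0, 1:]" q A] op_poly_mult[of q "[:0, 1:]" A] by (simp add: op_poly_linear mult.commute)

lemma selfadj_op_poly: "selfadj A \<Longrightarrow> selfadj (op_poly q A)"
proof (induction q)
  case (pCons a q)
  then have "(A o\<^sub>L op_poly q A) x \<bullet> y = x \<bullet> (op_poly q A o\<^sub>L A) y" for x y
    by (simp add: selfadj_def)
  then show ?case
    by (simp add: selfadj_def op_poly_pCons blinfun.add_left blinfun.scaleR_left inner_add_left inner_add_right
        flip: op_poly_commute blinfun_apply_blinfun_compose)
qed (simp add: selfadj_def)

lemma complex_linear_op_poly: "complex_linear A \<Longrightarrow> complex_linear (op_poly q A)"
proof (induction q)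
  case 0
  have "scaleC c 0 = 0" for c using scaleC_simps(3)[of c 0] by simp
  then show ?case by (simp add: complex_linear_def)
next
  case (pCons a q)
  then show ?case
    by (simp add: complex_linear_def op_poly_pCons blinfun.add_left blinfun.scaleR_left scaleC_simps)
qed

lemma op_poly_eigenvector:
  fixes A :: op_ell2
  assumes "A v = c *\<^sub>R v"
  shows "op_poly q A v = poly q c *\<^sub>R v"
  by (induction q) (simp_all add: op_poly_pCons blinfun.add_left blinfun.scaleR_left blinfun.scaleR_right assms algebra_simps)

section \<open>Finite-dimensional spectral theorem\<close>

text \<open>Supplies compactness inside infinite-dimensional spaces: for the unit sphere in the
  range of \<open>trunc K\<close>, and later for bounded parts of a space of operators.\<close>

lemma compact_combinations:
  fixes b :: "'i \<Rightarrow> 'a::real_normed_vector"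
  assumes "finite I"
  shows "compact {\<Sum>i\<in>I. c i *\<^sub>R b i | c. \<forall>i\<in>I. \<bar>c i\<bar> \<le> R}"
  using assms
proof (induction I)
  case (insert k I)
  let ?S = "\<lambda>I. {\<Sum>i\<in>I. c i *\<^sub>R b i | c. \<forall>i\<in>I. \<bar>c i\<bar> \<le> R}"
  have "?S (insert k I) = (\<lambda>(x, t). x + t *\<^sub>R b k) ` (?S I \<times> {-R..R})"
  proof (intro equalityI subsetI)
    fix x assume "x \<in> ?S (insert k I)"
    then obtain c where "x = (\<Sum>i\<in>I. c i *\<^sub>R b i) + c k *\<^sub>R b k" "\<forall>i\<in>insert k I. \<bar>c i\<bar> \<le> R"
      using insert.hyps by (auto simp: add.commute)
    then show "x \<in> (\<lambda>(x, t). x + t *\<^sub>R b k) ` (?S I \<times> {-R..R})"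
      by (intro image_eqI[of _ _ "(\<Sum>i\<in>I. c i *\<^sub>R b i, c k)"]) (auto simp: abs_le_iff)
  next
    fix x assume "x \<in> (\<lambda>(x, t). x + t *\<^sub>R b k) ` (?S I \<times> {-R..R})"
    then obtain c t where c: "x = (\<Sum>i\<in>I. c i *\<^sub>R b i) + t *\<^sub>R b k" "\<forall>i\<in>I. \<bar>c i\<bar> \<le> R" "\<bar>t\<bar> \<le> R"
      by (auto simp: abs_le_iff)
    have "(\<Sum>i\<in>I. (c(k := t)) i *\<^sub>R b i) = (\<Sum>i\<in>I. c i *\<^sub>R b i)"
      using insert.hyps by (intro sum.cong) auto
    then show "x \<in> ?S (insert k I)"
      using c insert.hyps by (intro CollectI exI[of _ "c(k := t)"]) (auto simp: add.commute)
  qed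
  moreover have "compact ((\<lambda>(x, t). x + t *\<^sub>R b k) ` (?S I \<times> {-R..R}))"
    unfolding case_prod_unfold
    by (intro compact_continuous_image compact_Times insert.IH compact_Icc continuous_intros)
  ultimately show ?case by simp
qed simp

lemma orthonormal_upto_norm: "orthonormal_upto (\<bullet>) N f \<Longrightarrow> i < N \<Longrightarrow> norm (f i) = 1"
  using orthonormal_uptoD[of "(\<bullet>)" N f i i] by (simp add: norm_eq_1)

text \<open>First variation of the Rayleigh quotient: moving from g by t times the residual h raises
  the form by 2 t times the squared norm of h, up to terms of second order. At a maximum this forces
  h = 0.\<close>

lemma eigenvector_of_maximum:
  assumes A: "selfadj A" and W: "subspace W" "\<And>v. v \<in> W \<Longrightarrow> A v \<in> W"
    and g: "g \<in> W" "norm g = 1" and max: "\<And>v. v \<in> W \<Longrightarrow> norm v = 1 \<Longrightarrow> v \<bullet> A v \<le> g \<bullet> A g"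
  shows "A g = (g \<bullet> A g) *\<^sub>R g"
proof -
  define l where "l = g \<bullet> A g"
  have hom: "v \<bullet> A v \<le> l * (v \<bullet> v)" if "v \<in> W" for v
  proof (cases "v = 0")
    case False
    have "sgn v \<bullet> A (sgn v) \<le> l"
      unfolding l_def using that W(1) False by (intro max) (auto simp: sgn_div_norm subspace_scale)
    moreover have "sgn v \<bullet> A (sgn v) = (v \<bullet> A v) / (norm v)\<^sup>2"
      by (simp add: sgn_div_norm blinfun.scaleR_right power2_eq_square divide_inverse)
    ultimately show ?thesis
      using False by (simp add: power2_norm_eq_inner[symmetric] divide_le_eq)
  qed simp
  define h where "h = A g - l *\<^sub>R g"
  have gg: "g \<bullet> g = 1" using g by (simp add: norm_eq_1)
  have h: "h \<in> W" using W g by (simp add: h_def subspace_diff subspace_scale)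
  have gh: "g \<bullet> h = 0" by (simp add: h_def inner_diff_right l_def gg)
  have hh: "h \<bullet> A g = h \<bullet> h"
    using gh by (simp add: h_def inner_diff_right inner_diff_left inner_commute)
  have sym: "g \<bullet> A h = h \<bullet> h"
    using selfadjD[OF A, of g h] hh by (simp add: inner_commute)
  define a where "a = l * (h \<bullet> h) - h \<bullet> A h"
  have ineq: "2 * t * (h \<bullet> h) \<le> t * t * a" for t
  proof -
    have "(g + t *\<^sub>R h) \<bullet> A (g + t *\<^sub>R h) \<le> l * ((g + t *\<^sub>R h) \<bullet> (g + t *\<^sub>R h))"
      using g h W(1) by (intro hom) (simp add: subspace_add subspace_scale)
    then show ?thesis
      using gh hh sym gg inner_commute[of g h]
      by (simp add: blinfun.add_right blinfun.scaleR_right inner_add_left inner_add_right a_def l_def algebra_simps)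
  qed
  have "h \<bullet> h \<le> 0"
  proof (rule ccontr)
    assume "\<not> ?thesis"
    then have pos: "h \<bullet> h > 0" by (simp only: not_le)
    \<comment> \<open>Small enough that \<open>t * \<bar>a\<bar>\<close> is at most
      \<open>h \<bullet> h\<close>, which contradicts the factor 2 on the other side.\<close>
    define t where "t = (h \<bullet> h) / (\<bar>a\<bar> + 1)"
    have t: "t > 0" using pos by (simp add: t_def)
    have "t * t * a \<le> t * t * \<bar>a\<bar>" by (intro mult_left_mono) auto
    then have "2 * t * (h \<bullet> h) \<le> t * t * \<bar>a\<bar>" using ineq[of t] by linarith
    moreover have "t * (2 * (h \<bullet> h)) = 2 * t * (h \<bullet> h)" "t * (t * \<bar>a\<bar>) = t * t * \<bar>a\<bar>" by simp_all
    ultimately have "t * (2 * (h \<bullet> h)) \<le> t * (t * \<bar>a\<bar>)" by linarith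
    then have "2 * (h \<bullet> h) \<le> t * \<bar>a\<bar>" by (rule mult_left_le_imp_le[OF _ t])
    also have "\<dots> \<le> h \<bullet> h" using pos by (simp add: t_def divide_le_eq mult.commute mult_left_mono)
    finally show False using pos by simp
  qed
  then have "h = 0" using inner_gt_zero_iff[of h] by linarith
  then show ?thesis by (simp add: h_def l_def)
qed

text \<open>Eigenvectors are found one at a time: the orthogonal complement of those already chosen
  is invariant because A is self-adjoint, and the form attains its maximum on the compact unit
  sphere there at a new one.\<close>

lemma finite_dim_eigenbasis:
  assumes A: "selfadj A" and V: "V = {v. trunc K v = v}" "\<And>v. v \<in> V \<Longrightarrow> A v \<in> V"
  shows "\<exists>m g. (\<forall>i<m. g i \<in> V \<and> A (g i) = (g i \<bullet> A (g i)) *\<^sub>R g i) \<and> orthonormal_upto (\<bullet>) m g \<and>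
    (\<forall>v\<in>V. v = (\<Sum>i<m. (g i \<bullet> v) *\<^sub>R g i))"
proof -
  let ?E = "{v \<in> V. A v = (v \<bullet> A v) *\<^sub>R v}"
  have V_norm: "(norm v)\<^sup>2 = (\<Sum>m<K. (real_basis m \<bullet> v)\<^sup>2)" if "v \<in> V" for v
    using norm_diff_orthonormal[OF orthonormal_upto_real_basis, of v K] that unfolding V trunc_def[symmetric] by simp
  have trunc_lin: "trunc K (x + y) = trunc K x + trunc K y" "trunc K (r *\<^sub>R x) = r *\<^sub>R trunc K x" for x y r
    by (simp_all add: trunc_def inner_add_right scaleR_add_left sum.distrib scaleR_sum_right)
  have subV: "subspace V"
    using trunc_lin unfolding V by (intro subspaceI) (auto simp: trunc_def)
  have V_compact: "compact (V \<inter> {v. norm v = 1})"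
  proof -
    have sub: "V \<inter> {v. norm v = 1} \<subseteq> {\<Sum>m<K. c m *\<^sub>R real_basis m | c. \<forall>m\<in>{..<K}. \<bar>c m\<bar> \<le> 1}"
    proof
      fix v assume v: "v \<in> V \<inter> {v. norm v = 1}"
      have "\<bar>real_basis m \<bullet> v\<bar> \<le> 1" for m
        using Cauchy_Schwarz_ineq2[of "real_basis m" v] v orthonormal_upto_norm[OF orthonormal_upto_real_basis, of m "Suc m"] by simp
      then show "v \<in> {\<Sum>m<K. c m *\<^sub>R real_basis m | c. \<forall>m\<in>{..<K}. \<bar>c m\<bar> \<le> 1}"
        using v by (intro CollectI exI[of _ "\<lambda>m. real_basis m \<bullet> v"]) (simp add: V trunc_def)
    qed
    have "closed (V \<inter> {v. norm v = 1})"
      unfolding V trunc_def by (intro closed_Int closed_Collect_eq continuous_intros)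
    from closed_Int_compact[OF this compact_combinations[where b = real_basis and R = 1, OF finite_lessThan[of K]]] show ?thesis
      unfolding Int_absorb2[OF sub] .
  qed
  have "(\<exists>f. (\<forall>i. f i \<in> ?E) \<and> (\<forall>m. orthonormal_upto (\<bullet>) m f)) \<or>
    (\<exists>m f. (\<forall>i<m. f i \<in> ?E) \<and> orthonormal_upto (\<bullet>) m f \<and> (\<forall>x\<in>V. x = (\<Sum>i<m. (f i \<bullet> x) *\<^sub>R f i)))"
  proof (rule orthonormal_extension_dichotomy)
    show "x \<bullet> y = y \<bullet> x" for x y :: ell2 by (rule inner_commute)
    fix f :: "nat \<Rightarrow> ell2" and m
    assume f: "\<forall>i<m. f i \<in> ?E" "orthonormal_upto (\<bullet>) m f" and "\<exists>x\<in>V. x \<noteq> (\<Sum>i<m. (f i \<bullet> x) *\<^sub>R f i)"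
    then obtain x where x: "x \<in> V" "x \<noteq> (\<Sum>i<m. (f i \<bullet> x) *\<^sub>R f i)" by blast
    define W where "W = {v \<in> V. \<forall>i<m. f i \<bullet> v = 0}"
    have subW: "subspace W"
      using subV unfolding W_def subspace_def by (auto simp: inner_add_right)
    have AW: "A v \<in> W" if "v \<in> W" for v
    proof -
      have "f i \<bullet> A v = 0" if i: "i < m" for i
      proof -
        have "f i \<bullet> A v = A (f i) \<bullet> v" using selfadjD[OF A] by simp
        also have "A (f i) = (f i \<bullet> A (f i)) *\<^sub>R f i" using f(1) i by blast
        finally show ?thesis using \<open>v \<in> W\<close> i by (simp add: W_def)
      qed
      then show ?thesis using that V(2) by (simp add: W_def)
    qed
    define y where "y = x - (\<Sum>i<m. (f i \<bullet> x) *\<^sub>R f i)"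
    have "f j \<bullet> y = 0" if "j < m" for j
      using inner_orthonormal_sum[OF f(2) that] by (simp add: y_def inner_diff_right)
    then have y: "y \<in> W" "y \<noteq> 0"
      using x f(1) subV by (auto simp: W_def y_def intro!: subspace_diff subspace_sum subspace_scale)
    have "closed W" 
    proof -
      have "W = V \<inter> (\<Inter>i\<in>{..<m}. {v. f i \<bullet> v = 0})" by (auto simp: W_def)
      moreover have "closed V" unfolding V trunc_def by (intro closed_Collect_eq continuous_intros)
      ultimately show ?thesis by (auto intro!: closed_Int closed_INT closed_Collect_eq continuous_intros)
    qed
    moreover have "W \<inter> {v. norm v = 1} = W \<inter> (V \<inter> {v. norm v = 1})" by (auto simp: W_def)
    ultimately have "compact (W \<inter> {v. norm v = 1})"
      using V_compact by (simp add: closed_Int_compact)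
    moreover have "sgn y \<in> W \<inter> {v. norm v = 1}"
      using y subW by (simp add: norm_sgn sgn_div_norm subspace_scale)
    moreover have "continuous_on (W \<inter> {v. norm v = 1}) (\<lambda>v. v \<bullet> A v)"
      by (intro continuous_intros)
    ultimately obtain g where g: "g \<in> W" "norm g = 1" "\<And>v. v \<in> W \<Longrightarrow> norm v = 1 \<Longrightarrow> v \<bullet> A v \<le> g \<bullet> A g"
      using continuous_attains_sup[of "W \<inter> {v. norm v = 1}" "\<lambda>v. v \<bullet> A v"] by blast
    have "A g = (g \<bullet> A g) *\<^sub>R g"
      by (rule eigenvector_of_maximum[OF A subW AW g])
    then show "\<exists>y\<in>?E. y \<bullet> y = 1 \<and> (\<forall>i<m. f i \<bullet> y = 0)"
      using g by (intro bexI[of _ g]) (auto simp: W_def norm_eq_1)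
  qed
  \<comment> \<open>A dimension count: the squared lengths of K + 1 orthonormal vectors in V,
    expanded in the K basis vectors, add up to at most K by Bessel's inequality.\<close>
  moreover have infinite: False if f: "\<forall>i. f i \<in> ?E" "\<forall>m. orthonormal_upto (\<bullet>) m f" for f
  proof -
    have "real (Suc K) = (\<Sum>i<Suc K. (norm (f i))\<^sup>2)"
      using orthonormal_upto_norm[OF f(2)[rule_format, of "Suc K"]] by simp
    also have "\<dots> = (\<Sum>i<Suc K. \<Sum>m<K. (real_basis m \<bullet> f i)\<^sup>2)"
      using f(1) by (intro sum.cong V_norm) auto
    also have "\<dots> = (\<Sum>m<K. \<Sum>i<Suc K. (f i \<bullet> real_basis m)\<^sup>2)"
      by (subst sum.swap) (simp add: inner_commute)
    also have "\<dots> \<le> (\<Sum>m<K. (norm (real_basis m))\<^sup>2)"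
      by (intro sum_mono Bessel f(2)[rule_format])
    also have "\<dots> = K"
      using orthonormal_upto_norm[OF orthonormal_upto_real_basis[of K]] by simp
    finally show False by simp
  qed
  ultimately have "\<exists>m f. (\<forall>i<m. f i \<in> ?E) \<and> orthonormal_upto (\<bullet>) m f \<and> (\<forall>x\<in>V. x = (\<Sum>i<m. (f i \<bullet> x) *\<^sub>R f i))"
  proof (elim disjE)
    assume "\<exists>f. (\<forall>i. f i \<in> ?E) \<and> (\<forall>m. orthonormal_upto (\<bullet>) m f)"
    then obtain f where "\<forall>i. f i \<in> ?E" "\<forall>m. orthonormal_upto (\<bullet>) m f" by (elim exE conjE)
    from infinite[OF this] show ?thesis ..
  qed
  then show ?thesis
    by (elim ex_forward) simp
qed

section \<open>Compressions and bounds for polynomials of operators\<close>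

lemma norm_trunc_le: "norm (trunc K v) \<le> norm v"
proof -
  have "(norm (trunc K v))\<^sup>2 \<le> (norm v)\<^sup>2"
    using Bessel[OF orthonormal_upto_real_basis, of v K]
    by (simp add: trunc_def norm_orthonormal_sum[OF orthonormal_upto_real_basis])
  then show ?thesis by (rule power2_le_imp_le) simp
qed

lemma bounded_linear_trunc: "bounded_linear (trunc K)"
  by (rule bounded_linear_intro[of _ 1])
    (simp_all add: norm_trunc_le, simp_all add: trunc_def inner_add_right scaleR_add_left sum.distrib scaleR_sum_right)

lemma trunc_trunc: "trunc K (trunc K v) = trunc K v"
  unfolding trunc_def
  by (intro sum.cong) (simp_all add: inner_orthonormal_sum[OF orthonormal_upto_real_basis])

lemma inner_trunc: "trunc K x \<bullet> y = x \<bullet> trunc K y"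
  by (simp add: trunc_def inner_sum_left inner_sum_right inner_commute mult.commute)

lemma trunc_real_basis: "m < K \<Longrightarrow> trunc K (real_basis m) = real_basis m"
  by (simp add: trunc_def orthonormal_real_basis of_bool_def if_distrib[of "\<lambda>c. c *\<^sub>R _"] cong: if_cong)

definition compression :: "nat \<Rightarrow> op_ell2 \<Rightarrow> op_ell2"
  where "compression K A = Blinfun (trunc K) o\<^sub>L A o\<^sub>L Blinfun (trunc K)"

lemma compression_apply [simp]: "compression K A v = trunc K (A (trunc K v))"
  by (simp add: compression_def bounded_linear_Blinfun_apply[OF bounded_linear_trunc])

lemma psd_compression: "psd A \<Longrightarrow> psd (compression K A)"
  unfolding psd_def selfadj_def by (simp add: inner_trunc flip: inner_trunc) (metis inner_trunc)

lemma norm_compression_le: "norm (compression K A) \<le> norm A"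
proof (rule norm_blinfun_bound)
  fix v
  have "norm (compression K A v) \<le> norm (A (trunc K v))" by (simp add: norm_trunc_le)
  also have "\<dots> \<le> norm A * norm v"
    by (intro order_trans[OF norm_blinfun] mult_left_mono norm_trunc_le) auto
  finally show "norm (compression K A v) \<le> norm A * norm v" .
qed simp

lemma compression_tendsto: "(\<lambda>K. compression K A v) \<longlonglongrightarrow> A v"
proof -
  have "(\<lambda>K. trunc K (A (trunc K v) - A v)) \<longlonglongrightarrow> 0"
  proof (rule Lim_null_comparison)
    show "\<forall>\<^sub>F K in sequentially. norm (trunc K (A (trunc K v) - A v)) \<le> norm (A (trunc K v) - A v)"
      by (simp add: norm_trunc_le)
    have "(\<lambda>K. A (trunc K v) - A v) \<longlonglongrightarrow> A v - A v"
      by (intro tendsto_intros trunc_tendsto)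
    then show "(\<lambda>K. norm (A (trunc K v) - A v)) \<longlonglongrightarrow> 0"
      using tendsto_norm_zero by simp
  qed
  from tendsto_add[OF this trunc_tendsto[of "A v"]] show ?thesis
    by (simp add: linear_simps[OF bounded_linear_trunc])
qed

text \<open>Composition respects strong convergence on norm-bounded families, whence the bound M.
  The vector varies with K so that it may be truncated along with the operator.\<close>

lemma op_poly_strong_limit:
  assumes M: "\<And>K. norm (A' K) \<le> M" and A: "\<And>v. (\<lambda>K. blinfun_apply (A' K) v) \<longlonglongrightarrow> blinfun_apply A v"
    and v: "v' \<longlonglongrightarrow> v"
  shows "(\<lambda>K. op_poly q (A' K) (v' K)) \<longlonglongrightarrow> op_poly q A v"
proof (induction q)
  case (pCons a q)
  let ?d = "\<lambda>K. op_poly q (A' K) (v' K) - op_poly q A v"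
  have "(\<lambda>K. A' K (?d K)) \<longlonglongrightarrow> 0"
  proof (rule Lim_null_comparison)
    show "\<forall>\<^sub>F K in sequentially. norm (A' K (?d K)) \<le> M * norm (?d K)"
      using M by (intro always_eventually allI order_trans[OF norm_blinfun] mult_right_mono) auto
    show "(\<lambda>K. M * norm (?d K)) \<longlonglongrightarrow> 0"
      using pCons by (intro tendsto_mult_right_zero tendsto_norm_zero) (simp add: LIM_zero)
  qed
  from tendsto_add[OF this A[of "op_poly q A v"]]
  have "(\<lambda>K. A' K (op_poly q (A' K) (v' K))) \<longlonglongrightarrow> A (op_poly q A v)"
    by (simp add: blinfun.diff_right)
  then have "(\<lambda>K. a *\<^sub>R v' K + A' K (op_poly q (A' K) (v' K))) \<longlonglongrightarrow> a *\<^sub>R v + A (op_poly q A v)"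
    by (intro tendsto_add tendsto_scaleR tendsto_const v)
  then show ?case
    by (simp add: op_poly_pCons blinfun.add_left blinfun.scaleR_left)
qed simp

text \<open>The compressions of \<open>A\<close> to finite-dimensional subspaces are diagonalizable and converge strongly
  to \<open>A\<close>, so that no spectral theorem for \<open>A\<close> itself is needed.\<close>

lemma op_poly_nonneg:
  assumes A: "psd A" and q: "\<And>t. 0 \<le> t \<Longrightarrow> t \<le> norm A \<Longrightarrow> 0 \<le> poly q t"
  shows "0 \<le> v \<bullet> op_poly q A v"
proof -
  have "0 \<le> trunc K v \<bullet> op_poly q (compression K A) (trunc K v)" for K
  proof -
    define B V where "B = compression K A" and "V = {v. trunc K v = v}"
    have B: "psd B" unfolding B_def by (rule psd_compression[OF A])
    have "B w \<in> V" for w by (simp add: B_def V_def trunc_trunc)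
    then obtain m g where on: "orthonormal_upto (\<bullet>) m g"
      and eig: "\<And>i. i < m \<Longrightarrow> B (g i) = (g i \<bullet> B (g i)) *\<^sub>R g i"
      and expand: "\<And>w. w \<in> V \<Longrightarrow> w = (\<Sum>i<m. (g i \<bullet> w) *\<^sub>R g i)"
      using finite_dim_eigenbasis[OF _ V_def, of B] B unfolding psd_def by blast
    have mu: "0 \<le> poly q (g i \<bullet> B (g i))" if "i < m" for i
      using B inner_blinfun_le[of "g i" B] norm_compression_le[of K A] orthonormal_upto_norm[OF on that]
      by (intro q) (simp_all add: psd_def B_def)
    define w where "w = trunc K v"
    have "w \<in> V" by (simp add: w_def V_def trunc_trunc)
    then have "op_poly q B w = op_poly q B (\<Sum>i<m. (g i \<bullet> w) *\<^sub>R g i)"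
      using expand by metis
    also have "\<dots> = (\<Sum>i<m. (g i \<bullet> w) *\<^sub>R (poly q (g i \<bullet> B (g i)) *\<^sub>R g i))"
      by (simp add: blinfun.sum_right blinfun.scaleR_right op_poly_eigenvector[OF eig])
    finally have eq: "w \<bullet> op_poly q B w = (\<Sum>i<m. poly q (g i \<bullet> B (g i)) * (g i \<bullet> w)\<^sup>2)"
      by (simp add: inner_sum_right power2_eq_square inner_commute mult_ac)
    have "0 \<le> w \<bullet> op_poly q B w"
      unfolding eq using mu by (intro sum_nonneg mult_nonneg_nonneg) auto
    then show ?thesis by (simp only: B_def w_def)
  qed
  moreover have "(\<lambda>K. trunc K v \<bullet> op_poly q (compression K A) (trunc K v)) \<longlonglongrightarrow> v \<bullet> op_poly q A v"
    by (intro tendsto_inner trunc_tendsto op_poly_strong_limit[OF norm_compression_le compression_tendsto])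
  ultimately show ?thesis
    by (intro LIMSEQ_le_const) auto
qed

lemma op_poly_lower:
  assumes A: "psd A" and q: "\<And>t. 0 \<le> t \<Longrightarrow> t \<le> norm A \<Longrightarrow> c \<le> poly q t"
  shows "c * (norm v)\<^sup>2 \<le> v \<bullet> op_poly q A v"
  using op_poly_nonneg[OF A, of "q - [:c:]" v] q
  by (simp add: op_poly_diff blinfun.diff_left blinfun.scaleR_left inner_diff_right power2_norm_eq_inner)

text \<open>On the interval q^2 is at most c^2, and for the self-adjoint operator q(A) the form of
  q(A)^2 at v is the squared norm of q(A) v.\<close>

lemma norm_op_poly_le:
  assumes A: "psd A" and q: "\<And>t. 0 \<le> t \<Longrightarrow> t \<le> norm A \<Longrightarrow> \<bar>poly q t\<bar> \<le> c"
  shows "norm (op_poly q A) \<le> c"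
proof -
  have c: "c \<ge> 0" using q[of 0] by simp
  have "norm (op_poly q A v) \<le> c * norm v" for v
  proof -
    have "- (c\<^sup>2) * (norm v)\<^sup>2 \<le> v \<bullet> op_poly (- (q * q)) A v"
    proof (rule op_poly_lower[OF A])
      fix t assume "0 \<le> t" "t \<le> norm A"
      then have "\<bar>poly q t\<bar>\<^sup>2 \<le> c\<^sup>2" using q by (intro power_mono) auto
      then show "- (c\<^sup>2) \<le> poly (- (q * q)) t" by (simp add: power2_eq_square)
    qed
    also have "op_poly (- (q * q)) A = - (op_poly q A o\<^sub>L op_poly q A)"
      using op_poly_smult[of "- 1" "q * q" A] by (simp add: op_poly_mult)
    also have "v \<bullet> (- (op_poly q A o\<^sub>L op_poly q A)) v = - (norm (op_poly q A v))\<^sup>2"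
      using selfadjD[OF selfadj_op_poly, of A q v "op_poly q A v"] A
      by (simp add: psd_def blinfun.minus_left power2_norm_eq_inner)
    finally have "(norm (op_poly q A v))\<^sup>2 \<le> (c * norm v)\<^sup>2"
      by (simp add: power_mult_distrib)
    then show ?thesis by (rule power2_le_imp_le) (use c in simp)
  qed
  then show ?thesis using c by (intro norm_blinfun_bound) auto
qed

section \<open>From polynomials to continuous functions\<close>

lemma uniform_polynomials:
  fixes f :: "real \<Rightarrow> real"
  assumes "continuous_on {a..b} f"
  shows "\<exists>q. uniform_limit {a..b} (\<lambda>k. poly (q k)) f sequentially"
proof -
  have "\<exists>p. \<forall>x\<in>{a..b}. \<bar>f x - poly p x\<bar> < 1 / Suc k" for k :: nat
  proof -
    obtain g where g: "real_polynomial_function g" "\<And>x. x \<in> {a..b} \<Longrightarrow> \<bar>f x - g x\<bar> < 1 / Suc k"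
      by (rule Stone_Weierstrass_real_polynomial_function[OF compact_Icc assms, of "1 / Suc k"]) auto
    obtain c n where "g = (\<lambda>x. \<Sum>i\<le>n. c i * x ^ i)"
      using g(1) real_polynomial_function_iff_sum by blast
    then have "g x = poly (\<Sum>i\<le>n. Polynomial.monom (c i) i) x" for x
      by (simp add: poly_sum poly_monom)
    then show ?thesis using g(2) by metis
  qed
  then obtain q where q: "\<And>k x. x \<in> {a..b} \<Longrightarrow> \<bar>f x - poly (q k) x\<bar> < 1 / Suc k"
    by metis
  have "uniform_limit {a..b} (\<lambda>k. poly (q k)) f sequentially"
    unfolding uniform_limit_iff
  proof (intro allI impI)
    fix e :: real assume "e > 0"
    then have "\<forall>\<^sub>F k in sequentially. 1 / Suc k < e"
      using order_tendstoD(2)[OF LIMSEQ_inverse_real_of_nat] by (simp add: inverse_eq_divide)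
    then show "\<forall>\<^sub>F k in sequentially. \<forall>x\<in>{a..b}. dist (poly (q k) x) (f x) < e"
    proof eventually_elim
      case (elim k)
      show ?case
      proof
        fix x assume "x \<in> {a..b}"
        then have "\<bar>f x - poly (q k) x\<bar> < e" by (rule less_trans[OF q elim])
        then show "dist (poly (q k) x) (f x) < e" by (simp add: dist_real_def abs_minus_commute)
      qed
    qed
  qed
  then show ?thesis by blast
qed

lemma op_poly_difference_tendsto:
  assumes A: "psd A" and "uniform_limit {0..norm A} (\<lambda>k. poly (q k)) f F" "uniform_limit {0..norm A} (\<lambda>k. poly (q' k)) f F"
  shows "((\<lambda>k. op_poly (q k) A - op_poly (q' k) A) \<longlongrightarrow> 0) F"
proof (rule tendstoI)
  fix e :: real assume e: "e > 0"
  have "\<forall>\<^sub>F k in F. (\<forall>x\<in>{0..norm A}. dist (poly (q k) x) (f x) < e / 4) \<and> (\<forall>x\<in>{0..norm A}. dist (poly (q' k) x) (f x) < e / 4)"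
  proof -
    have e4: "e / 4 > 0" using e by simp
    show ?thesis
      by (intro eventually_conj assms(2,3)[unfolded uniform_limit_iff, rule_format, OF e4])
  qed
  then show "\<forall>\<^sub>F k in F. dist (op_poly (q k) A - op_poly (q' k) A) 0 < e"
  proof eventually_elim
    case (elim k)
    have "norm (op_poly (q k - q' k) A) \<le> e / 2"
    proof (rule norm_op_poly_le[OF A])
      fix t assume "0 \<le> t" "t \<le> norm A"
      then have "\<bar>poly (q k) t - f t\<bar> < e / 4" "\<bar>poly (q' k) t - f t\<bar> < e / 4"
        using elim by (auto simp: dist_real_def)
      then show "\<bar>poly (q k - q' k) t\<bar> \<le> e / 2"
        using abs_triangle_ineq4[of "poly (q k) t - f t" "poly (q' k) t - f t"] by simp
    qed
    then show ?case using e by (simp add: op_poly_diff)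
  qed
qed

text \<open>Polynomials that are uniformly close on the interval give operators that are close in
  norm, so the sequence is Cauchy and all approximating sequences share its limit. Uniqueness in the
  definite description comes from the existence of at least one such sequence, here q.\<close>

lemma fun_calculus_tendsto:
  assumes A: "psd A" and f: "continuous_on {0..norm A} f"
    and q: "uniform_limit {0..norm A} (\<lambda>k. poly (q k)) f sequentially"
  shows "(\<lambda>k. op_poly (q k) A) \<longlonglongrightarrow> fun_calculus f A"
proof -
  have Cauchy: "Cauchy (\<lambda>k. op_poly (q k) A)"
  proof (rule metric_CauchyI)
    fix e :: real assume e: "e > 0"
    then obtain N where N: "\<And>k x. k \<ge> N \<Longrightarrow> x \<in> {0..norm A} \<Longrightarrow> dist (poly (q k) x) (f x) < e / 4"
      using q unfolding uniform_limit_iff eventually_sequentially by (meson zero_less_divide_iff zero_less_numeral)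
    have "dist (op_poly (q k) A) (op_poly (q l) A) < e" if "k \<ge> N" "l \<ge> N" for k l
    proof -
      have "norm (op_poly (q k - q l) A) \<le> e / 2"
      proof (rule norm_op_poly_le[OF A])
        fix t assume "0 \<le> t" "t \<le> norm A"
        then have "\<bar>poly (q k) t - f t\<bar> < e / 4" "\<bar>poly (q l) t - f t\<bar> < e / 4"
          using N[OF that(1)] N[OF that(2)] by (auto simp: dist_real_def)
        then show "\<bar>poly (q k - q l) t\<bar> \<le> e / 2"
          using abs_triangle_ineq4[of "poly (q k) t - f t" "poly (q l) t - f t"] by simp
      qed
      then show ?thesis using e by (simp add: op_poly_diff dist_norm)
    qed
    then show "\<exists>N. \<forall>k\<ge>N. \<forall>l\<ge>N. dist (op_poly (q k) A) (op_poly (q l) A) < e" by blast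
  qed
  then obtain B where B: "(\<lambda>k. op_poly (q k) A) \<longlonglongrightarrow> B"
    using Cauchy_convergent convergent_def by blast
  have all: "(\<lambda>k. op_poly (r k) A) \<longlonglongrightarrow> B" if "uniform_limit {0..norm A} (\<lambda>k. poly (r k)) f sequentially" for r
    using tendsto_add[OF op_poly_difference_tendsto[OF A that q] B] by simp
  have "fun_calculus f A = B"
    unfolding fun_calculus_def
  proof (rule the_equality)
    fix C assume "\<forall>q. uniform_limit {0..norm A} (\<lambda>k. poly (q k)) f sequentially \<longrightarrow> (\<lambda>k. op_poly (q k) A) \<longlonglongrightarrow> C"
    then show "C = B" using q B LIMSEQ_unique by blast
  qed (use all in blast)
  then show ?thesis using B by simp
qed

lemma fun_calculus_approx:
  assumes "psd A" "continuous_on {0..norm A} f"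
  obtains q where "uniform_limit {0..norm A} (\<lambda>k. poly (q k)) f sequentially"
    "(\<lambda>k. op_poly (q k) A) \<longlonglongrightarrow> fun_calculus f A"
    "\<And>v. (\<lambda>k. op_poly (q k) A v) \<longlonglongrightarrow> fun_calculus f A v"
proof -
  obtain q where q: "uniform_limit {0..norm A} (\<lambda>k. poly (q k)) f sequentially"
    using uniform_polynomials[OF assms(2)] by blast
  note lim = fun_calculus_tendsto[OF assms q]
  have "(\<lambda>k. op_poly (q k) A v) \<longlonglongrightarrow> fun_calculus f A v" for v
    by (rule blinfun.tendsto[OF lim tendsto_const])
  then show ?thesis using q lim that by blast
qed

lemma fun_calculus_poly:
  assumes "psd A" shows "fun_calculus (poly q) A = op_poly q A"
proof -
  have "(\<lambda>k::nat. op_poly q A) \<longlonglongrightarrow> fun_calculus (poly q) A"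
    by (rule fun_calculus_tendsto[OF assms]) (auto intro: continuous_intros uniform_limit_const)
  then show ?thesis by (simp add: LIMSEQ_const_iff)
qed

lemma fun_calculus_cong:
  assumes A: "psd A" and f: "continuous_on {0..norm A} f" and fg: "\<And>t. 0 \<le> t \<Longrightarrow> t \<le> norm A \<Longrightarrow> f t = g t"
  shows "fun_calculus f A = fun_calculus g A"
proof -
  obtain q where q: "uniform_limit {0..norm A} (\<lambda>k. poly (q k)) f sequentially" "(\<lambda>k. op_poly (q k) A) \<longlonglongrightarrow> fun_calculus f A"
    by (rule fun_calculus_approx[OF A f]) blast
  have "continuous_on {0..norm A} g" by (rule continuous_on_eq[OF f]) (use fg in auto)
  moreover have "uniform_limit {0..norm A} (\<lambda>k. poly (q k)) g sequentially"
    using q(1) fg by (simp add: uniform_limit_iff)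
  ultimately have "(\<lambda>k. op_poly (q k) A) \<longlonglongrightarrow> fun_calculus g A"
    by (rule fun_calculus_tendsto[OF A])
  then show ?thesis using q(2) LIMSEQ_unique by blast
qed

lemma fun_calculus_mult:
  assumes A: "psd A" and f: "continuous_on {0..norm A} f" and g: "continuous_on {0..norm A} g"
  shows "fun_calculus (\<lambda>t. f t * g t) A = fun_calculus f A o\<^sub>L fun_calculus g A"
proof -
  obtain q where q: "uniform_limit {0..norm A} (\<lambda>k. poly (q k)) f sequentially" "(\<lambda>k. op_poly (q k) A) \<longlonglongrightarrow> fun_calculus f A"
    by (rule fun_calculus_approx[OF A f]) blast
  obtain r where r: "uniform_limit {0..norm A} (\<lambda>k. poly (r k)) g sequentially" "(\<lambda>k. op_poly (r k) A) \<longlonglongrightarrow> fun_calculus g A"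
    by (rule fun_calculus_approx[OF A g]) blast
  have bnd: "bounded (f ` {0..norm A})" "bounded (g ` {0..norm A})"
    using f g by (auto intro!: compact_imp_bounded compact_continuous_image)
  have "uniform_limit {0..norm A} (\<lambda>k. poly (q k * r k)) (\<lambda>t. f t * g t) sequentially"
  proof -
    have "poly (q k * r k) = (\<lambda>t. poly (q k) t * poly (r k) t)" for k
      by (simp add: fun_eq_iff)
    then show ?thesis using uniform_lim_mult[OF q(1) r(1) bnd] by simp
  qed
  then have "(\<lambda>k. op_poly (q k * r k) A) \<longlonglongrightarrow> fun_calculus (\<lambda>t. f t * g t) A"
    by (intro fun_calculus_tendsto[OF A]) (auto intro: continuous_intros f g)
  moreover have "(\<lambda>k. op_poly (q k * r k) A) \<longlonglongrightarrow> (fun_calculus f A o\<^sub>L fun_calculus g A)"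
    unfolding op_poly_mult by (rule bounded_bilinear.tendsto[OF bounded_bilinear_blinfun_compose q(2) r(2)])
  ultimately show ?thesis by (rule LIMSEQ_unique)
qed

lemma selfadj_fun_calculus:
  assumes A: "psd A" and f: "continuous_on {0..norm A} f"
  shows "selfadj (fun_calculus f A)"
  unfolding selfadj_def
proof (intro allI)
  fix x y
  obtain q where q: "\<And>v. (\<lambda>k. op_poly (q k) A v) \<longlonglongrightarrow> fun_calculus f A v"
    by (rule fun_calculus_approx[OF A f]) blast
  have "(\<lambda>k. op_poly (q k) A x \<bullet> y) \<longlonglongrightarrow> fun_calculus f A x \<bullet> y"
    by (intro tendsto_intros q)
  moreover have "op_poly (q k) A x \<bullet> y = x \<bullet> op_poly (q k) A y" for k
    using selfadj_op_poly A by (simp add: psd_def selfadj_def)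
  moreover have "(\<lambda>k. x \<bullet> op_poly (q k) A y) \<longlonglongrightarrow> x \<bullet> fun_calculus f A y"
    by (intro tendsto_intros q)
  ultimately show "fun_calculus f A x \<bullet> y = x \<bullet> fun_calculus f A y"
    using LIMSEQ_unique by simp
qed

lemma complex_linear_fun_calculus:
  assumes A: "psd A" and f: "continuous_on {0..norm A} f" and c: "complex_linear A"
  shows "complex_linear (fun_calculus f A)"
  unfolding complex_linear_def
proof (intro allI)
  fix c x
  obtain q where q: "\<And>v. (\<lambda>k. op_poly (q k) A v) \<longlonglongrightarrow> fun_calculus f A v"
    by (rule fun_calculus_approx[OF A f]) blast
  have "(\<lambda>k. scaleC c (op_poly (q k) A x)) \<longlonglongrightarrow> scaleC c (fun_calculus f A x)"
    by (rule bounded_linear.tendsto[OF bounded_linear_scaleC q])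
  moreover have "scaleC c (op_poly (q k) A x) = op_poly (q k) A (scaleC c x)" for k
    using complex_linear_op_poly[OF assms(3)] by (simp add: complex_linear_def)
  ultimately show "fun_calculus f A (scaleC c x) = scaleC c (fun_calculus f A x)"
    using q[of "scaleC c x"] LIMSEQ_unique by simp
qed

text \<open>With r = 0 this is positivity of f(A); with a suitable parabola as r it will yield
  Jensen's inequality.\<close>

lemma fun_calculus_lower:
  assumes A: "psd A" and f: "continuous_on {0..norm A} f"
    and r: "\<And>t. 0 \<le> t \<Longrightarrow> t \<le> norm A \<Longrightarrow> poly r t \<le> f t"
  shows "v \<bullet> op_poly r A v \<le> v \<bullet> fun_calculus f A v"
proof (rule field_le_epsilon)
  fix e :: real assume e: "e > 0"
  obtain q where q: "uniform_limit {0..norm A} (\<lambda>k. poly (q k)) f sequentially"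
    "\<And>v. (\<lambda>k. op_poly (q k) A v) \<longlonglongrightarrow> fun_calculus f A v"
    by (rule fun_calculus_approx[OF A f]) blast
  define d where "d = e / ((norm v)\<^sup>2 + 1)"
  have pos: "(norm v)\<^sup>2 + 1 > 0" by (simp add: add_nonneg_pos)
  have d: "d > 0" "d * (norm v)\<^sup>2 \<le> e"
    using e pos by (simp_all add: d_def field_simps)
  have "\<forall>\<^sub>F k in sequentially. v \<bullet> op_poly r A v - e \<le> v \<bullet> op_poly (q k) A v"
    using q(1)[unfolded uniform_limit_iff, rule_format, OF d(1)]
  proof eventually_elim
    case (elim k)
    have "- d * (norm v)\<^sup>2 \<le> v \<bullet> op_poly (q k - r) A v"
    proof (rule op_poly_lower[OF A])
      fix t assume t: "0 \<le> t" "t \<le> norm A"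
      then have "\<bar>poly (q k) t - f t\<bar> < d" using elim by (simp add: dist_real_def)
      then show "- d \<le> poly (q k - r) t" using r[OF t] by simp
    qed
    then show ?case using d(2) by (simp add: op_poly_diff blinfun.diff_left inner_diff_right)
  qed
  moreover have "(\<lambda>k. v \<bullet> op_poly (q k) A v) \<longlonglongrightarrow> v \<bullet> fun_calculus f A v"
    by (intro tendsto_intros q)
  ultimately have "v \<bullet> op_poly r A v - e \<le> v \<bullet> fun_calculus f A v"
    by (intro tendsto_lowerbound[where F = sequentially]) auto
  then show "v \<bullet> op_poly r A v \<le> v \<bullet> fun_calculus f A v + e" by simp
qed

lemma psd_fun_calculus:
  assumes A: "psd A" and f: "continuous_on {0..norm A} f"
    and "\<And>t. 0 \<le> t \<Longrightarrow> t \<le> norm A \<Longrightarrow> 0 \<le> f t"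
  shows "psd (fun_calculus f A)"
  using fun_calculus_lower[OF A f, of 0] selfadj_fun_calculus[OF A f] assms(3) by (simp add: psd_def)

text \<open>Comparison with a fixed polynomial lets one approximation serve a whole sequence of
  operators at once.\<close>

lemma norm_fun_calculus_diff_le:
  assumes A: "psd A" and f: "continuous_on {0..norm A} f"
    and c: "\<And>t. 0 \<le> t \<Longrightarrow> t \<le> norm A \<Longrightarrow> \<bar>f t - poly r t\<bar> \<le> c"
  shows "norm (fun_calculus f A - op_poly r A) \<le> c"
proof (rule field_le_epsilon)
  fix e :: real assume e: "e > 0"
  obtain q where q: "uniform_limit {0..norm A} (\<lambda>k. poly (q k)) f sequentially"
    "(\<lambda>k. op_poly (q k) A) \<longlonglongrightarrow> fun_calculus f A"
    by (rule fun_calculus_approx[OF A f]) blast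
  have "\<forall>\<^sub>F k in sequentially. norm (op_poly (q k) A - op_poly r A) \<le> c + e"
    using q(1)[unfolded uniform_limit_iff, rule_format, OF e]
  proof eventually_elim
    case (elim k)
    have "norm (op_poly (q k - r) A) \<le> c + e"
    proof (rule norm_op_poly_le[OF A])
      fix t assume t: "0 \<le> t" "t \<le> norm A"
      then have "\<bar>poly (q k) t - f t\<bar> < e" using elim by (simp add: dist_real_def)
      then show "\<bar>poly (q k - r) t\<bar> \<le> c + e" using c[OF t] by simp
    qed
    then show ?case by (simp add: op_poly_diff)
  qed
  then show "norm (fun_calculus f A - op_poly r A) \<le> c + e"
    by (intro tendsto_upperbound[OF tendsto_norm[OF tendsto_diff[OF q(2) tendsto_const]]]) auto
qed

lemma norm_fun_calculus_le:
  assumes "psd A" "continuous_on {0..norm A} f"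
    and "\<And>t. 0 \<le> t \<Longrightarrow> t \<le> norm A \<Longrightarrow> \<bar>f t\<bar> \<le> c"
  shows "norm (fun_calculus f A) \<le> c"
  using norm_fun_calculus_diff_le[OF assms(1,2), of 0 c] assms(3) by simp

lemma fun_calculus_eigenvector:
  assumes A: "psd A" and f: "continuous_on {0..norm A} f" and v: "A v = c *\<^sub>R v" "0 \<le> c" "c \<le> norm A"
  shows "fun_calculus f A v = f c *\<^sub>R v"
proof -
  obtain q where q: "uniform_limit {0..norm A} (\<lambda>k. poly (q k)) f sequentially"
    "\<And>v. (\<lambda>k. op_poly (q k) A v) \<longlonglongrightarrow> fun_calculus f A v"
    by (rule fun_calculus_approx[OF A f]) blast
  have "(\<lambda>k. poly (q k) c) \<longlonglongrightarrow> f c"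
    using tendsto_uniform_limitI[OF q(1), of c] v by simp
  then have "(\<lambda>k. poly (q k) c *\<^sub>R v) \<longlonglongrightarrow> f c *\<^sub>R v"
    by (intro tendsto_intros)
  then show ?thesis
    using q(2)[of v] LIMSEQ_unique by (simp add: op_poly_eigenvector[OF v(1)])
qed

section \<open>Schatten norms\<close>

lemma powr_le_cancel2: "p > 0 \<Longrightarrow> 0 \<le> y \<Longrightarrow> x powr p \<le> y powr p \<Longrightarrow> x \<le> (y::real)"
  using powr_less_mono2[of p y x] by linarith

text \<open>The convex power lies above its tangent at c. For c = 1 this is Bernoulli's inequality,
  obtained from Young's inequality with second factor 1; scaling gives the rest.\<close>

lemma powr_tangent:
  assumes "p > 1" "c > 0" "a \<ge> (0::real)"
  shows "c powr p * (1 + p * (a / c - 1)) \<le> a powr p"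
proof -
  define q where "q = p / (p - 1)"
  have q: "q > 1" "1 / p + 1 / q = 1" using assms(1) by (auto simp: q_def field_simps)
  have "a / c * 1 \<le> (a / c) powr p / p + 1 powr q / q"
    using assms q by (intro Youngs_inequality) auto
  moreover have "1 / q = 1 - 1 / p" using q by simp
  ultimately have "a / c \<le> (a / c) powr p / p + 1 - 1 / p" by simp
  then have "p * (a / c) \<le> p * ((a / c) powr p / p + 1 - 1 / p)"
    using assms(1) by (intro mult_left_mono) auto
  also have "\<dots> = (a / c) powr p + p - 1"
    using assms(1) by (simp add: distrib_left right_diff_distrib)
  finally have "1 + p * (a / c - 1) \<le> (a / c) powr p"
    by (simp add: algebra_simps)
  then have "c powr p * (1 + p * (a / c - 1)) \<le> c powr p * (a / c) powr p"
    by (intro mult_left_mono) auto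
  also have "\<dots> = a powr p" using assms by (simp add: powr_divide)
  finally show ?thesis .
qed

text \<open>The tangent at the weighted mean, evaluated at a and b, averages to the value at the
  mean.\<close>

lemma powr_convex_combination:
  assumes p: "p > 1" and "s \<ge> 0" "t \<ge> 0" "s + t = 1" "a \<ge> 0" "b \<ge> (0::real)"
  shows "(s * a + t * b) powr p \<le> s * a powr p + t * b powr p"
proof (cases "s * a + t * b = 0")
  case False
  define c where "c = s * a + t * b"
  have c: "c > 0" using False assms unfolding c_def by (smt (verit) mult_nonneg_nonneg)
  have "s * (c powr p * (1 + p * (a / c - 1))) + t * (c powr p * (1 + p * (b / c - 1))) \<le> s * a powr p + t * b powr p"
    using assms c by (intro add_mono mult_left_mono powr_tangent) auto
  moreover have "s * (c powr p * (1 + p * (a / c - 1))) + t * (c powr p * (1 + p * (b / c - 1))) = c powr p"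
  proof -
    have "s * (c powr p * (1 + p * (a / c - 1))) + t * (c powr p * (1 + p * (b / c - 1))) = 
       c powr p * ((s + t) + p * ((s * a + t * b) / c - (s + t)))"
      using c by (simp add: field_simps)
    then show ?thesis using c assms(4) by (simp flip: c_def)
  qed
  ultimately show ?thesis by (simp add: c_def)
next
  case True
  then show ?thesis using assms by simp
qed

text \<open>Positive bounds \<open>\<alpha>\<close> and \<open>\<beta>\<close> replace the norms, so
  that vanishing sums are no special case; the factor L will absorb the ratio of real to complex
  traces. After division by \<open>\<alpha> + \<beta>\<close>, a + b is a convex combination of a /
  \<open>\<alpha>\<close> and b / \<open>\<beta>\<close>.\<close>

lemma Minkowski_sum:
  fixes a b :: "'i \<Rightarrow> real"
  assumes p: "p > 1" and nonneg: "\<And>i. i \<in> I \<Longrightarrow> 0 \<le> a i" "\<And>i. i \<in> I \<Longrightarrow> 0 \<le> b i" and pos: "\<alpha> > 0" "\<beta> > 0"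
    and le: "(\<Sum>i\<in>I. a i powr p) \<le> L * \<alpha> powr p" "(\<Sum>i\<in>I. b i powr p) \<le> L * \<beta> powr p"
  shows "(\<Sum>i\<in>I. (a i + b i) powr p) \<le> L * (\<alpha> + \<beta>) powr p"
proof -
  define s t where "s = \<alpha> / (\<alpha> + \<beta>)" and "t = \<beta> / (\<alpha> + \<beta>)"
  have st: "s \<ge> 0" "t \<ge> 0" "s + t = 1" using pos by (simp_all add: s_def t_def flip: add_divide_distrib)
  let ?C = "(\<alpha> + \<beta>) powr p"
  have "(a i + b i) powr p \<le> ?C * (s / \<alpha> powr p * a i powr p + t / \<beta> powr p * b i powr p)" if "i \<in> I" for i
  proof -
    have "a i + b i = (\<alpha> + \<beta>) * (s * (a i / \<alpha>) + t * (b i / \<beta>))"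
    proof -
      have "(\<alpha> + \<beta>) * s = \<alpha>" "(\<alpha> + \<beta>) * t = \<beta>" using pos by (simp_all add: s_def t_def)
      then show ?thesis using pos by (simp add: distrib_left mult.assoc[symmetric] del: mult.assoc)
    qed
    then have "(a i + b i) powr p = ?C * (s * (a i / \<alpha>) + t * (b i / \<beta>)) powr p"
      using pos st nonneg[OF that] by (simp add: powr_mult)
    also have "\<dots> \<le> ?C * (s * (a i / \<alpha>) powr p + t * (b i / \<beta>) powr p)"
      using pos nonneg[OF that] st by (intro mult_left_mono powr_convex_combination p) auto
    finally show ?thesis using pos nonneg[OF that] by (simp add: powr_divide)
  qed
  then have "(\<Sum>i\<in>I. (a i + b i) powr p) \<le> (\<Sum>i\<in>I. ?C * (s / \<alpha> powr p * a i powr p + t / \<beta> powr p * b i powr p))"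
    by (rule sum_mono)
  also have "\<dots> = ?C * (s / \<alpha> powr p * (\<Sum>i\<in>I. a i powr p) + t / \<beta> powr p * (\<Sum>i\<in>I. b i powr p))"
    by (simp add: sum_distrib_left sum.distrib distrib_left)
  also have "\<dots> \<le> ?C * (s / \<alpha> powr p * (L * \<alpha> powr p) + t / \<beta> powr p * (L * \<beta> powr p))"
    using st le by (intro mult_left_mono add_mono) auto
  also have "\<dots> = ?C * (L * (s + t))"
    using pos by (simp add: algebra_simps)
  finally show ?thesis using st by (simp add: mult.commute)
qed

section \<open>Absolute values, traces and orthonormal systems\<close>

lemma complex_linear_compose: "complex_linear x \<Longrightarrow> complex_linear y \<Longrightarrow> complex_linear (x o\<^sub>L y)"
  by (simp add: complex_linear_def)

lemma complex_linear_add: "complex_linear x \<Longrightarrow> complex_linear y \<Longrightarrow> complex_linear (x + y)"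
  by (simp add: complex_linear_def blinfun.add_left scaleC_simps)

lemma scaleC_minus: "scaleC c (- x) = - scaleC c x"
  by (rule ell2_eqI) (simp add: coord_scaleC uminus_ell2.rep_eq)

lemma complex_linear_minus: "complex_linear x \<Longrightarrow> complex_linear (- x)"
  by (simp add: complex_linear_def blinfun.minus_left scaleC_minus)

lemma complex_linear_diff: "complex_linear x \<Longrightarrow> complex_linear y \<Longrightarrow> complex_linear (x - y)"
  using complex_linear_add[of x "- y"] complex_linear_minus by simp

lemma complex_linear_id: "complex_linear id_blinfun"
  by (simp add: complex_linear_def)

lemma continuous_on_powr_nonneg: "r > 0 \<Longrightarrow> continuous_on {0..M} (\<lambda>t::real. t powr r)"
  by (intro continuous_on_powr' continuous_intros) auto

definition gram :: "op_ell2 \<Rightarrow> op_ell2" where "gram x = op_adjoint x o\<^sub>L x"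

lemma gram:
  assumes "complex_linear x"
  shows "psd (gram x)" "complex_linear (gram x)" "v \<bullet> gram x v = (norm (x v))\<^sup>2"
proof -
  have *: "w \<bullet> gram x v = x w \<bullet> x v" for v w
    using op_adjoint(1)[OF assms, of w "x v"] by (simp add: gram_def)
  then show "psd (gram x)" 
    by (simp add: psd_def selfadj_def) (metis inner_commute)
  show "complex_linear (gram x)"
    unfolding gram_def by (intro complex_linear_compose op_adjoint(2) assms)
  show "v \<bullet> gram x v = (norm (x v))\<^sup>2"
    using * by (simp add: power2_norm_eq_inner)
qed

lemma psd_powr: "psd A \<Longrightarrow> r > 0 \<Longrightarrow> psd (op_powr A r)"
  unfolding op_powr_def by (intro psd_fun_calculus continuous_on_powr_nonneg) auto

lemma complex_linear_powr: "psd A \<Longrightarrow> complex_linear A \<Longrightarrow> r > 0 \<Longrightarrow> complex_linear (op_powr A r)"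
  unfolding op_powr_def by (intro complex_linear_fun_calculus continuous_on_powr_nonneg)

lemma op_powr_half_square:
  assumes "psd A" "r > 0" shows "op_powr A (r / 2) o\<^sub>L op_powr A (r / 2) = op_powr A r"
proof -
  have "op_powr A (r / 2) o\<^sub>L op_powr A (r / 2) = fun_calculus (\<lambda>t. t powr (r / 2) * t powr (r / 2)) A"
    unfolding op_powr_def using assms by (intro fun_calculus_mult[symmetric] continuous_on_powr_nonneg) auto
  then show ?thesis by (simp add: op_powr_def flip: powr_add)
qed

lemma op_powr_one: 
  assumes "psd A" shows "op_powr A 1 = A"
proof -
  have "op_powr A 1 = fun_calculus (poly [:0, 1:]) A"
    unfolding op_powr_def by (rule fun_calculus_cong[OF assms continuous_on_powr_nonneg]) auto
  then show ?thesis by (simp add: fun_calculus_poly[OF assms] op_poly_linear)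
qed

text \<open>Turns traces of a power into Hilbert-Schmidt sums of the half power.\<close>

lemma norm_op_powr_half:
  assumes "psd A" "r > 0" shows "(norm (op_powr A (r / 2) v))\<^sup>2 = v \<bullet> op_powr A r v"
proof -
  have "selfadj (op_powr A (r / 2))" using psd_powr[of A "r / 2"] assms by (simp add: psd_def)
  then have "(norm (op_powr A (r / 2) v))\<^sup>2 = v \<bullet> (op_powr A (r / 2) o\<^sub>L op_powr A (r / 2)) v"
    by (simp add: power2_norm_eq_inner selfadj_def)
  then show ?thesis by (simp add: op_powr_half_square[OF assms])
qed

lemma op_abs_eq: "op_abs x = op_powr (gram x) (1 / 2)"
  by (simp add: op_abs_def gram_def)

lemma op_abs:
  assumes "complex_linear x"
  shows "psd (op_abs x)" "complex_linear (op_abs x)" "norm (op_abs x v) = norm (x v)"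
proof -
  show "psd (op_abs x)" "complex_linear (op_abs x)"
    unfolding op_abs_eq using gram[OF assms] by (auto intro: psd_powr complex_linear_powr)
  have "(norm (op_abs x v))\<^sup>2 = (norm (x v))\<^sup>2"
    using norm_op_powr_half[OF gram(1)[OF assms], of 1 v] gram(3)[OF assms, of v] gram(1)[OF assms]
    by (simp add: op_abs_eq op_powr_one)
  then show "norm (op_abs x v) = norm (x v)" by (simp add: power2_eq_iff_nonneg)
qed

abbreviation "abs_powr x p \<equiv> op_powr (op_abs x) p"

abbreviation diag :: "op_ell2 \<Rightarrow> nat \<Rightarrow> real" where "diag A n \<equiv> basis_vec n \<bullet> blinfun_apply A (basis_vec n)"

lemma psd_abs_powr: "complex_linear x \<Longrightarrow> p > 0 \<Longrightarrow> psd (abs_powr x p)"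
  by (intro psd_powr op_abs)

lemma schatten_class_iff:
  assumes x: "complex_linear x" and p: "p > 0"
  shows "x \<in> schatten_class p \<longleftrightarrow> summable (diag (abs_powr x p))"
    and "x \<in> schatten_class p \<Longrightarrow> schatten_norm p x powr p = suminf (diag (abs_powr x p))"
    and "schatten_norm p x \<ge> 0"
proof -
  let ?d = "diag (abs_powr x p)"
  have nonneg: "0 \<le> ?d n" for n using psd_abs_powr[OF x p] by (simp add: psd_def)
  have tr: "op_trace (abs_powr x p) = (\<Sum>n. ennreal (?d n))"
    by (simp add: op_trace_def inner_ell2_eq_Re_cinner)
  have 1: "x \<in> schatten_class p" if "summable ?d"
    using suminf_ennreal2[OF nonneg that] x by (simp add: schatten_class_def tr)
  have 2: "summable ?d" if "x \<in> schatten_class p"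
    using that by (intro summable_suminf_not_top nonneg) (auto simp: schatten_class_def tr)
  show "x \<in> schatten_class p \<longleftrightarrow> summable ?d" using 1 2 by blast
  show "schatten_norm p x powr p = suminf ?d" if "x \<in> schatten_class p"
  proof -
    have "op_trace (abs_powr x p) = ennreal (suminf ?d)"
      unfolding tr by (rule suminf_ennreal2[OF nonneg 2[OF that]])
    then show ?thesis
      using that p suminf_nonneg[OF 2[OF that] nonneg] by (simp add: schatten_norm_def powr_powr)
  qed
  show "schatten_norm p x \<ge> 0" by (simp add: schatten_norm_def)
qed

text \<open>Multiplication by i is isometric and commutes with C, so a basis vector and its multiple
  by i contribute equally.\<close>

lemma real_trace_partial:
  assumes "complex_linear C"
  shows "(\<Sum>m<2*N. real_basis m \<bullet> C (real_basis m)) = 2 * (\<Sum>n<N. diag C n)"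
proof (induction N)
  case (Suc N)
  have "C (scaleC \<i> v) = scaleC \<i> (C v)" for v
    using assms by (simp add: complex_linear_def)
  then have "real_basis (Suc (2*N)) \<bullet> C (real_basis (Suc (2*N))) = diag C N"
    by (simp add: real_basis_def inner_scaleC scaleC_simps) 
       (simp add: scaleC_def map_fun_def coord_inverse id_def)
  then show ?case using Suc by (simp add: real_basis_def)
qed simp

text \<open>A Hilbert-Schmidt sum over any orthonormal system is at most the one over the basis:
  expand by Parseval, exchange the sums using the symmetry of S, and apply Bessel's
  inequality.\<close>

lemma sum_norm_orthonormal_le:
  assumes S: "selfadj S" and f: "orthonormal_upto (\<bullet>) N f"
    and t: "\<And>M. (\<Sum>m<M. (norm (S (real_basis m)))\<^sup>2) \<le> t"
  shows "(\<Sum>i<N. (norm (S (f i)))\<^sup>2) \<le> t"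
proof (rule LIMSEQ_le_const2)
  show "(\<lambda>M. \<Sum>i<N. \<Sum>m<M. (real_basis m \<bullet> S (f i))\<^sup>2) \<longlonglongrightarrow> (\<Sum>i<N. (norm (S (f i)))\<^sup>2)"
    using Parseval_sums unfolding sums_def by (intro tendsto_sum)
  have "(\<Sum>i<N. \<Sum>m<M. (real_basis m \<bullet> S (f i))\<^sup>2) \<le> t" for M
  proof -
    have "(\<Sum>i<N. \<Sum>m<M. (real_basis m \<bullet> S (f i))\<^sup>2) = (\<Sum>m<M. \<Sum>i<N. (f i \<bullet> S (real_basis m))\<^sup>2)"
      using selfadjD[OF S] by (subst sum.swap) (metis (no_types, lifting) inner_commute sum.cong)
    also have "\<dots> \<le> (\<Sum>m<M. (norm (S (real_basis m)))\<^sup>2)"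
      by (intro sum_mono Bessel f)
    finally show ?thesis using t[of M] by simp
  qed
  then show "\<exists>K. \<forall>M\<ge>K. (\<Sum>i<N. \<Sum>m<M. (real_basis m \<bullet> S (f i))\<^sup>2) \<le> t" by blast
qed

text \<open>Jensen's inequality for the distribution of |x| at the unit vector v and the convex
  function u^(p/2) of u = t^2. The tangent of this function is a polynomial in t, so
  \<open>fun_calculus_lower\<close> applies and no spectral measure appears.\<close>

lemma norm_powr_le_abs_powr:
  assumes x: "complex_linear x" and p: "p > 2" and v: "norm v = 1"
  shows "norm (x v) powr p \<le> v \<bullet> abs_powr x p v"
proof (cases "x v = 0")
  case True
  then show ?thesis using psd_abs_powr[OF x, of p] p by (simp add: psd_def)
next
  case False
  define s q where "s = (norm (x v))\<^sup>2" and "q = p / 2"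
  have s: "s > 0" using False by (simp add: s_def)
  \<comment> \<open>The tangent of u^q at the mean value u = s, written in t with u = t^2. Its form
    at v is exactly s^q, because the form of |x|^2 at v is s.\<close>
  define r where "r = [:s powr q * (1 - q), 0, s powr q * q / s:]"
  have "v \<bullet> op_poly r (op_abs x) v \<le> v \<bullet> abs_powr x p v"
    unfolding op_powr_def
  proof (rule fun_calculus_lower[OF op_abs(1)[OF x]])
    show "continuous_on {0..norm (op_abs x)} (\<lambda>t. t powr p)"
      using p by (intro continuous_on_powr_nonneg) simp
    fix t :: real assume t: "0 \<le> t"
    have "poly r t = s powr q * (1 + q * (t\<^sup>2 / s - 1))"
      by (simp add: r_def algebra_simps power2_eq_square)
    also have "\<dots> \<le> (t\<^sup>2) powr q"
      using p s by (intro powr_tangent) (auto simp: q_def)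
    also have "\<dots> = t powr p"
      using t by (cases "t = 0") (simp_all add: q_def powr_powr flip: powr_numeral)
    finally show "poly r t \<le> t powr p" .
  qed
  moreover have "v \<bullet> op_poly r (op_abs x) v = s powr q"
  proof -
    have "v \<bullet> op_abs x (op_abs x v) = s"
      using op_abs(1,3)[OF x] by (simp add: s_def psd_def selfadj_def power2_norm_eq_inner[symmetric])
        (metis op_abs(3) power2_norm_eq_inner x)
    moreover have "v \<bullet> v = 1" using v by (simp add: norm_eq_1)
    ultimately show ?thesis
      using s by (simp add: r_def op_poly_pCons blinfun.add_left blinfun.diff_left inner_diff_right blinfun.scaleR_left blinfun.add_right blinfun.scaleR_right
          inner_add_right algebra_simps)
  qed
  moreover have "s powr q = norm (x v) powr p"
    using False by (simp add: s_def q_def powr_powr flip: powr_numeral)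
  ultimately show ?thesis by simp
qed

text \<open>The estimate through which orthonormal systems see the Schatten norm; both the triangle
  inequality and the cocycle rest on it.\<close>

lemma sum_norm_powr_le:
  assumes x: "x \<in> schatten_class p" and p: "p > 2" and f: "orthonormal_upto (\<bullet>) N f"
  shows "(\<Sum>i<N. norm (x (f i)) powr p) \<le> 2 * schatten_norm p x powr p"
proof -
  have cl: "complex_linear x" using x by (simp add: schatten_class_def)
  have p0: "p > 0" using p by simp
  note psdB = op_abs(1)[OF cl]
  have half: "(norm (op_powr (op_abs x) (p / 2) v))\<^sup>2 = v \<bullet> abs_powr x p v" for v
    by (rule norm_op_powr_half[OF psdB p0])
  have "(\<Sum>i<N. norm (x (f i)) powr p) \<le> (\<Sum>i<N. (norm (op_powr (op_abs x) (p / 2) (f i)))\<^sup>2)"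
    unfolding half using orthonormal_upto_norm[OF f] by (intro sum_mono norm_powr_le_abs_powr cl p) auto
  also have "\<dots> \<le> 2 * schatten_norm p x powr p"
  proof (rule sum_norm_orthonormal_le[OF _ f])
    show "selfadj (op_powr (op_abs x) (p / 2))"
      using psd_powr[OF psdB, of "p / 2"] p by (simp add: psd_def)
    fix M
    have nonneg: "0 \<le> v \<bullet> abs_powr x p v" for v
      using psd_abs_powr[OF cl p0] by (simp add: psd_def)
    have "(\<Sum>m<M. (norm (op_powr (op_abs x) (p / 2) (real_basis m)))\<^sup>2) \<le> 
        (\<Sum>m<2*M. real_basis m \<bullet> abs_powr x p (real_basis m))"
      unfolding half using nonneg by (intro sum_mono2) auto
    also have "\<dots> = 2 * (\<Sum>n<M. diag (abs_powr x p) n)"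
      by (rule real_trace_partial[OF complex_linear_powr[OF psdB op_abs(2)[OF cl] p0]])
    also have "\<dots> \<le> 2 * suminf (diag (abs_powr x p))"
      using schatten_class_iff(1)[OF cl p0] x nonneg by (intro mult_left_mono sum_le_suminf) auto
    finally show "(\<Sum>m<M. (norm (op_powr (op_abs x) (p / 2) (real_basis m)))\<^sup>2) \<le> 2 * schatten_norm p x powr p"
      using schatten_class_iff(2)[OF cl p0 x] by simp
  qed
  finally show ?thesis .
qed

text \<open>A single unit vector in \<open>sum_norm_powr_le\<close> suffices. The constant is crude:
  the factor 2 under the p-th power is replaced by 2^p.\<close>

lemma norm_le_schatten:
  assumes x: "x \<in> schatten_class p" and p: "p > 2"
  shows "norm x \<le> 2 * schatten_norm p x"
proof (rule norm_blinfun_bound)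
  have cl: "complex_linear x" using x by (simp add: schatten_class_def)
  have nonneg: "schatten_norm p x \<ge> 0" by (rule schatten_class_iff(3)[OF cl]) (use p in simp)
  then show "0 \<le> 2 * schatten_norm p x" by simp
  fix v
  show "norm (x v) \<le> 2 * schatten_norm p x * norm v"
  proof (cases "v = 0")
    case False
    then have "orthonormal_upto (\<bullet>) 1 (\<lambda>_. sgn v)"
      by (simp add: orthonormal_upto_def norm_sgn flip: norm_eq_1)
    from sum_norm_powr_le[OF x p this]
    have "norm (x (sgn v)) powr p \<le> 2 * schatten_norm p x powr p" by simp
    also have "\<dots> \<le> 2 powr p * schatten_norm p x powr p"
      using p powr_mono[of 1 p 2] by (intro mult_right_mono) auto
    also have "\<dots> = (2 * schatten_norm p x) powr p"
      using nonneg by (simp add: powr_mult)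
    finally have le: "norm (x (sgn v)) powr p \<le> (2 * schatten_norm p x) powr p" .
    have "norm (x (sgn v)) \<le> 2 * schatten_norm p x"
      by (rule powr_le_cancel2[OF _ _ le]) (use p nonneg in simp_all)
    then show ?thesis
      using False by (simp add: sgn_div_norm blinfun.scaleR_right field_simps)
  qed simp
qed

section \<open>The triangle inequality\<close>

text \<open>One polynomial close to f on the common interval approximates f of A and of every
  \<open>A' K\<close> equally well, and polynomials respect strong convergence.\<close>

lemma fun_calculus_strong_limit:
  assumes psd: "\<And>K. psd (A' K)" "psd A" and M: "\<And>K. norm (A' K) \<le> M" "norm A \<le> M"
    and A: "\<And>v. (\<lambda>K. blinfun_apply (A' K) v) \<longlonglongrightarrow> blinfun_apply A v" and f: "continuous_on {0..M} f"
  shows "(\<lambda>K. fun_calculus f (A' K) v) \<longlonglongrightarrow> fun_calculus f A v"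
proof (rule tendstoI)
  fix e :: real assume e: "e > 0"
  define d where "d = e / (4 * (norm v + 1))"
  have pos: "norm v + 1 > 0" by (simp add: add_nonneg_pos)
  have d: "d > 0" "d * norm v \<le> e / 4"
    using e pos by (simp_all add: d_def field_simps)
  obtain q where "uniform_limit {0..M} (\<lambda>k. poly (q k)) f sequentially"
    using uniform_polynomials[OF f] by blast
  then obtain r where r: "\<And>t. 0 \<le> t \<Longrightarrow> t \<le> M \<Longrightarrow> \<bar>f t - poly r t\<bar> \<le> d"
    using d(1) unfolding uniform_limit_iff eventually_sequentially dist_real_def
    by (metis abs_minus_commute atLeastAtMost_iff less_imp_le order_refl)
  have approx: "norm (fun_calculus f B v - op_poly r B v) \<le> e / 4" if "psd B" "norm B \<le> M" for B
  proof -
    have "norm (fun_calculus f B - op_poly r B) \<le> d"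
      using that r f by (intro norm_fun_calculus_diff_le continuous_on_subset[OF f]) auto
    then have "norm ((fun_calculus f B - op_poly r B) v) \<le> d * norm v"
      by (intro order_trans[OF norm_blinfun] mult_right_mono) auto
    then show ?thesis using d(2) by (simp add: blinfun.diff_left)
  qed
  have "\<forall>\<^sub>F K in sequentially. dist (op_poly r (A' K) v) (op_poly r A v) < e / 4"
    using e by (intro tendstoD op_poly_strong_limit[OF M(1) A tendsto_const]) simp
  then show "\<forall>\<^sub>F K in sequentially. dist (fun_calculus f (A' K) v) (fun_calculus f A v) < e"
  proof eventually_elim
    case (elim K)
    have "norm (a + b - c) \<le> norm a + norm b + norm c" for a b c :: ell2
      using norm_triangle_ineq4[of "a + b" c] norm_triangle_ineq[of a b] by linarith
    from this[of "fun_calculus f (A' K) v - op_poly r (A' K) v" "op_poly r (A' K) v - op_poly r A v"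
        "fun_calculus f A v - op_poly r A v"]
    have "norm (fun_calculus f (A' K) v - fun_calculus f A v) \<le> e / 4 + e / 4 + e / 4"
      using approx[OF psd(1) M(1), of K] approx[OF psd(2) M(2)] elim by (simp add: dist_norm)
    then show ?case using e by (simp add: dist_norm)
  qed
qed

text \<open>The compressed operator has a finite eigenbasis \<open>g\<close>, and the trace of its \<open>p/2\<close>-th power
  is \<open>\<Sum>i. norm (z (g i)) powr p\<close>.\<close>

lemma trace_compression:
  assumes z: "complex_linear z" and p: "p > 0"
  shows "\<exists>m g. orthonormal_upto (\<bullet>) m g \<and>
    (\<Sum>k<K. real_basis k \<bullet> op_powr (op_powr (compression K (gram z)) (1 / 2)) p (real_basis k)) =
    (\<Sum>i<m. norm (z (g i)) powr p)"
proof -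
  define A where "A = compression K (gram z)"
  define B where "B = op_powr A (1 / 2)"
  define C where "C = op_powr B p"
  have A: "psd A" unfolding A_def by (intro psd_compression gram z)
  have B: "psd B" unfolding B_def by (intro psd_powr A) simp
  define V where "V = {v. trunc K v = v}"
  have "A v \<in> V" for v by (simp add: V_def A_def trunc_trunc)
  then obtain m g where g: "\<And>i. i < m \<Longrightarrow> g i \<in> V" "\<And>i. i < m \<Longrightarrow> A (g i) = (g i \<bullet> A (g i)) *\<^sub>R g i"
    and on: "orthonormal_upto (\<bullet>) m g" and expand: "\<And>v. v \<in> V \<Longrightarrow> v = (\<Sum>i<m. (g i \<bullet> v) *\<^sub>R g i)"
    using finite_dim_eigenbasis[OF _ V_def, of A] A unfolding psd_def by blast
  have C_g: "C (g i) = norm (z (g i)) powr p *\<^sub>R g i" if i: "i < m" for i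
  proof -
    have ng: "norm (g i) = 1" by (rule orthonormal_upto_norm[OF on i])
    have mu: "g i \<bullet> A (g i) = (norm (z (g i)))\<^sup>2"
      using g(1)[OF i] gram(3)[OF z, of "g i"] inner_trunc[of K "g i" "gram z (g i)"] by (simp add: A_def V_def)
    have "(norm (z (g i)))\<^sup>2 \<le> norm A"
      using inner_blinfun_le[of "g i" A] mu ng by simp
    then have "B (g i) = ((norm (z (g i)))\<^sup>2) powr (1 / 2) *\<^sub>R g i"
      unfolding B_def op_powr_def
      by (intro fun_calculus_eigenvector[OF A continuous_on_powr_nonneg]) (use g(2)[OF i] mu in auto)
    then have Bg: "B (g i) = norm (z (g i)) *\<^sub>R g i"
      by (simp add: powr_half_sqrt)
    have "norm (z (g i)) \<le> norm B"
      using norm_blinfun[of B "g i"] Bg ng by simp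
    then show ?thesis
      unfolding C_def op_powr_def
      by (intro fun_calculus_eigenvector[OF B continuous_on_powr_nonneg[OF p] Bg]) auto
  qed
  have "real_basis k \<bullet> C (real_basis k) = (\<Sum>i<m. norm (z (g i)) powr p * (real_basis k \<bullet> g i)\<^sup>2)" if "k < K" for k
  proof -
    have "real_basis k \<in> V" using that by (simp add: V_def trunc_real_basis)
    then have "C (real_basis k) = C (\<Sum>i<m. (g i \<bullet> real_basis k) *\<^sub>R g i)"
      using expand by metis
    also have "\<dots> = (\<Sum>i<m. (g i \<bullet> real_basis k) *\<^sub>R (norm (z (g i)) powr p *\<^sub>R g i))"
      by (simp add: blinfun.sum_right blinfun.scaleR_right C_g)
    finally show ?thesis
      by (simp add: inner_sum_right power2_eq_square inner_commute mult_ac)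
  qed
  then have "(\<Sum>k<K. real_basis k \<bullet> C (real_basis k)) = (\<Sum>i<m. \<Sum>k<K. norm (z (g i)) powr p * (real_basis k \<bullet> g i)\<^sup>2)"
    by (subst sum.swap) simp
  also have "\<dots> = (\<Sum>i<m. norm (z (g i)) powr p)"
  proof (rule sum.cong[OF refl])
    fix i assume "i \<in> {..<m}"
    then have i: "i < m" by simp
    have "(norm (g i))\<^sup>2 = (\<Sum>k<K. (real_basis k \<bullet> g i)\<^sup>2)"
      using norm_diff_orthonormal[OF orthonormal_upto_real_basis, of "g i" K] g(1)[OF i]
      unfolding trunc_def[symmetric] by (simp add: V_def)
    then have "(\<Sum>k<K. (real_basis k \<bullet> g i)\<^sup>2) = 1"
      using orthonormal_upto_norm[OF on i] by simp
    then show "(\<Sum>k<K. norm (z (g i)) powr p * (real_basis k \<bullet> g i)\<^sup>2) = norm (z (g i)) powr p"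
      by (simp flip: sum_distrib_left)
  qed
  finally show ?thesis
    using on unfolding C_def B_def A_def by blast
qed

text \<open>Two functional calculi are nested, since the absolute value is itself a square root. The
  square roots need a common norm bound before the outer power can pass to the limit.\<close>

lemma compressed_powr_tendsto:
  assumes z: "complex_linear z" and p: "p > 0"
  shows "(\<lambda>K. op_powr (op_powr (compression K (gram z)) (1 / 2)) p v) \<longlonglongrightarrow> abs_powr z p v"
proof -
  define A where "A = gram z"
  have A: "psd A" "\<And>K. psd (compression K A)" unfolding A_def by (intro psd_compression gram z)+
  have half: "psd (op_powr D (1 / 2))" "norm (op_powr D (1 / 2)) \<le> norm A powr (1 / 2)"
    if D: "psd D" "norm D \<le> norm A" for D
  proof -
    show "psd (op_powr D (1 / 2))" by (intro psd_powr D) simp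
    show "norm (op_powr D (1 / 2)) \<le> norm A powr (1 / 2)"
      unfolding op_powr_def
    proof (rule norm_fun_calculus_le[OF D(1) continuous_on_powr_nonneg])
      show "\<bar>t powr (1 / 2)\<bar> \<le> norm A powr (1 / 2)" if "0 \<le> t" "t \<le> norm D" for t
        using powr_mono2[of "1 / 2" t "norm A"] that D(2) by simp
    qed simp
  qed
  have "(\<lambda>K. op_powr (compression K A) (1 / 2) w) \<longlonglongrightarrow> op_powr A (1 / 2) w" for w
    unfolding op_powr_def
    by (rule fun_calculus_strong_limit[OF A(2,1) norm_compression_le order_refl compression_tendsto continuous_on_powr_nonneg]) simp
  then show ?thesis
    unfolding op_powr_def[of _ p] op_abs_eq A_def[symmetric]
    by (intro fun_calculus_strong_limit[where M = "norm A powr (1 / 2)"] half A norm_compression_le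
        order_refl continuous_on_powr_nonneg p)
qed

text \<open>In an eigenbasis g of the compression of \<open>gram (x + y)\<close> the trace becomes a
  sum of p-th powers of the norms of (x + y) g_i, which Minkowski and
  \<open>sum_norm_powr_le\<close> bound independently of K. Partial sums of fixed length survive the
  limit in K. The strict inequalities make \<open>\<alpha>\<close> and \<open>\<beta>\<close>
  positive even if a norm vanishes.\<close>

lemma schatten_add_aux:
  assumes x: "x \<in> schatten_class p" and y: "y \<in> schatten_class p" and p: "p > 2"
    and \<alpha>: "\<alpha> > schatten_norm p x" and \<beta>: "\<beta> > schatten_norm p y"
  shows "(\<Sum>n<N. diag (abs_powr (x + y) p) n) \<le> (\<alpha> + \<beta>) powr p"
proof -
  have p0: "p > 0" using p by simp
  have cl: "complex_linear x" "complex_linear y" "complex_linear (x + y)"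
    using x y complex_linear_add by (auto simp: schatten_class_def)
  note nonneg = schatten_class_iff(3)[OF cl(1) p0] schatten_class_iff(3)[OF cl(2) p0]
  define C where "C K = op_powr (op_powr (compression K (gram (x + y))) (1 / 2)) p" for K
  have psdC: "psd (C K)" for K
    unfolding C_def by (intro psd_powr psd_compression gram cl p0) simp
  have bound: "(\<Sum>k<K. real_basis k \<bullet> C K (real_basis k)) \<le> 2 * (\<alpha> + \<beta>) powr p" for K
  proof -
    obtain m g where g: "orthonormal_upto (\<bullet>) m g" "(\<Sum>k<K. real_basis k \<bullet> C K (real_basis k)) = (\<Sum>i<m. norm ((x + y) (g i)) powr p)"
      using trace_compression[OF cl(3) p0, of K] unfolding C_def by blast
    have "(\<Sum>i<m. norm ((x + y) (g i)) powr p) \<le> (\<Sum>i<m. (norm (x (g i)) + norm (y (g i))) powr p)"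
      using p by (intro sum_mono powr_mono2) (auto simp: blinfun.add_left norm_triangle_ineq)
    also have "\<dots> \<le> 2 * (\<alpha> + \<beta>) powr p"
    proof (rule Minkowski_sum)
      have "2 * schatten_norm p x powr p \<le> 2 * \<alpha> powr p" "2 * schatten_norm p y powr p \<le> 2 * \<beta> powr p"
        using \<alpha> \<beta> p nonneg by (auto intro!: powr_mono2)
      then show "(\<Sum>i<m. norm (x (g i)) powr p) \<le> 2 * \<alpha> powr p" "(\<Sum>i<m. norm (y (g i)) powr p) \<le> 2 * \<beta> powr p"
        using sum_norm_powr_le[OF x p g(1)] sum_norm_powr_le[OF y p g(1)] by linarith+
    qed (use p \<alpha> \<beta> nonneg in auto)
    finally show ?thesis using g(2) by simp
  qed
  have "(\<Sum>k<2*N. real_basis k \<bullet> abs_powr (x + y) p (real_basis k)) \<le> 2 * (\<alpha> + \<beta>) powr p"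
  proof (rule LIMSEQ_le_const2)
    show "(\<lambda>K. \<Sum>k<2*N. real_basis k \<bullet> C K (real_basis k)) \<longlonglongrightarrow> (\<Sum>k<2*N. real_basis k \<bullet> abs_powr (x + y) p (real_basis k))"
      unfolding C_def by (intro tendsto_intros compressed_powr_tendsto cl p0)
    have "(\<Sum>k<2*N. real_basis k \<bullet> C K (real_basis k)) \<le> 2 * (\<alpha> + \<beta>) powr p" if "K \<ge> 2 * N" for K
    proof -
      have "(\<Sum>k<2*N. real_basis k \<bullet> C K (real_basis k)) \<le> (\<Sum>k<K. real_basis k \<bullet> C K (real_basis k))"
        using that psdC by (intro sum_mono2) (auto simp: psd_def)
      then show ?thesis using bound[of K] by simp
    qed
    then show "\<exists>N'. \<forall>K\<ge>N'. (\<Sum>k<2*N. real_basis k \<bullet> C K (real_basis k)) \<le> 2 * (\<alpha> + \<beta>) powr p" by blast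
  qed
  moreover have "complex_linear (abs_powr (x + y) p)"
    by (intro complex_linear_powr op_abs cl p0)
  ultimately show ?thesis
    by (simp add: real_trace_partial)
qed

lemma schatten_norm_le:
  assumes x: "complex_linear x" and p: "p > 0" and t: "t \<ge> 0" and le: "\<And>N. (\<Sum>n<N. diag (abs_powr x p) n) \<le> t powr p"
  shows "x \<in> schatten_class p" "schatten_norm p x \<le> t"
proof -
  have nonneg: "0 \<le> diag (abs_powr x p) n" for n using psd_abs_powr[OF x p] by (simp add: psd_def)
  have s: "summable (diag (abs_powr x p))"
    by (rule summableI_nonneg_bounded[OF nonneg le])
  then show cl: "x \<in> schatten_class p" using schatten_class_iff(1)[OF x p] by simp
  have "schatten_norm p x powr p \<le> t powr p"
    unfolding schatten_class_iff(2)[OF x p cl] by (rule suminf_le_const[OF s le])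
  then show "schatten_norm p x \<le> t"
    using powr_le_cancel2[OF p t] by blast
qed

lemma schatten_add:
  assumes x: "x \<in> schatten_class p" and y: "y \<in> schatten_class p" and p: "p > 2"
  shows "x + y \<in> schatten_class p" "schatten_norm p (x + y) \<le> schatten_norm p x + schatten_norm p y"
proof -
  have p0: "p > 0" using p by simp
  have cl: "complex_linear x" "complex_linear y" "complex_linear (x + y)"
    using x y complex_linear_add by (auto simp: schatten_class_def)
  note nonneg = schatten_class_iff(3)[OF cl(1) p0] schatten_class_iff(3)[OF cl(2) p0]
  have *: "x + y \<in> schatten_class p \<and> schatten_norm p (x + y) \<le> (schatten_norm p x + e) + (schatten_norm p y + e)" if "e > 0" for e
  proof -
    have T: "0 \<le> (schatten_norm p x + e) + (schatten_norm p y + e)"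
      using that nonneg by simp
    have "schatten_norm p x < schatten_norm p x + e" "schatten_norm p y < schatten_norm p y + e"
      using that by simp_all
    note le = schatten_add_aux[OF x y p this]
    show ?thesis
      using schatten_norm_le[OF cl(3) p0 T le] by blast
  qed
  then show "x + y \<in> schatten_class p" by (meson zero_less_one)
  show "schatten_norm p (x + y) \<le> schatten_norm p x + schatten_norm p y"
  proof (rule field_le_epsilon)
    fix e :: real assume "e > 0"
    then show "schatten_norm p (x + y) \<le> schatten_norm p x + schatten_norm p y + e"
      using *[of "e / 2"] by simp
  qed
qed

text \<open>Class and norm depend on x through its Gram operator alone. This yields invariance under
  a change of sign and, for unitary u, under passing from u - 1 to its adjoint.\<close>

lemma schatten_gram_cong:
  assumes "gram x = gram y" "complex_linear x" "complex_linear y"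
  shows "x \<in> schatten_class p \<longleftrightarrow> y \<in> schatten_class p" "schatten_norm p x = schatten_norm p y"
proof -
  have "op_abs x = op_abs y" by (simp add: op_abs_eq assms)
  then show "x \<in> schatten_class p \<longleftrightarrow> y \<in> schatten_class p" "schatten_norm p x = schatten_norm p y"
    using assms by (simp_all add: schatten_class_def schatten_norm_def)
qed

lemma op_adjoint_unique:
  assumes "complex_linear A" "\<And>x y. A x \<bullet> y = x \<bullet> blinfun_apply B y"
  shows "op_adjoint A = B"
proof (rule blinfun_eqI)
  fix y show "op_adjoint A y = B y"
    by (rule vector_eq_ldot[THEN iffD1]) (simp add: op_adjoint(1)[OF assms(1), symmetric] assms(2))
qed

lemma schatten_minus:
  assumes "complex_linear x"
  shows "- x \<in> schatten_class p \<longleftrightarrow> x \<in> schatten_class p" "schatten_norm p (- x) = schatten_norm p x"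
proof -
  have "op_adjoint (- x) = - op_adjoint x"
    by (intro op_adjoint_unique complex_linear_minus assms) (simp add: blinfun.minus_left op_adjoint(1)[OF assms])
  then have "gram (- x) = gram x"
    unfolding gram_def by (intro blinfun_eqI) (simp add: blinfun.minus_left blinfun.minus_right)
  then show "- x \<in> schatten_class p \<longleftrightarrow> x \<in> schatten_class p" "schatten_norm p (- x) = schatten_norm p x"
    using schatten_gram_cong assms complex_linear_minus by blast+
qed

lemma schatten_zero: "p > 0 \<Longrightarrow> schatten_norm p 0 = 0"
proof -
  assume p: "p > 0"
  have cl: "complex_linear 0" using complex_linear_diff[OF complex_linear_id complex_linear_id] by simp
  have "abs_powr 0 p (basis_vec n) = 0 powr p *\<^sub>R basis_vec n" for n
    unfolding op_powr_def
    by (rule fun_calculus_eigenvector[OF op_abs(1)[OF cl] continuous_on_powr_nonneg[OF p]])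
      (use op_abs(3)[OF cl, of "basis_vec n"] in auto)
  then show ?thesis
    using schatten_norm_le(2)[OF cl p, of 0] schatten_class_iff(3)[OF cl p] by simp
qed

lemma unitary_complex_linear: "unitary u \<Longrightarrow> complex_linear u"
  by (simp add: unitary_def)

lemma carrier_schatten_diff:
  assumes "p > 2" "u \<in> carrier (schatten_unitary_group p)" "v \<in> carrier (schatten_unitary_group p)"
  shows "u - v \<in> schatten_class p"
proof -
  have *: "u - id_blinfun \<in> schatten_class p" "v - id_blinfun \<in> schatten_class p" "complex_linear (v - id_blinfun)"
    using assms complex_linear_diff[OF unitary_complex_linear complex_linear_id] by (auto simp: schatten_unitary_group_def)
  have "- (v - id_blinfun) \<in> schatten_class p"
    using * schatten_minus(1)[OF *(3)] by blast
  from schatten_add(1)[OF *(1) this assms(1)] show ?thesis by simp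
qed

lemma Metric_space_schatten:
  assumes p: "p > 2"
  shows "Metric_space (carrier (schatten_unitary_group p)) (\<lambda>u v. schatten_norm p (u - v))"
proof
  fix x y
  show "0 \<le> schatten_norm p (x - y)" by (simp add: schatten_norm_def)
  show "schatten_norm p (x - y) = schatten_norm p (y - x)"
  proof (cases "complex_linear (x - y)")
    case True
    then show ?thesis using schatten_minus(2)[of "x - y" p] by simp
  next
    \<comment> \<open>Outside the complex-linear operators both sides have the default value
      0.\<close>
    case False
    then have "\<not> complex_linear (y - x)" using complex_linear_minus[of "y - x"] by auto
    then show ?thesis using False by (simp add: schatten_norm_def schatten_class_def)
  qed
next
  fix x y assume "x \<in> carrier (schatten_unitary_group p)" "y \<in> carrier (schatten_unitary_group p)"
  then have "norm (x - y) \<le> 2 * schatten_norm p (x - y)"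
    using carrier_schatten_diff norm_le_schatten p by blast
  then show "schatten_norm p (x - y) = 0 \<longleftrightarrow> x = y"
    using schatten_zero[of p] p by auto
next
  fix x y z assume "x \<in> carrier (schatten_unitary_group p)" "y \<in> carrier (schatten_unitary_group p)" "z \<in> carrier (schatten_unitary_group p)"
  then show "schatten_norm p (x - z) \<le> schatten_norm p (x - y) + schatten_norm p (y - z)"
    using schatten_add(2)[OF carrier_schatten_diff carrier_schatten_diff p, OF p _ _ p, of x y y z] by simp
qed

text \<open>|x|^p vanishes on the orthogonal complement of the span of f and is self-adjoint, so its
  form sees only the component in this span. Its norm is at most the p-th power of the norm of x,
  and its trace at most k times that.\<close>

lemma schatten_finite_support:
  assumes x: "complex_linear x" and p: "p > 0" and f: "orthonormal_upto (\<bullet>) k f"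
    and zero: "\<And>v. (\<And>j. j < k \<Longrightarrow> f j \<bullet> v = 0) \<Longrightarrow> x v = 0"
  shows "x \<in> schatten_class p" "schatten_norm p x \<le> real k powr (1 / p) * norm x"
proof -
  define B C where "B = op_abs x" and "C = abs_powr x p"
  have B: "psd B" "\<And>v. norm (B v) = norm (x v)" using op_abs[OF x] by (simp_all add: B_def)
  have C: "psd C" using psd_abs_powr[OF x p] by (simp add: C_def)
  have C0: "C v = 0" if "\<And>j. j < k \<Longrightarrow> f j \<bullet> v = 0" for v
  proof -
    have "B v = 0 *\<^sub>R v" using B(2)[of v] zero[OF that] by simp
    then have "C v = 0 powr p *\<^sub>R v"
      unfolding C_def op_powr_def B_def[symmetric]
      by (intro fun_calculus_eigenvector[OF B(1) continuous_on_powr_nonneg[OF p]]) auto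
    then show ?thesis by simp
  qed
  have "norm B \<le> norm x"
    by (rule norm_blinfun_bound) (simp_all add: B(2) norm_blinfun)
  have nC: "norm C \<le> norm x powr p"
    unfolding C_def op_powr_def B_def[symmetric]
  proof (rule norm_fun_calculus_le[OF B(1) continuous_on_powr_nonneg[OF p]])
    fix t assume "0 \<le> t" "t \<le> norm B"
    then show "\<bar>t powr p\<bar> \<le> norm x powr p"
      using powr_mono2[of p t "norm x"] \<open>norm B \<le> norm x\<close> p by simp
  qed
  have e: "e \<bullet> C e \<le> norm x powr p * (\<Sum>j<k. (f j \<bullet> e)\<^sup>2)" for e
  proof -
    define q where "q = (\<Sum>j<k. (f j \<bullet> e) *\<^sub>R f j)"
    have fq: "f i \<bullet> q = f i \<bullet> e" if "i < k" for i
      unfolding q_def by (rule inner_orthonormal_sum[OF f that])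
    then have "C (e - q) = 0" by (intro C0) (simp add: inner_diff_right)
    then have Ce: "C e = C q" by (simp add: blinfun.diff_right)
    have sym: "C a \<bullet> b = a \<bullet> C b" for a b using C by (simp add: psd_def selfadj_def)
    have "e \<bullet> C e = q \<bullet> C q" by (metis Ce sym)
    also have "\<dots> \<le> norm C * (norm q)\<^sup>2" using inner_blinfun_le[of q C] by simp
    also have "\<dots> \<le> norm x powr p * (norm q)\<^sup>2" using nC by (rule mult_right_mono) simp
    also have "(norm q)\<^sup>2 = (\<Sum>j<k. (f j \<bullet> e)\<^sup>2)"
      unfolding q_def by (rule norm_orthonormal_sum[OF f])
    finally show ?thesis .
  qed
  have on: "orthonormal_upto (\<bullet>) N basis_vec" for N
    by (auto simp: orthonormal_upto_def inner_basis_vec coord_basis_vec)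
  have "(\<Sum>n<N. diag C n) \<le> (real k powr (1 / p) * norm x) powr p" for N
  proof -
    have "(\<Sum>n<N. diag C n) \<le> (\<Sum>n<N. norm x powr p * (\<Sum>j<k. (f j \<bullet> basis_vec n)\<^sup>2))"
      by (intro sum_mono e)
    also have "\<dots> = norm x powr p * (\<Sum>j<k. \<Sum>n<N. (basis_vec n \<bullet> f j)\<^sup>2)"
      by (subst sum.swap) (simp add: sum_distrib_left inner_commute)
    also have "\<dots> \<le> norm x powr p * (\<Sum>j<k. (norm (f j))\<^sup>2)"
      by (intro mult_left_mono sum_mono Bessel on) auto
    also have "\<dots> = norm x powr p * real k"
      using orthonormal_upto_norm[OF f] by simp
    also have "\<dots> = (real k powr (1 / p) * norm x) powr p"
      using p by (simp add: powr_mult powr_powr)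
    finally show ?thesis .
  qed
  then show "x \<in> schatten_class p" "schatten_norm p x \<le> real k powr (1 / p) * norm x"
    using schatten_norm_le[OF x p, of "real k powr (1 / p) * norm x"] by (auto simp: C_def)
qed

section \<open>Hilbert sums\<close>

definition hilbert_sum :: "(nat \<Rightarrow> 'a::real_inner) hilbert"
  where "hilbert_sum =
    \<lparr>carrier = {x. summable (\<lambda>n. (norm (x n))\<^sup>2)}, mult = (\<lambda>x y. x), one = (\<lambda>_. 0), zero = (\<lambda>_. 0),
     add = (\<lambda>x y n. x n + y n), smult = (\<lambda>r x n. r *\<^sub>R x n), hinner = (\<lambda>x y. \<Sum>n. x n \<bullet> y n)\<rparr>"

lemma hilbert_sum_simps:
  "x \<in> carrier hilbert_sum \<longleftrightarrow> summable (\<lambda>n. (norm (x n))\<^sup>2)" "zero hilbert_sum = (\<lambda>_. 0)"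
  "x \<oplus>\<^bsub>hilbert_sum\<^esub> y = (\<lambda>n. x n + y n)" "r \<odot>\<^bsub>hilbert_sum\<^esub> x = (\<lambda>n. r *\<^sub>R x n)"
  "hinner hilbert_sum x y = (\<Sum>n. x n \<bullet> y n)"
  by (simp_all add: hilbert_sum_def)

lemma norm_add_square_le: "(norm (x + y))\<^sup>2 \<le> 2 * (norm x)\<^sup>2 + 2 * (norm (y :: 'a::real_normed_vector))\<^sup>2"
proof -
  have "(norm (x + y))\<^sup>2 \<le> (norm x + norm y)\<^sup>2"
    by (intro power_mono norm_triangle_ineq) simp
  also have "\<dots> \<le> 2 * (norm x)\<^sup>2 + 2 * (norm y)\<^sup>2"
    using sum_squares_bound[of "norm x" "norm y"] by (simp add: power2_sum)
  finally show ?thesis .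
qed

lemma hilbert_sum_add_closed:
  "x \<in> carrier hilbert_sum \<Longrightarrow> y \<in> carrier hilbert_sum \<Longrightarrow> (\<lambda>n. x n + y n) \<in> carrier hilbert_sum"
  unfolding hilbert_sum_simps
  by (rule summable_comparison_test'[where g = "\<lambda>n. 2 * (norm (x n))\<^sup>2 + 2 * (norm (y n))\<^sup>2" and N = 0])
    (auto intro: summable_add summable_mult norm_add_square_le)

lemma hilbert_sum_scale_closed:
  "x \<in> carrier hilbert_sum \<Longrightarrow> (\<lambda>n. r *\<^sub>R x n) \<in> carrier hilbert_sum"
  unfolding hilbert_sum_simps by (simp add: power_mult_distrib summable_mult)

lemma hilbert_sum_diff_closed:
  "x \<in> carrier hilbert_sum \<Longrightarrow> y \<in> carrier hilbert_sum \<Longrightarrow> (\<lambda>n. x n - y n) \<in> carrier hilbert_sum"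
  using hilbert_sum_add_closed[of x "\<lambda>n. (-1) *\<^sub>R y n"] hilbert_sum_scale_closed[of y "-1"] by simp

lemma hilbert_sum_summable_inner:
  assumes "x \<in> carrier hilbert_sum" "y \<in> carrier hilbert_sum"
  shows "summable (\<lambda>n. x n \<bullet> y n)"
proof (rule summable_comparison_test'[where N = 0])
  show "summable (\<lambda>n. (norm (x n))\<^sup>2 + (norm (y n))\<^sup>2)"
    using assms by (intro summable_add) (auto simp: hilbert_sum_simps)
  fix n
  have "\<bar>x n \<bullet> y n\<bar> \<le> norm (x n) * norm (y n)" by (rule Cauchy_Schwarz_ineq2)
  also have "\<dots> \<le> (norm (x n))\<^sup>2 + (norm (y n))\<^sup>2"
    using sum_squares_bound[of "norm (x n)" "norm (y n)"] mult_nonneg_nonneg[OF norm_ge_zero norm_ge_zero, of "x n" "y n"] by linarith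
  finally show "norm (x n \<bullet> y n) \<le> (norm (x n))\<^sup>2 + (norm (y n))\<^sup>2" by simp
qed

lemma real_inner_product_space_hilbert_sum:
  "real_inner_product_space (hilbert_sum :: (nat \<Rightarrow> 'a::real_inner) hilbert)"
proof -
  let ?H = "hilbert_sum :: (nat \<Rightarrow> 'a::real_inner) hilbert"
  have ab: "abelian_group ?H"
  proof (rule abelian_groupI)
    fix x assume "x \<in> carrier ?H"
    then show "\<exists>y\<in>carrier ?H. y \<oplus>\<^bsub>?H\<^esub> x = \<zero>\<^bsub>?H\<^esub>"
      using hilbert_sum_scale_closed[of x "- 1"]
      by (intro bexI[of _ "\<lambda>n. (- 1) *\<^sub>R x n"]) (simp_all add: hilbert_sum_simps(2-))
  qed (use hilbert_sum_add_closed in \<open>auto simp: hilbert_sum_simps(2-) algebra_simps\<close>, simp add: hilbert_sum_simps)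
  have cr: "cring real_ring"
  proof (rule cringI)
    show "abelian_group real_ring"
      by (rule abelian_groupI) (auto intro: exI[of _ "- _"] simp: algebra_simps intro!: exI[of _ "- _"])
    show "comm_monoid real_ring" by (rule comm_monoidI) (auto simp: algebra_simps)
  qed (simp add: algebra_simps)
  have "module real_ring ?H"
    by (rule moduleI[OF cr ab])
      (use hilbert_sum_scale_closed in \<open>auto simp: hilbert_sum_simps(2-) algebra_simps\<close>)
  then interpret module real_ring ?H .
  show ?thesis
  proof
    fix x y z :: "nat \<Rightarrow> 'a" and r :: real
    assume x: "x \<in> carrier ?H"
    show "0 \<le> hinner ?H x x"
      unfolding hilbert_sum_simps by (intro suminf_nonneg hilbert_sum_summable_inner x) simp
    show "x = \<zero>\<^bsub>?H\<^esub>" if "hinner ?H x x = 0"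
      using that suminf_eq_zero_iff[OF hilbert_sum_summable_inner[OF x x]] by (simp add: hilbert_sum_simps fun_eq_iff)
    assume y: "y \<in> carrier ?H"
    show "hinner ?H x y = hinner ?H y x" by (simp add: hilbert_sum_simps inner_commute)
    show "hinner ?H (r \<odot>\<^bsub>?H\<^esub> x) y = r * hinner ?H x y"
      using suminf_mult[OF hilbert_sum_summable_inner[OF x y], of r] by (simp add: hilbert_sum_simps(2-))
    assume z: "z \<in> carrier ?H"
    show "hinner ?H (x \<oplus>\<^bsub>?H\<^esub> y) z = hinner ?H x z + hinner ?H y z"
      using suminf_add[OF hilbert_sum_summable_inner[OF x z] hilbert_sum_summable_inner[OF y z]]
      by (simp add: hilbert_sum_simps(2-) inner_add_left)
  qed
qed

lemma hilbert_sum_minus: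
  fixes x y :: "nat \<Rightarrow> 'a::real_inner"
  assumes "x \<in> carrier hilbert_sum" "y \<in> carrier hilbert_sum"
  shows "x \<ominus>\<^bsub>hilbert_sum\<^esub> y = (\<lambda>n. x n - y n)"
proof -
  interpret real_inner_product_space "hilbert_sum :: (nat \<Rightarrow> 'a) hilbert"
    by (rule real_inner_product_space_hilbert_sum)
  have "\<ominus>\<^bsub>hilbert_sum\<^esub> y = (\<lambda>n. (- 1) *\<^sub>R y n)"
    using assms hilbert_sum_scale_closed[of y "- 1"]
    by (intro M.minus_equality) (simp_all add: hilbert_sum_simps(2-))
  then show ?thesis
    by (simp add: a_minus_def hilbert_sum_simps)
qed

lemma hdist_hilbert_sum:
  fixes x y :: "nat \<Rightarrow> 'a::real_inner"
  assumes "x \<in> carrier hilbert_sum" "y \<in> carrier hilbert_sum"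
  shows "hdist hilbert_sum x y = sqrt (\<Sum>n. (norm (x n - y n))\<^sup>2)"
  using assms by (simp add: hdist_def hilbert_sum_minus hilbert_sum_simps(5) power2_norm_eq_inner)

lemma hdist_hilbert_sum_le:
  fixes x y :: "nat \<Rightarrow> 'a::real_inner"
  assumes "x \<in> carrier hilbert_sum" "y \<in> carrier hilbert_sum" "t \<ge> 0" and "\<And>N. (\<Sum>n<N. (norm (x n - y n))\<^sup>2) \<le> t\<^sup>2"
  shows "hdist hilbert_sum x y \<le> t"
proof -
  have "summable (\<lambda>n. (norm (x n - y n))\<^sup>2)"
    using hilbert_sum_diff_closed[OF assms(1,2)] by (simp add: hilbert_sum_simps)
  then have "(\<Sum>n. (norm (x n - y n))\<^sup>2) \<le> t\<^sup>2"
    using assms(4) by (rule suminf_le_const)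
  then show ?thesis
    unfolding hdist_hilbert_sum[OF assms(1,2)] using assms(3) by (simp add: real_le_lsqrt)
qed

lemma hdist_hilbert_sum_ge:
  fixes x y :: "nat \<Rightarrow> 'a::real_inner"
  assumes "x \<in> carrier hilbert_sum" "y \<in> carrier hilbert_sum"
  shows "(\<Sum>n<N. (norm (x n - y n))\<^sup>2) \<le> (hdist hilbert_sum x y)\<^sup>2"
proof -
  have s: "summable (\<lambda>n. (norm (x n - y n))\<^sup>2)"
    using hilbert_sum_diff_closed[OF assms(1,2)] by (simp add: hilbert_sum_simps)
  then show ?thesis
    by (simp add: hdist_hilbert_sum[OF assms] suminf_nonneg sum_le_suminf)
qed

text \<open>The coordinates converge, and the Cauchy bound for a partial sum of fixed length passes
  to their limits; only then is the length allowed to grow.\<close>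

lemma real_hilbert_space_hilbert_sum:
  "real_hilbert_space (hilbert_sum :: (nat \<Rightarrow> 'a::{real_inner, complete_space}) hilbert)"
proof -
  let ?H = "hilbert_sum :: (nat \<Rightarrow> 'a) hilbert"
  interpret real_inner_product_space ?H by (rule real_inner_product_space_hilbert_sum)
  interpret HM: Metric_space "carrier ?H" "hdist ?H" by (rule metric_space)
  show ?thesis
  proof
    show "HM.mcomplete"
      unfolding HM.mcomplete_def
    proof (intro allI impI)
      fix \<sigma> assume \<sigma>: "HM.MCauchy \<sigma>"
      then have c: "\<sigma> k \<in> carrier ?H" for k by (auto simp: HM.MCauchy_def)
      have C: "\<exists>M. \<forall>k\<ge>M. \<forall>l\<ge>M. hdist ?H (\<sigma> k) (\<sigma> l) < e" if "e > 0" for e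
        using \<sigma> that by (auto simp: HM.MCauchy_def)
      have coord: "norm (x n - y n) \<le> hdist ?H x y" if "x \<in> carrier ?H" "y \<in> carrier ?H" for x y n
      proof -
        have "(norm (x n - y n))\<^sup>2 \<le> (\<Sum>k<Suc n. (norm (x k - y k))\<^sup>2)" by (simp add: sum_nonneg)
        also have "\<dots> \<le> (hdist ?H x y)\<^sup>2" by (rule hdist_hilbert_sum_ge[OF that])
        finally show ?thesis by (rule power2_le_imp_le) simp
      qed
      have "Cauchy (\<lambda>k. \<sigma> k n)" for n
      proof (rule metric_CauchyI)
        fix e :: real assume "e > 0"
        then obtain M where M: "\<And>k l. k \<ge> M \<Longrightarrow> l \<ge> M \<Longrightarrow> hdist ?H (\<sigma> k) (\<sigma> l) < e" using C by blast
        then show "\<exists>M. \<forall>k\<ge>M. \<forall>l\<ge>M. dist (\<sigma> k n) (\<sigma> l n) < e"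
          using coord[OF c c] by (metis dist_norm le_less_trans)
      qed
      then have "\<exists>a. (\<lambda>k. \<sigma> k n) \<longlonglongrightarrow> a" for n
        by (simp add: Cauchy_convergent_iff convergent_def)
      then obtain a where a: "\<And>n. (\<lambda>k. \<sigma> k n) \<longlonglongrightarrow> a n" by metis
      have bound: "\<exists>M. \<forall>l\<ge>M. \<forall>N. (\<Sum>n<N. (norm (a n - \<sigma> l n))\<^sup>2) \<le> e\<^sup>2" if e: "0 < e" for e
      proof -
        obtain M where M: "\<And>k l. k \<ge> M \<Longrightarrow> l \<ge> M \<Longrightarrow> hdist ?H (\<sigma> k) (\<sigma> l) < e" using C[OF e] by blast
        have "(\<Sum>n<N. (norm (a n - \<sigma> l n))\<^sup>2) \<le> e\<^sup>2" if l: "l \<ge> M" for l N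
        proof (rule LIMSEQ_le_const2)
          show "(\<lambda>k. \<Sum>n<N. (norm (\<sigma> k n - \<sigma> l n))\<^sup>2) \<longlonglongrightarrow> (\<Sum>n<N. (norm (a n - \<sigma> l n))\<^sup>2)"
            by (intro tendsto_intros a)
          have "(\<Sum>n<N. (norm (\<sigma> k n - \<sigma> l n))\<^sup>2) \<le> e\<^sup>2" if k: "k \<ge> M" for k
          proof -
            have "(hdist ?H (\<sigma> k) (\<sigma> l))\<^sup>2 \<le> e\<^sup>2"
              using M[OF k l] by (intro power_mono) auto
            then show ?thesis using hdist_hilbert_sum_ge[OF c c, where N = N] order_trans by blast
          qed
          then show "\<exists>K. \<forall>k\<ge>K. (\<Sum>n<N. (norm (\<sigma> k n - \<sigma> l n))\<^sup>2) \<le> e\<^sup>2" by blast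
        qed
        then show ?thesis by blast
      qed
      obtain l where l: "\<And>N. (\<Sum>n<N. (norm (a n - \<sigma> l n))\<^sup>2) \<le> 1\<^sup>2" using bound[of 1] by auto
      have "(\<lambda>n. a n - \<sigma> l n) \<in> carrier ?H"
        unfolding hilbert_sum_simps by (rule summableI_nonneg_bounded[OF _ l]) simp
      then have ac: "a \<in> carrier ?H"
        using hilbert_sum_add_closed[OF _ c[of l], of "\<lambda>n. a n - \<sigma> l n"] by simp
      have "limitin HM.mtopology \<sigma> a sequentially"
        unfolding HM.limit_metric_sequentially
      proof (intro conjI allI impI ac)
        fix e :: real assume e: "e > 0"
        then obtain M where M: "\<And>l N. l \<ge> M \<Longrightarrow> (\<Sum>n<N. (norm (a n - \<sigma> l n))\<^sup>2) \<le> (e / 2)\<^sup>2"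
          using bound[of "e / 2"] by auto
        have "hdist ?H (\<sigma> l) a < e" if "l \<ge> M" for l
        proof -
          have "hdist ?H a (\<sigma> l) \<le> e / 2" using M[OF that] e by (intro hdist_hilbert_sum_le ac c) auto
          then show ?thesis using e by (simp add: HM.commute)
        qed
        then show "\<exists>N. \<forall>n\<ge>N. \<sigma> n \<in> carrier ?H \<and> hdist ?H (\<sigma> n) a < e" using c by blast
      qed
      then show "\<exists>x. limitin HM.mtopology \<sigma> x sequentially" by blast
    qed
  qed
qed

text \<open>Hoelder's inequality in disguise: \<open>1/(n+1)\<close> lies in \<open>\<ell>\<^sup>q\<close> for the exponent \<open>q = p/(p-2) > 1\<close> conjugate to \<open>p/2\<close>.\<close>

lemma schatten_weighted_sum:
  assumes p: "p > 2"
  shows "\<exists>K\<ge>0. \<forall>x\<in>schatten_class p. \<forall>f. (\<forall>N. orthonormal_upto (\<bullet>) N f) \<longrightarrow>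
    (\<forall>N. (\<Sum>n<N. (norm (blinfun_apply x (f n)))\<^sup>2 / Suc n) \<le> K * (schatten_norm p x)\<^sup>2)"
proof -
  define q where "q = p / (p - 2)"
  have q: "q > 1" "2 / (p - 2) + 1 = q" using p by (simp_all add: q_def field_simps)
  have s: "summable (\<lambda>n. real (Suc n) powr (- q))"
    using summable_real_powr_iff[of "- q"] summable_Suc_iff[of "\<lambda>n. real n powr (- q)"] q by simp
  define Z where "Z = (\<Sum>n. real (Suc n) powr (- q))"
  \<comment> \<open>If d^(p - 2) is at least 1 / (n + 1), the first term on the right suffices;
    otherwise d is below (1 / (n + 1))^(1 / (p - 2)) and the second term does.\<close>
  have young: "d\<^sup>2 / Suc n \<le> d powr p + real (Suc n) powr (- q)" if d: "d \<ge> 0" for d :: real and n :: nat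
  proof (cases "d powr (p - 2) \<ge> 1 / Suc n")
    case True
    have "d\<^sup>2 / Suc n \<le> d\<^sup>2 * d powr (p - 2)"
      using mult_left_mono[OF True, of "d\<^sup>2"] by simp
    also have "\<dots> = d powr p"
      using d powr_add[of d 2 "p - 2"] by (cases "d = 0") auto
    finally show ?thesis by (simp add: add_increasing2)
  next
    case False
    have "d = (d powr (p - 2)) powr (1 / (p - 2))"
      using d p by (simp add: powr_powr)
    also have "\<dots> \<le> (1 / Suc n) powr (1 / (p - 2))"
      using False p by (intro powr_mono2) auto
    finally have "d\<^sup>2 \<le> ((1 / Suc n) powr (1 / (p - 2)))\<^sup>2"
      using d by (intro power_mono)
    also have "\<dots> = (1 / Suc n) powr (2 / (p - 2))"
      by (simp add: powr_powr flip: powr_numeral)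
    finally have "d\<^sup>2 / Suc n \<le> (1 / Suc n) powr (2 / (p - 2)) * (1 / Suc n)"
      by (simp add: divide_right_mono)
    also have "\<dots> = (1 / Suc n) powr q"
      using powr_add[of "1 / real (Suc n)" "2 / (p - 2)" 1] by (simp add: q(2))
    also have "\<dots> = real (Suc n) powr (- q)"
      by (simp add: powr_minus powr_divide inverse_eq_divide)
    finally show ?thesis by (simp add: add_increasing)
  qed
  have "(\<Sum>n<N. (norm (blinfun_apply x (f n)))\<^sup>2 / Suc n) \<le> (2 + Z) * (schatten_norm p x)\<^sup>2"
    if x: "x \<in> schatten_class p" and f: "\<And>N. orthonormal_upto (\<bullet>) N f" for x f N
  proof (cases "schatten_norm p x = 0")
    case True
    then have "x = 0" using norm_le_schatten[OF x p] by simp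
    then show ?thesis using True by simp
  next
    case False
    \<comment> \<open>Both sides of the claim scale quadratically in x, while \<open>young\<close>
      does not; after division by the Schatten norm its two terms sum to at most 2 and Z.\<close>
    define \<tau> where "\<tau> = schatten_norm p x"
    have \<tau>: "\<tau> > 0" using False schatten_norm_def by (simp add: \<tau>_def schatten_norm_def split: if_splits)
    have "(norm (x (f n)))\<^sup>2 / Suc n = \<tau>\<^sup>2 * ((norm (x (f n)) / \<tau>)\<^sup>2 / Suc n)" for n
      using \<tau> by (simp add: power_divide)
    then have "(\<Sum>n<N. (norm (x (f n)))\<^sup>2 / Suc n) = \<tau>\<^sup>2 * (\<Sum>n<N. (norm (x (f n)) / \<tau>)\<^sup>2 / Suc n)"
      by (simp add: sum_distrib_left)
    also have "\<dots> \<le> \<tau>\<^sup>2 * (\<Sum>n<N. (norm (x (f n)) / \<tau>) powr p + real (Suc n) powr (- q))"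
      using \<tau> by (intro mult_left_mono sum_mono young) auto
    also have "\<dots> = \<tau>\<^sup>2 * ((\<Sum>n<N. norm (x (f n)) powr p) / \<tau> powr p + (\<Sum>n<N. real (Suc n) powr (- q)))"
      using \<tau> by (simp add: sum.distrib powr_divide sum_divide_distrib)
    also have "\<dots> \<le> \<tau>\<^sup>2 * (2 + Z)"
    proof (intro mult_left_mono add_mono)
      show "(\<Sum>n<N. norm (x (f n)) powr p) / \<tau> powr p \<le> 2"
        using sum_norm_powr_le[OF x p f, of N] \<tau> by (simp add: \<tau>_def divide_le_eq)
      show "(\<Sum>n<N. real (Suc n) powr (- q)) \<le> Z"
        unfolding Z_def by (intro sum_le_suminf s) auto
    qed simp
    finally show ?thesis by (simp add: \<tau>_def mult.commute)
  qed
  moreover have "Z \<ge> 0" unfolding Z_def by (intro suminf_nonneg s) simp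
  ultimately show ?thesis by (intro exI[of _ "2 + Z"]) auto
qed

section \<open>Closed subgroups with property (FH)\<close>

lemma unitary_op_adjoint:
  assumes u: "unitary u"
  shows "op_adjoint (op_adjoint u) = u" "unitary (op_adjoint u)" "norm (u v) = norm v"
proof -
  have cl: "complex_linear u" using u by (simp add: unitary_def)
  show adj: "op_adjoint (op_adjoint u) = u"
    by (intro op_adjoint_unique op_adjoint(2) cl) (metis inner_commute op_adjoint(1)[OF cl])
  then show "unitary (op_adjoint u)"
    using u op_adjoint(2)[OF cl] by (simp add: unitary_def)
  have "op_adjoint u (u v) = v"
    using u unfolding unitary_def by (metis blinfun_apply_blinfun_compose blinfun_apply_id_blinfun)
  then show "norm (u v) = norm v"
    using op_adjoint(1)[OF cl, of v "u v"] by (simp add: norm_eq_sqrt_inner)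
qed

text \<open>Unitarity makes u - 1 normal, so u - 1 and its adjoint have the same Gram
  operator.\<close>

lemma op_adjoint_in_schatten_unitary_group:
  assumes "u \<in> carrier (schatten_unitary_group p)"
  shows "op_adjoint u \<in> carrier (schatten_unitary_group p)"
proof -
  have u: "unitary u" "complex_linear u" "u - id_blinfun \<in> schatten_class p"
    using assms by (auto simp: schatten_unitary_group_def unitary_def)
  have cl: "complex_linear (op_adjoint u)" by (rule op_adjoint(2)[OF u(2)])
  have adj: "op_adjoint (a - id_blinfun) = op_adjoint a - id_blinfun" if "complex_linear a" for a
    by (intro op_adjoint_unique complex_linear_diff complex_linear_id that)
      (simp add: blinfun.diff_left inner_diff_left inner_diff_right op_adjoint(1)[OF that])
  have "gram (op_adjoint u - id_blinfun) = gram (u - id_blinfun)"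
    using u(1) unitary_op_adjoint(1)[OF u(1)]
    by (simp add: gram_def adj u(2) cl blinfun_compose_distrib unitary_def)
  then have "op_adjoint u - id_blinfun \<in> schatten_class p"
    using u(3) schatten_gram_cong(1)[OF _ complex_linear_diff complex_linear_diff, OF _ cl complex_linear_id u(2) complex_linear_id]
    by blast
  then show ?thesis
    using unitary_op_adjoint(2)[OF u(1)] by (simp add: schatten_unitary_group_def)
qed

locale closed_FH_subgroup =
  fixes p :: real and G :: "op_ell2 set"
  assumes p: "2 < p"
    and subgroup: "subgroup G (schatten_unitary_group p)"
    and closed: "closedin (schatten_unitary_topology p) G"
    and FH: "property_FH (schatten_unitary_group p\<lparr>carrier := G\<rparr>) (subtopology (schatten_unitary_topology p) G)"
begin

lemma G_subset: "G \<subseteq> carrier (schatten_unitary_group p)"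
  using subgroup by (rule subgroup.subset)

sublocale metric: Metric_space "carrier (schatten_unitary_group p)" "\<lambda>u v. schatten_norm p (u - v)"
  by (rule Metric_space_schatten[OF p])

sublocale sub: Submetric "carrier (schatten_unitary_group p)" "\<lambda>u v. schatten_norm p (u - v)" G
  by unfold_locales (rule G_subset)

lemma subtopology_eq: "subtopology (schatten_unitary_topology p) G = sub.sub.mtopology"
  by (simp add: schatten_unitary_topology_def sub.mtopology_submetric)

lemma G_unitary:
  assumes "u \<in> G" shows "unitary u" "complex_linear u" "u - id_blinfun \<in> schatten_class p" "norm (u v) = norm v"
  using assms G_subset unitary_op_adjoint(3)[of u v] by (auto simp: schatten_unitary_group_def unitary_def)

lemma G_diff: "u \<in> G \<Longrightarrow> v \<in> G \<Longrightarrow> u - v \<in> schatten_class p"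
  using G_subset by (intro carrier_schatten_diff p) auto

lemma G_mult: "u \<in> G \<Longrightarrow> v \<in> G \<Longrightarrow> u o\<^sub>L v \<in> G"
  using subgroup.m_closed[OF subgroup] by (simp add: schatten_unitary_group_def)

lemma G_one: "id_blinfun \<in> G"
  using subgroup.one_closed[OF subgroup] by (simp add: schatten_unitary_group_def)

lemma G_adjoint:
  assumes u: "u \<in> G" shows "op_adjoint u \<in> G" "u o\<^sub>L op_adjoint u = id_blinfun" "op_adjoint u o\<^sub>L u = id_blinfun"
proof -
  show uu: "u o\<^sub>L op_adjoint u = id_blinfun" "op_adjoint u o\<^sub>L u = id_blinfun"
    using G_unitary(1)[OF u] by (simp_all add: unitary_def)
  \<comment> \<open>\<open>subgroup\<close> closes G under \<open>m_inv\<close>. Its description is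
    evaluated directly in the record, which presupposes no group structure on all of
    \<open>schatten_unitary_group p\<close>.\<close>
  have "m_inv (schatten_unitary_group p) u = op_adjoint u"
    unfolding m_inv_def
  proof (rule the_equality)
    show "op_adjoint u \<in> carrier (schatten_unitary_group p) \<and>
      u \<otimes>\<^bsub>schatten_unitary_group p\<^esub> op_adjoint u = \<one>\<^bsub>schatten_unitary_group p\<^esub> \<and>
      op_adjoint u \<otimes>\<^bsub>schatten_unitary_group p\<^esub> u = \<one>\<^bsub>schatten_unitary_group p\<^esub>"
      using op_adjoint_in_schatten_unitary_group[of u p] u G_subset uu
      by (auto simp: schatten_unitary_group_def)
    fix y assume "y \<in> carrier (schatten_unitary_group p) \<and>
      u \<otimes>\<^bsub>schatten_unitary_group p\<^esub> y = \<one>\<^bsub>schatten_unitary_group p\<^esub> \<and>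
      y \<otimes>\<^bsub>schatten_unitary_group p\<^esub> u = \<one>\<^bsub>schatten_unitary_group p\<^esub>"
    then have "u o\<^sub>L y = id_blinfun" by (simp add: schatten_unitary_group_def)
    then have "op_adjoint u o\<^sub>L (u o\<^sub>L y) = op_adjoint u" by simp
    then show "y = op_adjoint u" by (simp add: uu(2) flip: blinfun_compose_assoc)
  qed
  then show "op_adjoint u \<in> G"
    using subgroup.m_inv_closed[OF subgroup u] by simp
qed

lemma group_G: "group (schatten_unitary_group p\<lparr>carrier := G\<rparr>)"
proof (rule groupI)
  show "\<exists>y\<in>carrier (schatten_unitary_group p\<lparr>carrier := G\<rparr>).
      y \<otimes>\<^bsub>schatten_unitary_group p\<lparr>carrier := G\<rparr>\<^esub> x = \<one>\<^bsub>schatten_unitary_group p\<lparr>carrier := G\<rparr>\<^esub>"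
    if "x \<in> carrier (schatten_unitary_group p\<lparr>carrier := G\<rparr>)" for x
    using that G_adjoint[of x] by (auto simp: schatten_unitary_group_def)
qed (auto simp: schatten_unitary_group_def G_mult G_one blinfun_compose_assoc)

text \<open>This is the space called E in the opening text.\<close>

definition moving :: "ell2 set" where "moving = {v. \<forall>w. (\<forall>u\<in>G. u w = w) \<longrightarrow> v \<bullet> w = 0}"

lemma subspace_moving: "subspace moving"
  by (rule subspaceI) (auto simp: moving_def inner_add_left)

lemma G_diff_moving:
  assumes u: "u \<in> G" shows "u v - v \<in> moving"
  unfolding moving_def
proof (intro CollectI allI impI)
  fix w assume "\<forall>u\<in>G. u w = w"
  then have "op_adjoint u w = w" using G_adjoint(1)[OF u] by blast
  then show "(u v - v) \<bullet> w = 0"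
    using op_adjoint(1)[OF G_unitary(2)[OF u], of v w] by (simp add: inner_diff_left)
qed

text \<open>The vector u z - z lies in \<open>moving\<close> and is orthogonal to
  \<open>moving\<close>, hence to itself.\<close>

lemma orthogonal_moving_fixed:
  assumes u: "u \<in> G" and z: "\<And>y. y \<in> moving \<Longrightarrow> y \<bullet> z = 0"
  shows "u z = z"
proof -
  have "(u z - z) \<bullet> y = 0" if "y \<in> moving" for y
  proof -
    have "(u z - z) \<bullet> y = (op_adjoint u y - y) \<bullet> z"
      using op_adjoint(1)[OF G_unitary(2)[OF u], of z y] by (simp add: inner_diff_left inner_diff_right inner_commute)
    then show ?thesis using z G_diff_moving[OF G_adjoint(1)[OF u]] by simp
  qed
  from this[OF G_diff_moving[OF u, of z]] show ?thesis by simp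
qed

lemma no_infinite_orthonormal_sequence:
  assumes f: "\<And>i. f i \<in> moving" "\<And>N. orthonormal_upto (\<bullet>) N f"
  shows False
proof -
  let ?S = "hilbert_sum :: (nat \<Rightarrow> ell2) hilbert"
  let ?R = "schatten_unitary_group p\<lparr>carrier := G\<rparr>"
  let ?d = "\<lambda>u v. schatten_norm p (u - v)"
  interpret real_hilbert_space ?S by (rule real_hilbert_space_hilbert_sum)
  interpret HS: Metric_space "carrier ?S" "hdist ?S" by (rule metric_space)
  interpret R: group ?R by (rule group_G)
  define w where "w n = 1 / sqrt (Suc n)" for n
  have w2: "(w n)\<^sup>2 = 1 / Suc n" for n by (simp add: w_def power_divide)
  obtain K where K: "K \<ge> 0" "\<And>x N. x \<in> schatten_class p \<Longrightarrow>
      (\<Sum>n<N. (norm (blinfun_apply x (f n)))\<^sup>2 / Suc n) \<le> K * (schatten_norm p x)\<^sup>2"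
    using schatten_weighted_sum[OF p] f(2) by blast
  have Rsimps: "carrier ?R = G" "\<And>u v. u \<otimes>\<^bsub>?R\<^esub> v = u o\<^sub>L v" "\<one>\<^bsub>?R\<^esub> = id_blinfun"
    by (simp_all add: schatten_unitary_group_def)
  define \<beta> where "\<beta> u x = (\<lambda>n. blinfun_apply u (x n) + w n *\<^sub>R (blinfun_apply u (f n) - f n))" for u :: op_ell2 and x
  \<comment> \<open>Members of \<open>Bij\<close> are extensional, taking the value
    \<open>undefined\<close> off the carrier; hence the restriction of the affine map.\<close>
  define \<alpha> where "\<alpha> u = restrict (\<beta> u) (carrier ?S)" for u
  have \<beta>_in: "\<beta> u x \<in> carrier ?S" if u: "u \<in> G" and x: "x \<in> carrier ?S" for u x
    unfolding \<beta>_def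
  proof (rule hilbert_sum_add_closed)
    show "(\<lambda>n. u (x n)) \<in> carrier ?S"
      using x by (simp add: hilbert_sum_simps(1) G_unitary(4)[OF u])
    have "(norm (w n *\<^sub>R (u (f n) - f n)))\<^sup>2 = (norm ((u - id_blinfun) (f n)))\<^sup>2 / Suc n" for n
      by (simp only: norm_scaleR power_mult_distrib power2_abs w2) (simp add: blinfun.diff_left)
    then show "(\<lambda>n. w n *\<^sub>R (u (f n) - f n)) \<in> carrier ?S"
      unfolding hilbert_sum_simps(1)
      using K(2)[OF G_unitary(3)[OF u]] by (intro summableI_nonneg_bounded[where x = "K * (schatten_norm p (u - id_blinfun))\<^sup>2"]) auto
  qed
  have \<beta>_one: "\<beta> id_blinfun x = x" for x by (simp add: \<beta>_def)
  have \<beta>_mult: "\<beta> (u o\<^sub>L v) x = \<beta> u (\<beta> v x)" for u v x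
    by (simp add: \<beta>_def blinfun.add_right blinfun.scaleR_right blinfun.diff_right algebra_simps)
  have \<beta>_diff: "\<beta> u x n - \<beta> u y n = u (x n - y n)" for u x y n
    by (simp add: \<beta>_def blinfun.diff_right)
  have \<beta>_iso: "hdist ?S (\<beta> u x) (\<beta> u y) = hdist ?S x y"
    if "u \<in> G" "x \<in> carrier ?S" "y \<in> carrier ?S" for u x y
    using that by (simp add: hdist_hilbert_sum \<beta>_in \<beta>_diff G_unitary(4)[OF that(1)])
  have \<beta>_Bij: "\<alpha> u \<in> Bij (carrier ?S)" if u: "u \<in> G" for u
  proof -
    have "bij_betw (\<alpha> u) (carrier ?S) (carrier ?S)"
    proof (rule bij_betw_byWitness[where f' = "\<alpha> (op_adjoint u)"])
      show "\<forall>x\<in>carrier ?S. \<alpha> (op_adjoint u) (\<alpha> u x) = x" "\<forall>x\<in>carrier ?S. \<alpha> u (\<alpha> (op_adjoint u) x) = x"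
        using u G_adjoint[OF u] \<beta>_in by (simp_all add: \<alpha>_def \<beta>_one flip: \<beta>_mult)
      show "\<alpha> u ` carrier ?S \<subseteq> carrier ?S" "\<alpha> (op_adjoint u) ` carrier ?S \<subseteq> carrier ?S"
        using \<beta>_in u G_adjoint(1)[OF u] by (auto simp: \<alpha>_def)
    qed
    then show ?thesis by (simp add: Bij_def \<alpha>_def)
  qed
  have act: "group_action ?R (carrier ?S) \<alpha>"
    unfolding group_action_def
  proof (rule group_hom.intro[OF R.is_group group_BijGroup], unfold group_hom_axioms_def, rule homI)
    fix g h assume gh: "g \<in> carrier ?R" "h \<in> carrier ?R"
    then show "\<alpha> g \<in> carrier (BijGroup (carrier ?S))"
      using \<beta>_Bij by (simp add: BijGroup_def Rsimps)
    have "\<alpha> (g o\<^sub>L h) = compose (carrier ?S) (\<alpha> g) (\<alpha> h)"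
      using gh \<beta>_in by (auto simp: \<alpha>_def compose_def \<beta>_mult fun_eq_iff Rsimps)
    then show "\<alpha> (g \<otimes>\<^bsub>?R\<^esub> h) = \<alpha> g \<otimes>\<^bsub>BijGroup (carrier ?S)\<^esub> \<alpha> h"
      unfolding Rsimps(2) using gh \<beta>_Bij by (simp add: BijGroup_def Rsimps(1))
  qed
  \<comment> \<open>A Lipschitz constant in u for fixed x. The square of a sum of two terms costs a
    factor 2; in the linear term the operator norm is at most twice the Schatten norm, which makes
    it 8, and the cocycle term is bounded by \<open>schatten_weighted_sum\<close>.\<close>
  define L where "L x = sqrt (8 * (\<Sum>n. (norm (x n))\<^sup>2) + 2 * K)" for x :: "nat \<Rightarrow> ell2"
  have \<beta>_lip: "hdist ?S (\<beta> u x) (\<beta> v x) \<le> L x * ?d u v"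
    if u: "u \<in> G" and v: "v \<in> G" and x: "x \<in> carrier ?S" for u v x
  proof (rule hdist_hilbert_sum_le[OF \<beta>_in[OF u x] \<beta>_in[OF v x]])
    let ?q = "\<Sum>n. (norm (x n))\<^sup>2" and ?s = "?d u v"
    have sx: "summable (\<lambda>n. (norm (x n))\<^sup>2)" using x by (simp add: hilbert_sum_simps(1))
    have q: "?q \<ge> 0" by (intro suminf_nonneg sx) simp
    have s: "?s \<ge> 0" by (rule metric.nonneg)
    have L2: "(L x)\<^sup>2 = 8 * ?q + 2 * K" using q K(1) by (simp add: L_def)
    show "0 \<le> L x * ?s" using s q K(1) by (simp add: L_def)
    fix N
    have term_le: "(norm (\<beta> u x n - \<beta> v x n))\<^sup>2 \<le> 8 * ?s\<^sup>2 * (norm (x n))\<^sup>2 + 2 * ((norm ((u - v) (f n)))\<^sup>2 / Suc n)" for n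
    proof -
      have "\<beta> u x n - \<beta> v x n = (u - v) (x n) + w n *\<^sub>R (u - v) (f n)"
        by (simp add: \<beta>_def blinfun.diff_left algebra_simps)
      then have "(norm (\<beta> u x n - \<beta> v x n))\<^sup>2 \<le> 2 * (norm ((u - v) (x n)))\<^sup>2 + 2 * (norm (w n *\<^sub>R (u - v) (f n)))\<^sup>2"
        by (simp only: norm_add_square_le)
      also have "(norm (w n *\<^sub>R (u - v) (f n)))\<^sup>2 = (norm ((u - v) (f n)))\<^sup>2 / Suc n"
        by (simp only: norm_scaleR power_mult_distrib power2_abs w2) simp
      also have "(norm ((u - v) (x n)))\<^sup>2 \<le> (2 * ?s * norm (x n))\<^sup>2"
        using norm_le_schatten[OF G_diff[OF u v] p]
        by (intro power_mono order_trans[OF norm_blinfun] mult_right_mono) auto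
      finally show ?thesis by (simp add: power_mult_distrib)
    qed
    have "(\<Sum>n<N. (norm (\<beta> u x n - \<beta> v x n))\<^sup>2) \<le> 
        (\<Sum>n<N. 8 * ?s\<^sup>2 * (norm (x n))\<^sup>2 + 2 * ((norm ((u - v) (f n)))\<^sup>2 / Suc n))"
      by (intro sum_mono term_le)
    also have "\<dots> = 8 * ?s\<^sup>2 * (\<Sum>n<N. (norm (x n))\<^sup>2) + 2 * (\<Sum>n<N. (norm ((u - v) (f n)))\<^sup>2 / Suc n)"
      by (simp only: sum.distrib sum_distrib_left)
    also have "\<dots> \<le> 8 * ?s\<^sup>2 * ?q + 2 * (K * ?s\<^sup>2)"
      using K(2)[OF G_diff[OF u v], of N] sum_le_suminf[OF sx, of "{..<N}"] by (intro add_mono mult_left_mono) auto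
    also have "\<dots> = (L x * ?s)\<^sup>2" by (simp add: power_mult_distrib L2 algebra_simps)
    finally show "(\<Sum>n<N. (norm (\<beta> u x n - \<beta> v x n))\<^sup>2) \<le> (L x * ?s)\<^sup>2" .
  qed
  have cont: "continuous_map (prod_topology (subtopology (schatten_unitary_topology p) G) (htopology ?S)) (htopology ?S) (\<lambda>(g, x). \<alpha> g x)"
    unfolding subtopology_eq htopology_def HS.continuous_map_to_metric
  proof (intro ballI allI impI)
    fix z and \<epsilon> :: real assume z: "z \<in> topspace (prod_topology sub.sub.mtopology HS.mtopology)" and \<epsilon>: "\<epsilon> > 0"
    obtain u x where ux: "z = (u, x)" "u \<in> G" "x \<in> carrier ?S" using z by auto
    have L: "L x \<ge> 0"
    proof -
      have "(\<Sum>n. (norm (x n))\<^sup>2) \<ge> 0" using ux(3) by (intro suminf_nonneg) (auto simp: hilbert_sum_simps(1))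
      then show ?thesis using K(1) by (simp add: L_def)
    qed
    \<comment> \<open>Half of \<open>\<epsilon>\<close> is spent on the change of u and half on the
      change of x, in which the action is isometric. The summand 1 covers the case
      \<open>L x = 0\<close>.\<close>
    define \<delta> where "\<delta> = \<epsilon> / (2 * (L x + 1))"
    have \<delta>: "\<delta> > 0" "L x * \<delta> \<le> \<epsilon> / 2" using \<epsilon> L by (simp_all add: \<delta>_def field_simps)
    let ?U = "sub.sub.mball u \<delta> \<times> HS.mball x (\<epsilon> / 2)"
    have "hdist ?S (\<beta> u x) (\<beta> v y) < \<epsilon>" if "v \<in> sub.sub.mball u \<delta>" "y \<in> HS.mball x (\<epsilon> / 2)" for v y
    proof -
      have v: "v \<in> G" "?d u v < \<delta>" and y: "y \<in> carrier ?S" "hdist ?S x y < \<epsilon> / 2" using that by auto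
      have "hdist ?S (\<beta> u x) (\<beta> v y) \<le> hdist ?S (\<beta> u x) (\<beta> v x) + hdist ?S (\<beta> v x) (\<beta> v y)"
        by (intro HS.triangle \<beta>_in ux v y)
      also have "hdist ?S (\<beta> u x) (\<beta> v x) \<le> L x * \<delta>"
        using \<beta>_lip[OF ux(2) v(1) ux(3)] mult_left_mono[OF less_imp_le[OF v(2)] L] by linarith
      finally show ?thesis using \<beta>_iso[OF v(1) ux(3) y(1)] y(2) \<delta>(2) by simp
    qed
    then have "\<forall>y\<in>?U. (case y of (g, x) \<Rightarrow> \<alpha> g x) \<in> HS.mball (case z of (g, x) \<Rightarrow> \<alpha> g x) \<epsilon>"
      using ux \<beta>_in by (auto simp: \<alpha>_def)
    moreover have "openin (prod_topology sub.sub.mtopology HS.mtopology) ?U"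
      by (simp add: openin_prod_Times_iff)
    moreover have "z \<in> ?U" using ux \<delta>(1) \<epsilon> schatten_zero[of p] p by simp
    ultimately show "\<exists>U. openin (prod_topology sub.sub.mtopology HS.mtopology) U \<and> z \<in> U \<and>
        (\<forall>y\<in>U. (case y of (g, x) \<Rightarrow> \<alpha> g x) \<in> HS.mball (case z of (g, x) \<Rightarrow> \<alpha> g x) \<epsilon>)" by blast
  qed
  have comb: "(1 - t) \<odot>\<^bsub>?S\<^esub> x \<oplus>\<^bsub>?S\<^esub> t \<odot>\<^bsub>?S\<^esub> y \<in> carrier ?S" if "x \<in> carrier ?S" "y \<in> carrier ?S" for t x y
    using that by simp
  have affine: "affine_isometric_action ?R (subtopology (schatten_unitary_topology p) G) ?S \<alpha>"
    unfolding affine_isometric_action_def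
  proof (intro conjI act cont ballI allI)
    fix g x y t assume *: "g \<in> carrier ?R" "x \<in> carrier ?S" "y \<in> carrier ?S"
    then show "hdist ?S (\<alpha> g x) (\<alpha> g y) = hdist ?S x y"
      using \<beta>_iso by (simp add: \<alpha>_def Rsimps)
    have "\<beta> g ((1 - t) \<odot>\<^bsub>?S\<^esub> x \<oplus>\<^bsub>?S\<^esub> t \<odot>\<^bsub>?S\<^esub> y) = (1 - t) \<odot>\<^bsub>?S\<^esub> \<beta> g x \<oplus>\<^bsub>?S\<^esub> t \<odot>\<^bsub>?S\<^esub> \<beta> g y"
      by (simp add: \<beta>_def hilbert_sum_simps(3,4) fun_eq_iff blinfun.add_right blinfun.diff_right blinfun.scaleR_right algebra_simps)
    then show "\<alpha> g ((1 - t) \<odot>\<^bsub>?S\<^esub> x \<oplus>\<^bsub>?S\<^esub> t \<odot>\<^bsub>?S\<^esub> y) = (1 - t) \<odot>\<^bsub>?S\<^esub> \<alpha> g x \<oplus>\<^bsub>?S\<^esub> t \<odot>\<^bsub>?S\<^esub> \<alpha> g y"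
      using comb[of x y t] * by (simp add: \<alpha>_def)
  qed
  have top: "topspace (subtopology (schatten_unitary_topology p) G) = carrier ?R"
    by (simp only: subtopology_eq sub.sub.topspace_mtopology Rsimps)
  obtain x where x: "x \<in> carrier ?S" and "\<forall>u\<in>carrier ?R. \<alpha> u x = x"
    by (rule bexE[OF property_FH_fixed_point[OF FH top real_hilbert_space_hilbert_sum affine]])
  then have fixed: "\<beta> u x = x" if "u \<in> G" for u
    using that x by (simp add: \<alpha>_def)
  \<comment> \<open>As x is square-summable, this lower bound contradicts the divergence of the
    harmonic series.\<close>
  have "1 / Suc n \<le> (norm (x n))\<^sup>2" for n
  proof -
    let ?y = "x n + w n *\<^sub>R f n"
    have "u ?y = ?y" if "u \<in> G" for u
    proof -
      have "\<beta> u x n = x n" using fixed[OF that] by simp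
      then show ?thesis
        by (simp add: \<beta>_def blinfun.add_right blinfun.scaleR_right algebra_simps)
    qed
    then have "f n \<bullet> ?y = 0" using f(1)[of n] by (simp add: moving_def)
    moreover have "f n \<bullet> f n = 1" using orthonormal_uptoD[OF f(2)[of "Suc n"], of n n] by simp
    ultimately have "w n = - (f n \<bullet> x n)" by (simp add: inner_add_right)
    then have "\<bar>w n\<bar> \<le> norm (f n) * norm (x n)" using Cauchy_Schwarz_ineq2[of "f n" "x n"] by simp
    also have "norm (f n) = 1" by (rule orthonormal_upto_norm[OF f(2)[of "Suc n"]]) simp
    finally have "\<bar>w n\<bar>\<^sup>2 \<le> (norm (x n))\<^sup>2" by (intro power_mono) auto
    then show ?thesis by (simp add: w2)
  qed
  then have le: "norm (inverse (real (Suc n))) \<le> (norm (x n))\<^sup>2" for n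
    by (simp add: inverse_eq_divide del: of_nat_Suc)
  have "summable (\<lambda>n. (norm (x n))\<^sup>2)"
    using x by (simp only: hilbert_sum_simps(1))
  then have "summable (\<lambda>n. inverse (real (Suc n)))"
    by (rule summable_comparison_test'[of _ 0]) (rule le)
  then have "summable (\<lambda>n. inverse (real n))"
    by (rule summable_Suc_iff[of "\<lambda>n. inverse (real n)", THEN iffD1])
  then show False using not_summable_harmonic[where 'a = real] by simp
qed

lemma finite_basis_moving:
  "\<exists>m f. (\<forall>i<m. f i \<in> moving) \<and> orthonormal_upto (\<bullet>) m f \<and> (\<forall>x\<in>moving. x = (\<Sum>i<m. (f i \<bullet> x) *\<^sub>R f i))"
  using Gram_Schmidt_dichotomy[OF subspace_moving, of "(\<bullet>)"] no_infinite_orthonormal_sequence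
  by (auto simp: inner_commute bounded_linear.linear[OF bounded_linear_inner_right])

theorem compact_lie_group:
  "compact_space (subtopology (schatten_unitary_topology p) G) \<and>
    lie_group (schatten_unitary_group p\<lparr>carrier := G\<rparr>) (subtopology (schatten_unitary_topology p) G)"
proof -
  obtain m f where f: "\<And>i. i < m \<Longrightarrow> f i \<in> moving" and on: "orthonormal_upto (\<bullet>) m f"
    and expand: "\<And>x. x \<in> moving \<Longrightarrow> x = (\<Sum>i<m. (f i \<bullet> x) *\<^sub>R f i)"
    using finite_basis_moving by blast
  have p0: "p > 0" using p by simp
  \<comment> \<open>The \<open>E k\<close> are matrix units for f and \<open>cf X\<close> the matrix
    entries of X. \<open>\<Phi>\<close> compresses an operator to the span of f, so \<open>M\<close>
    consists of the operators that live on this span, and \<open>ip\<close> is the trace form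
    there.\<close>
  define I where "I = {..<m} \<times> {..<m}"
  define E where "E k = Blinfun (\<lambda>v. (f (snd k) \<bullet> v) *\<^sub>R f (fst k))" for k :: "nat \<times> nat"
  define cf where "cf X k = f (fst k) \<bullet> blinfun_apply X (f (snd k))" for X and k :: "nat \<times> nat"
  define \<Phi> where "\<Phi> X = (\<Sum>k\<in>I. cf X k *\<^sub>R E k)" for X
  define M where "M = {X. \<Phi> X = X}"
  define ip where "ip X Y = (\<Sum>j<m. blinfun_apply X (f j) \<bullet> blinfun_apply Y (f j))" for X Y :: op_ell2
  have E: "E k v = (f (snd k) \<bullet> v) *\<^sub>R f (fst k)" for k v
    unfolding E_def by (subst bounded_linear_Blinfun_apply) (auto intro!: bounded_linear_scaleR_const bounded_linear_inner_right)
  have bl: "bounded_linear \<Phi>"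
    unfolding \<Phi>_def cf_def
    by (intro bounded_linear_sum bounded_linear_scaleR_const bounded_linear_compose[OF bounded_linear_inner_right] blinfun.bounded_linear_left)
  have nf: "norm (f i) = 1" if "i < m" for i by (rule orthonormal_upto_norm[OF on that])
  have subM: "subspace M"
    unfolding M_def by (rule subspaceI) (simp_all add: linear_simps[OF bl])
  have closedM: "closed M"
    unfolding M_def by (intro closed_Collect_eq linear_continuous_on bl continuous_on_id)
  have compactM: "compact (M \<inter> cball 0 R)" for R
  proof -
    have sub: "M \<inter> cball 0 R \<subseteq> {\<Sum>k\<in>I. c k *\<^sub>R E k | c. \<forall>k\<in>I. \<bar>c k\<bar> \<le> R}"
    proof
      fix X assume X: "X \<in> M \<inter> cball 0 R"
      have "\<bar>cf X k\<bar> \<le> R" if k: "k \<in> I" for k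
      proof -
        have "\<bar>cf X k\<bar> \<le> norm (f (fst k)) * norm (X (f (snd k)))"
          unfolding cf_def by (rule Cauchy_Schwarz_ineq2)
        also have "\<dots> \<le> norm X" using norm_blinfun[of X "f (snd k)"] nf k by (auto simp: I_def)
        finally show ?thesis using X by simp
      qed
      moreover have "X = (\<Sum>k\<in>I. cf X k *\<^sub>R E k)" using X by (simp add: M_def \<Phi>_def)
      ultimately show "X \<in> {\<Sum>k\<in>I. c k *\<^sub>R E k | c. \<forall>k\<in>I. \<bar>c k\<bar> \<le> R}" by blast
    qed
    have "finite I" by (simp add: I_def)
    from closed_Int_compact[OF closed_Int[OF closedM closed_cball[of 0 R]] compact_combinations[OF this, where b = E and R = R]]
    show ?thesis unfolding Int_absorb2[OF sub] .
  qed
  have zeroM: "X v = 0" if X: "X \<in> M" and v: "\<And>j. j < m \<Longrightarrow> f j \<bullet> v = 0" for X v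
  proof -
    have "X v = (\<Sum>k\<in>I. cf X k *\<^sub>R E k) v" using X by (simp add: M_def \<Phi>_def)
    also have "\<dots> = (\<Sum>k\<in>I. cf X k *\<^sub>R (E k v))"
      by (simp add: blinfun.sum_left blinfun.scaleR_left)
    also have "\<dots> = 0" using v by (intro sum.neutral) (auto simp: E I_def)
    finally show ?thesis .
  qed
  have GM: "g - id_blinfun \<in> M" if g: "g \<in> G" for g
  proof -
    define X where "X = g - id_blinfun"
    have X: "X v = g v - v" for v by (simp add: X_def blinfun.diff_left)
    have "\<Phi> X v = X v" for v
    proof -
      \<comment> \<open>The component v - q is orthogonal to \<open>moving\<close> and so fixed by
        g. Hence X sees only q, and its values lie in \<open>moving\<close> again, which makes X its
        own compression.\<close>
      define q where "q = (\<Sum>j<m. (f j \<bullet> v) *\<^sub>R f j)"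
      have fq: "f i \<bullet> (v - q) = 0" if "i < m" for i
        using inner_orthonormal_sum[OF on that] by (simp add: q_def inner_diff_right)
      have "y \<bullet> (v - q) = 0" if "y \<in> moving" for y
        by (subst expand[OF that]) (simp add: inner_sum_left fq)
      then have "g (v - q) = v - q" by (rule orthogonal_moving_fixed[OF g])
      then have "X v = X q" by (simp add: X blinfun.diff_right algebra_simps)
      have "X q = (\<Sum>i<m. (f i \<bullet> X q) *\<^sub>R f i)"
        by (rule expand) (simp add: X G_diff_moving[OF g])
      also have "\<dots> = (\<Sum>i<m. \<Sum>j<m. cf X (i, j) *\<^sub>R E (i, j) v)"
        by (simp add: q_def blinfun.sum_right blinfun.scaleR_right inner_sum_right scaleR_sum_left E cf_def mult.commute)
      also have "\<dots> = (\<Sum>k\<in>I. cf X k *\<^sub>R E k v)"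
        by (simp add: I_def sum.cartesian_product case_prod_unfold)
      also have "\<dots> = \<Phi> X v"
        by (simp add: \<Phi>_def blinfun.sum_left blinfun.scaleR_left)
      finally show ?thesis using \<open>X v = X q\<close> by simp
    qed
    then have "\<Phi> X = X" by (rule blinfun_eqI)
    then show ?thesis by (simp add: M_def X_def)
  qed
  define C where "C = real m powr (1 / p)"
  have schatten_M: "X \<in> schatten_class p" "schatten_norm p X \<le> C * norm X" if "X \<in> M" "complex_linear X" for X
    using schatten_finite_support[OF that(2) p0 on zeroM[OF that(1)]] by (auto simp: C_def)
  have C: "C \<ge> 0" by (simp add: C_def)
  have MM: "u - v \<in> M" if "u - id_blinfun \<in> M" "v - id_blinfun \<in> M" for u v
    using subspace_diff[OF subM that] by simp
  \<comment> \<open>The given closedness is in the Schatten metric. A limit u in operator norm keeps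
    u - 1 in \<open>M\<close> and is unitary because the adjoints converge too;
    \<open>schatten_M\<close> then turns convergence in operator norm into convergence in the
    Schatten metric.\<close>
  have closedG: "closed G"
    unfolding closed_sequential_limits
  proof (intro allI impI)
    fix g u assume "(\<forall>k. g k \<in> G) \<and> g \<longlonglongrightarrow> u"
    then have g: "\<And>k. g k \<in> G" and lim: "g \<longlonglongrightarrow> u" by auto
    have "(\<lambda>k. g k - id_blinfun) \<longlonglongrightarrow> u - id_blinfun" by (intro tendsto_intros lim)
    from closed_sequentially[OF closedM GM[OF g] this] have uM: "u - id_blinfun \<in> M" .
    have cl: "complex_linear u"
      unfolding complex_linear_def
    proof (intro allI)
      fix c x
      have "(\<lambda>k. g k (scaleC c x)) \<longlonglongrightarrow> u (scaleC c x)"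
        by (rule blinfun.tendsto[OF lim tendsto_const])
      moreover have "(\<lambda>k. g k (scaleC c x)) \<longlonglongrightarrow> scaleC c (u x)"
        using bounded_linear.tendsto[OF bounded_linear_scaleC blinfun.tendsto[OF lim tendsto_const, of x]] G_unitary(2)[OF g]
        by (simp add: complex_linear_def)
      ultimately show "u (scaleC c x) = scaleC c (u x)" by (rule LIMSEQ_unique)
    qed
    have adj_lim: "(\<lambda>k. op_adjoint (g k)) \<longlonglongrightarrow> op_adjoint u"
    proof (rule LIM_zero_cancel, rule Lim_null_comparison)
      show "(\<lambda>k. norm (g k - u)) \<longlonglongrightarrow> 0" using lim by (simp add: LIM_zero tendsto_norm_zero)
      have "norm (op_adjoint (g k) - op_adjoint u) \<le> norm (g k - u)" for k
      proof (rule norm_blinfun_bound)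
        fix y
        let ?z = "(op_adjoint (g k) - op_adjoint u) y"
        have "norm ?z * norm ?z = ((g k - u) ?z) \<bullet> y"
          using op_adjoint(1)[OF G_unitary(2)[OF g[of k]], of ?z y] op_adjoint(1)[OF cl, of ?z y]
          by (simp add: blinfun.diff_left inner_diff_left inner_diff_right power2_norm_eq_inner flip: power2_eq_square)
        also have "\<dots> \<le> norm ((g k - u) ?z) * norm y" by (rule norm_cauchy_schwarz)
        also have "\<dots> \<le> norm (g k - u) * norm ?z * norm y" by (intro mult_right_mono norm_blinfun) auto
        finally have "norm ?z * norm ?z \<le> norm ?z * (norm (g k - u) * norm y)" by (simp add: mult_ac)
        then show "norm ?z \<le> norm (g k - u) * norm y"
          by (cases "?z = 0") simp_all
      qed simp
      then show "\<forall>\<^sub>F k in sequentially. norm (op_adjoint (g k) - op_adjoint u) \<le> norm (g k - u)"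
        by (intro always_eventually allI)
    qed
    have "(\<lambda>k. op_adjoint (g k) o\<^sub>L g k) \<longlonglongrightarrow> (op_adjoint u o\<^sub>L u)"
      by (rule bounded_bilinear.tendsto[OF bounded_bilinear_blinfun_compose adj_lim lim])
    moreover have "(\<lambda>k. g k o\<^sub>L op_adjoint (g k)) \<longlonglongrightarrow> (u o\<^sub>L op_adjoint u)"
      by (rule bounded_bilinear.tendsto[OF bounded_bilinear_blinfun_compose lim adj_lim])
    ultimately have "unitary u"
      using cl by (simp add: unitary_def G_adjoint[OF g] LIMSEQ_const_iff)
    then have uc: "u \<in> carrier (schatten_unitary_group p)"
      using schatten_M(1)[OF uM complex_linear_diff[OF cl complex_linear_id]] by (simp add: schatten_unitary_group_def)
    have "limitin metric.mtopology g u sequentially"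
      unfolding metric.limit_metric_sequentially
    proof (intro conjI uc allI impI)
      fix e :: real assume e: "e > 0"
      \<comment> \<open>C vanishes when m = 0, hence the denominator C + 1.\<close>
      have "e / (C + 1) > 0" using e C by simp
      then obtain N where N: "\<And>k. k \<ge> N \<Longrightarrow> norm (g k - u) < e / (C + 1)"
        using lim unfolding LIMSEQ_iff by blast
      have "schatten_norm p (g k - u) < e" if "k \<ge> N" for k
      proof -
        have "schatten_norm p (g k - u) \<le> C * norm (g k - u)"
          by (rule schatten_M(2)[OF MM[OF GM[OF g] uM] complex_linear_diff[OF G_unitary(2)[OF g] cl]])
        also have "\<dots> \<le> (C + 1) * norm (g k - u)" by (intro mult_right_mono) auto
        also have "\<dots> < e" using N[OF that] C by (simp add: pos_less_divide_eq mult.commute)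
        finally show ?thesis .
      qed
      then show "\<exists>N. \<forall>n\<ge>N. g n \<in> carrier (schatten_unitary_group p) \<and> schatten_norm p (g n - u) < e"
        using g G_subset by blast
    qed
    then show "u \<in> G"
      using closed g unfolding schatten_unitary_topology_def metric.metric_closedin_iff_sequentially_closed by blast
  qed
  have ip: "bounded_bilinear ip"
  proof (rule bounded_bilinear.intro)
    show "\<exists>K. \<forall>a b. norm (ip a b) \<le> norm a * norm b * K"
    proof (intro exI allI)
      fix a b
      have "norm (ip a b) \<le> (\<Sum>j<m. norm a * norm b)"
        unfolding ip_def
      proof (rule order_trans[OF norm_sum], rule sum_mono)
        fix j assume "j \<in> {..<m}"
        then have "norm (a (f j)) \<le> norm a" "norm (b (f j)) \<le> norm b"
          using norm_blinfun[of a "f j"] norm_blinfun[of b "f j"] nf by auto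
        then have "norm (a (f j)) * norm (b (f j)) \<le> norm a * norm b" by (intro mult_mono) auto
        then show "norm (a (f j) \<bullet> b (f j)) \<le> norm a * norm b"
          using Cauchy_Schwarz_ineq2[of "a (f j)" "b (f j)"] by simp
      qed
      then show "norm (ip a b) \<le> norm a * norm b * real m" by (simp add: mult.commute)
    qed
  qed (simp_all add: ip_def blinfun.add_left blinfun.scaleR_left inner_add_left inner_add_right sum.distrib sum_distrib_left)
  interpret L: closed_isometry_group G M ip
  proof (rule closed_isometry_group.intro)
    show "\<exists>y\<in>G. x o\<^sub>L y = id_blinfun \<and> y o\<^sub>L x = id_blinfun" if "x \<in> G" for x
      using G_adjoint[OF that] by blast
    show "norm x \<le> 1" if "x \<in> G" for x
      by (rule norm_blinfun_bound) (simp_all add: G_unitary(4)[OF that])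
    show "ip X Y = ip Y X" for X Y by (simp add: ip_def inner_commute)
    show "ip X X > 0" if "X \<in> M" "X \<noteq> 0" for X
    proof (rule ccontr)
      assume "\<not> ip X X > 0"
      moreover have "ip X X \<ge> 0" unfolding ip_def by (intro sum_nonneg) simp
      ultimately have "ip X X = 0" by simp
      then have "\<forall>j<m. X (f j) = 0"
        unfolding ip_def by (subst (asm) sum_nonneg_eq_0_iff) auto
      then have "\<Phi> X = 0" by (auto simp: \<Phi>_def cf_def I_def intro!: sum.neutral)
      then show False using that by (simp add: M_def)
    qed
  qed (use G_one G_mult closedG subM GM compactM ip in auto)
  \<comment> \<open>Differences of elements of G lie in \<open>M\<close>, so
    \<open>schatten_M\<close> fits a norm ball into each Schatten ball;
    \<open>norm_le_schatten\<close> gives the converse.\<close>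
  have top: "subtopology (schatten_unitary_topology p) G = top_of_set G"
    unfolding subtopology_eq topology_eq
  proof (intro allI iffI)
    fix U assume U: "openin sub.sub.mtopology U"
    then have "U \<subseteq> G" by (simp add: sub.sub.openin_mtopology)
    moreover have "\<exists>e>0. \<forall>v\<in>G. dist v u < e \<longrightarrow> v \<in> U" if u: "u \<in> U" for u
    proof -
      obtain r where r: "r > 0" "sub.sub.mball u r \<subseteq> U" using U u unfolding sub.sub.openin_mtopology by blast
      have uG: "u \<in> G" using u \<open>U \<subseteq> G\<close> by blast
      have "v \<in> U" if v: "v \<in> G" "dist v u < r / (C + 1)" for v
      proof -
        have "schatten_norm p (u - v) \<le> C * norm (u - v)"
          by (rule schatten_M(2)[OF MM[OF GM[OF uG] GM[OF v(1)]]
              complex_linear_diff[OF G_unitary(2)[OF uG] G_unitary(2)[OF v(1)]]])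
        also have "\<dots> \<le> (C + 1) * norm (u - v)" by (intro mult_right_mono) auto
        also have "\<dots> < r" using v(2) C by (simp add: dist_norm norm_minus_commute pos_less_divide_eq mult.commute)
        finally show ?thesis using r(2) uG v(1) by (auto simp: subset_iff)
      qed
      then show ?thesis using r(1) C by (intro exI[of _ "r / (C + 1)"]) auto
    qed
    ultimately show "openin (top_of_set G) U"
      unfolding openin_euclidean_subtopology_iff by blast
  next
    fix U assume "openin (top_of_set G) U"
    then have U: "U \<subseteq> G" "\<And>u. u \<in> U \<Longrightarrow> \<exists>e>0. \<forall>v\<in>G. dist v u < e \<longrightarrow> v \<in> U"
      unfolding openin_euclidean_subtopology_iff by blast+
    show "openin sub.sub.mtopology U"
      unfolding sub.sub.openin_mtopology
    proof (intro conjI allI impI U(1))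
      fix u assume u: "u \<in> U"
      then obtain e where e: "e > 0" "\<And>v. v \<in> G \<Longrightarrow> dist v u < e \<Longrightarrow> v \<in> U" using U(2) by blast
      have "sub.sub.mball u (e / 2) \<subseteq> U"
      proof
        fix v assume "v \<in> sub.sub.mball u (e / 2)"
        then have v: "u \<in> G" "v \<in> G" "schatten_norm p (u - v) < e / 2" by auto
        then have "norm (u - v) < e"
          using norm_le_schatten[OF G_diff[OF v(1,2)] p] by simp
        then show "v \<in> U" using e(2)[OF v(2)] by (simp add: dist_norm norm_minus_commute)
      qed
      then show "\<exists>r>0. sub.sub.mball u r \<subseteq> U" using e(1) by (intro exI[of _ "e / 2"]) auto
    qed
  qed
  have "compact_space (top_of_set G)"
    using L.compact_G by (simp add: compact_space_subtopology)
  moreover have "lie_group (schatten_unitary_group p\<lparr>carrier := G\<rparr>) (top_of_set G)"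
    by (rule L.lie_group) (simp_all add: schatten_unitary_group_def)
  ultimately show ?thesis unfolding top by blast
qed

end

theorem corollary4p33:
  fixes p :: real and G :: "op_ell2 set"
  assumes "2 < p"
    and "subgroup G (schatten_unitary_group p)"
    and "closedin (schatten_unitary_topology p) G"
    and "property_FH (schatten_unitary_group p\<lparr>carrier := G\<rparr>)
           (subtopology (schatten_unitary_topology p) G)"
  shows "compact_space (subtopology (schatten_unitary_topology p) G) \<and>
    lie_group (schatten_unitary_group p\<lparr>carrier := G\<rparr>)
      (subtopology (schatten_unitary_topology p) G)"
proof -
  interpret closed_FH_subgroup p G
    by (rule closed_FH_subgroup.intro[OF assms])
  show ?thesis
    by (rule compact_lie_group)
qed

end
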